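(* Let $y_{\rm ac}$ be a solution of the coupling problem, let Assumption (A) hold, and let $\bar f_{T_k}\in\mathbb{R}$ for $k\in\mathscr{K}^c_{\mathscr{T}_h}$ (chosen averages of $f$ on $T_k$). Let $h_{\tilde\omega_k}:=\frac{h_{T_k}+h_{T_{k+1}}}2$ and assume: (i) there is $\kappa\in(\frac12,1)$ with $\kappa\le h_{\tilde\omega_k}/h_{T_k}$ and $\kappa\le h_{\tilde\omega_k}/h_{T_{k+1}}$ for all $k\in\mathscr{K}^c$; (ii) $h_{\tilde\omega_k}^2\|f-\bar f_{\tilde\omega_k}\|^2_{\ell^2_\varepsilon(\mathcal{L}_{T_k}\cup\mathcal{L}_{T_{k+1}})}\le\min\big(\frac\kappa4,\frac{\kappa^2}{(2\kappa-1)^2}\big)(\eta^{\rm cg}_k)^2$ for all $k\in\mathscr{K}^c$; (iii) $$\max_{\substack{p\in\{K_1-1,K_1\}\\ q\in\{K_2,K_2+1\}}}\Big\{\Big|\frac{\nabla y_{\rm ac}|_{T_p}-\nabla y_{\rm ac}|_{T_{p+1}}}{\nabla y_{\rm ac}|_{T_{K_1-2}}-\nabla y_{\rm ac}|_{T_{K_1-1}}}\Big|,\Big|\frac{\nabla y_{\rm ac}|_{T_q}-\nabla y_{\rm ac}|_{T_{q+1}}}{\nabla y_{\rm ac}|_{T_{K_2+2}}-\nabla y_{\rm ac}|_{T_{K_2+3}}}\Big|\Big\}\le3$$ (the denominators being nonzero). Then $$\underline C^{\rm z-cg}\,\eta^{\rm z}\le\eta^{\rm cg}\le\overline C^{\rm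 z-cg}\,\eta^{\rm z},\qquad \underline C^{\rm z-cg}=\frac{(2\kappa-1)m_2^{\rm NN}}{\sqrt2\,\kappa},\quad \overline C^{\rm z-cg}=\frac{10\sqrt{3\kappa}\,M_2^{\rm NN}}{2\kappa-1},$$ where $\eta^{\rm cg}$ is the coarse-graining residual estimator and $\eta^{\rm z}$ the gradient recovery estimator.
   Context: **Lattice.** $N\in\mathbb{N}$, $\varepsilon=1/N$, $F>0$, $\mathcal{L}=\{-N+1,\dots,N\}$. $\mathcal{U}^\varepsilon$ is the space of $2N$-periodic $v:\mathbb{Z}\to\mathbb{R}$ with $\sum_{\ell\in\mathcal{L}}v_\ell=0$; $\mathcal{Y}^\varepsilon=\{y:\ y_\ell=\varepsilon F\ell+v_\ell,\ v\in\mathcal{U}^\varepsilon\}$. $v'_\ell:=(v_\ell-v_{\ell-1})/\varepsilon$; $D_jy_\ell:=(y_{\ell+j}-y_\ell)/\varepsilon$ for $j\in\{1,2,-1,-2\}$, $Dy_\ell:=(D_1y_\ell,D_2y_\ell,D_{-1}y_\ell,D_{-2}y_\ell)$. $\|v\|_{\ell^2_\varepsilon(\mathcal{D})}:=(\varepsilon\sum_{\ell\in\mathcal{D}}|v_\ell|^2)^{1/2}$ (scalars are identified with constant functions). $\operatorname{sgn}(t)=1$ for $t\ge0$ and $-1$ for $t<0$. **Potential.** $V\in C^3((0,\infty)^2\times(-\infty,0)^2;\mathbb{R})$, arguments labelled $(g_1,g_2,g_{-1},g_{-2})$, $\partial_{ij}V=\partial^2V/\partial g_i\partial g_j$. $W(G):=V(G,2G,-G,-2G)$,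 $G>0$. **Mesh.** Nodes $\ell_1<\dots<\ell_K=N$ in $\mathcal{L}$, extended by $\ell_{k+K}=\ell_k+2N$ (node/element indices understood $K$-periodically). $T_k=[\varepsilon\ell_{k-1},\varepsilon\ell_k]$, $h_{T_k}=\varepsilon(\ell_k-\ell_{k-1})$, $\mathcal{L}_{T_k}=\{\ell_{k-1}+1,\dots,\ell_k\}$. $K_1\ge3$, $K_1+2<K_2-1$, $K_2+3\le K$, and $\ell_k-\ell_{k-1}=1$ for $K_1-1\le k\le K_2+2$. $\mathscr{K}^c=\{1,\dots,K_1-2,K_2+2,\dots,K\}$, $\mathscr{K}^i=\{K_1-1,K_1,K_2,K_2+1\}$, $\mathring{\mathscr{K}}^c=\mathscr{K}^c\setminus\{K_1-2,K_2+2\}$, $\mathscr{K}^c_{\mathscr{T}_h}=\mathscr{K}^c\setminus\{K_2+2\}$, $\mathring{\mathscr{K}}^c_{\mathscr{T}_h}=\mathscr{K}^c_{\mathscr{T}_h}\setminus\{K_1-2,K_2+3\}$. $\mathcal{Y}^h$ = those $y\in\mathcal{Y}^\varepsilon$ affine on every $T_k$; $\nabla y|_{T_k}$ is the constant value of $y'_\ell$, $\ell\in\mathcal{L}_{T_k}$. **Coupling problem.** Fix $f\in\mathcal{U}^\varepsilon$. A solution $y_{\rm ac}$ of the coupling problem is a minimizer over $\mathcal{Y}^h$ (with $\nabla y|_{T_k}>0$ for all $k$) of $$E_{\rm ac}(y)=\varepsilon\sum_{k=K_1+1}^{K_2-1}V(Dy_{\ell_k})+\varepsilon\sum_{k\in\{K_1-1,K_1\}}V(D_1y,D_2y,D_{-1}y,2D_{-1}y)_{\ell_k}+\varepsilon\sum_{k\in\{K_2,K_2+1\}}V(D_1y,2D_1y,D_{-1}y,D_{-2}y)_{\ell_k}$$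 $$\qquad+\sum_{k\in\mathscr{K}^c_{\mathscr{T}_h}}h_{T_k}W(\nabla y|_{T_k})+\tfrac\varepsilon2\big[W(\nabla y|_{T_{K_1-1}})+W(\nabla y|_{T_{K_2+2}})\big]-\varepsilon\sum_{\ell\in\mathcal{L}}f_\ell y_\ell .$$ **Coarse-graining estimator.** $(\eta^{\rm cg}_{T_k})^2:=\frac12h_{T_k}^2\|\bar f_{T_k}\|^2_{\ell^2_\varepsilon(\mathcal{L}_{T_k})}$ for $k\in\mathscr{K}^c_{\mathscr{T}_h}$; $\eta^{\rm cg}_k=\frac{\sqrt2}2\sqrt{(\eta^{\rm cg}_{T_k})^2+(\eta^{\rm cg}_{T_{k+1}})^2}$ for $k\in\mathring{\mathscr{K}}^c$, $\eta^{\rm cg}_{K_1-2}=\frac{\sqrt2}2\eta^{\rm cg}_{T_{K_1-2}}$, $\eta^{\rm cg}_{K_2+2}=\frac{\sqrt2}2\eta^{\rm cg}_{T_{K_2+3}}$; $(\eta^{\rm cg})^2:=\sum_{k\in\mathscr{K}^c_{\mathscr{T}_h}}(\eta^{\rm cg}_{T_k})^2=\sum_{k\in\mathscr{K}^c}(\eta^{\rm cg}_k)^2$. The averages on node patches are $\bar f_{\tilde\omega_k}=\operatorname{sgn}\big(\frac{h_{T_k}\bar f_{T_k}+h_{T_{k+1}}\bar f_{T_{k+1}}}{h_{T_k}+h_{T_{k+1}}}\big)\frac{h_{T_k}|\bar f_{T_k}|+h_{T_{k+1}}|\bar f_{T_{k+1}}|}{h_{T_k}+h_{T_{k+1}}}$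 for $k\in\mathring{\mathscr{K}}^c$, $\bar f_{\tilde\omega_{K_1-2}}=\bar f_{T_{K_1-2}}$, $\bar f_{\tilde\omega_{K_2+2}}=\bar f_{T_{K_2+3}}$. **Gradient recovery estimator.** The recovered gradient $Gy_{\rm ac}$ is affine on each element $T_k$, $k\in\mathscr{K}^c\cup\{K_1-1\}$, with nodal values $(Gy_{\rm ac})_{\ell_k}=\frac{h_{T_k}\nabla y_{\rm ac}|_{T_k}+h_{T_{k+1}}\nabla y_{\rm ac}|_{T_{k+1}}}{h_{T_k}+h_{T_{k+1}}}$ for $k\in\mathscr{K}^c$, $(Gy_{\rm ac})_{\ell_{K_1-1}}=\nabla y_{\rm ac}|_{T_{K_1-1}}$, $(Gy_{\rm ac})_{\ell_{K_2+1}}=\nabla y_{\rm ac}|_{T_{K_2+2}}$. With $(\nabla y_{\rm ac})_\ell:=\nabla y_{\rm ac}|_{T_k}$ for $\ell\in\mathcal{L}_{T_k}$, $$\eta^{\rm z}_{T_k}=\begin{cases}\|Gy_{\rm ac}-\nabla y_{\rm ac}\|_{\ell^2_\varepsilon(\mathcal{L}_{T_k})}, & k\in\mathring{\mathscr{K}}^c_{\mathscr{T}_h},\\ \|Gy_{\rm ac}-\nabla y_{\rm ac}\|_{\ell^2_\varepsilon(\mathcal{L}_{T_k}\cup\mathcal{L}_{T_{k+1}})}, & k=K_1-2,\\ \|Gy_{\rm ac}-\nabla y_{\rm ac}\|_{\ell^2_\varepsilon(\mathcal{L}_{T_k}\cup\mathcal{L}_{T_{k-1}})}, & k=K_2+3,\end{cases}\qquad(\eta^{\rm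 z})^2:=\sum_{k\in\mathscr{K}^c_{\mathscr{T}_h}}(\eta^{\rm z}_{T_k})^2 .$$ **Assumption (A).** Let $E\subset\mathbb{R}$ be the closed interval with endpoints the minimum and maximum of $\nabla y_{\rm ac}|_{T_k}$ over $k\in\mathscr{K}^c\cup\mathscr{K}^i\cup\{K_1+1\}$, and $E^{\times4}=E\times2E\times(-E)\times(-2E)$. Put $S_1=\{\pm(1,-1),\pm(2,2)\}$, $S_2=\{\pm(1,2),\pm(2,1),\pm(-2,1),\pm(-1,2)\}$, $S_3=\{\pm(2,-2)\}$, $m_2^{\rm NN}:=\inf_{g\in E^{\times4},\,i=\pm1}|\partial_{ii}V(g)|$, $M_2^{\rm NN}:=\sup_{g\in E^{\times4},\,i=\pm1}|\partial_{ii}V(g)|$. Then: $\sup_{g\in E^{\times4},(i,j)\in S_1}|\partial_{ij}V(g)|\le\frac1{50}m_2^{\rm NN}$; $\sup_{g\in E^{\times4},(i,j)\in S_2}|\partial_{ij}V(g)|\le\frac1{10}\inf_{g\in E^{\times4},(i,j)\in S_1}|\partial_{ij}V(g)|$; $\sup_{g\in E^{\times4},(i,j)\in S_3}|\partial_{ij}V(g)|\le\frac1{10}\inf_{g\in E^{\times4},(i,j)\in S_2}|\partial_{ij}V(g)|$; and $\partial_{ii}V(g)>0$ for $i=\pm1$, $\partial_{jj}V(g)<0$ for $j=\pm2$, for all $g\in E^{\times4}$.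
   Formalization: The formal theorem additionally assumes the reflection symmetry V(g1,g2,g_{-1},g_{-2}) = V(-g_{-1},-g_{-2},-g1,-g2); without it ghost forces at the interfaces can give η^cg = 0 with η^z > 0, so the claim fails. *)

theory Defs
  imports "HOL-Analysis.Analysis"
begin

section \<open>Mesh and lattice functions\<close>

text \<open>
  Lattice functions are functions \<open>int \<Rightarrow> real\<close>. Node and element indices are integers;
  element \<open>k\<close> lies between nodes \<open>k - 1\<close> and \<open>k\<close>, and the node map is defined on all of
  \<open>int\<close> by its quasi-periodic extension, so that index \<open>K + 1\<close> is the periodic copy of index \<open>1\<close>.
\<close>

record mesh =
  mN :: nat
  mK :: int
  mK1 :: int
  mK2 :: int
  node :: "int \<Rightarrow> int"

definition eps :: "mesh \<Rightarrow> real" where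
  "eps M = 1 / real (mN M)"

definition sites :: "mesh \<Rightarrow> int set" where
  "sites M = {- int (mN M) + 1 .. int (mN M)}"

definition valid_mesh :: "mesh \<Rightarrow> bool" where
  "valid_mesh M \<longleftrightarrow>
     0 < mN M \<and>
     strict_mono_on {1..mK M} (node M) \<and>
     node M ` {1..mK M} \<subseteq> sites M \<and>
     node M (mK M) = int (mN M) \<and>
     (\<forall>k. node M (k + mK M) = node M k + 2 * int (mN M)) \<and>
     3 \<le> mK1 M \<and> mK1 M + 2 < mK2 M - 1 \<and> mK2 M + 3 \<le> mK M \<and>
     (\<forall>k\<in>{mK1 M - 1 .. mK2 M + 2}. node M k - node M (k - 1) = 1)"

definition displacements :: "mesh \<Rightarrow> (int \<Rightarrow> real) set" where
  "displacements M =
     {v. (\<forall>l. v (l + 2 * int (mN M)) = v l) \<and> (\<Sum>l\<in>sites M. v l) = 0}"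

definition deformations :: "mesh \<Rightarrow> real \<Rightarrow> (int \<Rightarrow> real) set" where
  "deformations M F =
     {y. \<exists>v\<in>displacements M. \<forall>l. y l = eps M * F * real_of_int l + v l}"

definition bdiff :: "mesh \<Rightarrow> (int \<Rightarrow> real) \<Rightarrow> int \<Rightarrow> real" where
  "bdiff M v l = (v l - v (l - 1)) / eps M"

definition Dq :: "mesh \<Rightarrow> int \<Rightarrow> (int \<Rightarrow> real) \<Rightarrow> int \<Rightarrow> real" where
  "Dq M j y l = (y (l + j) - y l) / eps M"

definition l2norm :: "mesh \<Rightarrow> int set \<Rightarrow> (int \<Rightarrow> real) \<Rightarrow> real" where
  "l2norm M D v = sqrt (eps M * (\<Sum>l\<in>D. \<bar>v l\<bar>\<^sup>2))"

definition hT :: "mesh \<Rightarrow> int \<Rightarrow> real" where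
  "hT M k = eps M * real_of_int (node M k - node M (k - 1))"

definition elem_sites :: "mesh \<Rightarrow> int \<Rightarrow> int set" where
  "elem_sites M k = {node M (k - 1) + 1 .. node M k}"

definition h_patch :: "mesh \<Rightarrow> int \<Rightarrow> real" where
  "h_patch M k = (hT M k + hT M (k + 1)) / 2"

definition Kc :: "mesh \<Rightarrow> int set" where
  "Kc M = {1 .. mK1 M - 2} \<union> {mK2 M + 2 .. mK M}"

definition Ki :: "mesh \<Rightarrow> int set" where
  "Ki M = {mK1 M - 1, mK1 M, mK2 M, mK2 M + 1}"

definition KcT :: "mesh \<Rightarrow> int set" where
  "KcT M = Kc M - {mK2 M + 2}"

definition deformations_h :: "mesh \<Rightarrow> real \<Rightarrow> (int \<Rightarrow> real) set" where
  "deformations_h M F =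
     {y \<in> deformations M F.
        \<forall>k. \<exists>a b. \<forall>l\<in>{node M (k - 1) .. node M k}. y l = a + b * (eps M * real_of_int l)}"

text \<open>
  For \<open>y\<close> in \<^const>\<open>deformations_h\<close> the backward difference is constant on \<open>elem_sites M k\<close>;
  its value is read off at the site \<open>node M k\<close>, which belongs to \<open>elem_sites M k\<close>.
\<close>

definition grad :: "mesh \<Rightarrow> (int \<Rightarrow> real) \<Rightarrow> int \<Rightarrow> real" where
  "grad M y k = bdiff M y (node M k)"


section \<open>Interaction potential\<close>

text \<open>
  The arguments \<open>(g\<^sub>1, g\<^sub>2, g\<^sub>-\<^sub>1, g\<^sub>-\<^sub>2)\<close> are the components \<open>1, 2, 3, 4\<close> of a vector in
  \<open>real^4\<close>; \<open>slot\<close> translates the labels \<open>1, 2, -1, -2\<close> into components.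
\<close>

definition slot :: "int \<Rightarrow> 4" where
  "slot j = (if j = 1 then 1 else if j = 2 then 2 else if j = - 1 then 3 else 4)"

lemma vector_4:
  fixes a b c d :: real
  defines "g \<equiv> (vector [a, b, c, d] :: real^4)"
  shows "g $ slot 1 = a" "g $ slot 2 = b" "g $ slot (- 1) = c" "g $ slot (- 2) = d"
  by (simp_all add: g_def vector_def slot_def)

definition partial :: "'n::finite \<Rightarrow> (real^'n \<Rightarrow> real) \<Rightarrow> real^'n \<Rightarrow> real" where
  "partial i \<phi> g = deriv (\<lambda>t. \<phi> (g + t *\<^sub>R axis i 1)) 0"

definition partial2 :: "(real^4 \<Rightarrow> real) \<Rightarrow> int \<Rightarrow> int \<Rightarrow> real^4 \<Rightarrow> real" where
  "partial2 V i j = partial (slot i) (partial (slot j) V)"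

text \<open>\<open>C\<^sup>k\<close> on an open set: all partial derivatives up to order \<open>k\<close> exist and are continuous.\<close>

primrec Ck_on :: "nat \<Rightarrow> (real^'n::finite) set \<Rightarrow> (real^'n \<Rightarrow> real) \<Rightarrow> bool" where
  "Ck_on 0 S \<phi> = continuous_on S \<phi>"
| "Ck_on (Suc k) S \<phi> =
     (continuous_on S \<phi> \<and>
      (\<forall>i. (\<forall>g\<in>S. (\<lambda>t. \<phi> (g + t *\<^sub>R axis i 1)) field_differentiable at 0) \<and>
           Ck_on k S (partial i \<phi>)))"

definition V_dom :: "(real^4) set" where
  "V_dom = {g. 0 < g $ slot 1 \<and> 0 < g $ slot 2 \<and> g $ slot (- 1) < 0 \<and> g $ slot (- 2) < 0}"

text \<open>
  Invariance of the site energy under reflection of the chain, which exchanges the left and the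
  right neighbours and reverses the sign of all differences. It yields
  \<open>\<partial>\<^sub>1V + 2\<partial>\<^sub>2V + \<partial>\<^sub>-\<^sub>1V + 2\<partial>\<^sub>-\<^sub>2V = 0\<close> at \<open>(G, 2G, -G, -2G)\<close>, without which
  the coupled energy below has ghost forces at the two interfaces: adding
  \<open>c (g\<^sub>1 + g\<^sub>-\<^sub>1)\<close> to \<open>V\<close> changes neither \<open>W\<close> nor any second derivative of \<open>V\<close>, but adds
  \<open>c \<epsilon> (\<nabla>y|T\<^sub>p - \<nabla>y|T\<^sub>q)\<close>, \<open>p = K\<^sub>2 + 2\<close>, \<open>q = K\<^sub>1 - 1\<close>, to \<open>E_ac\<close>.
\<close>

definition reflection_symmetric :: "(real^4 \<Rightarrow> real) \<Rightarrow> bool" where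
  "reflection_symmetric V \<longleftrightarrow>
     (\<forall>a b c d. vector [a, b, c, d] \<in> V_dom \<longrightarrow>
        V (vector [a, b, c, d]) = V (vector [- c, - d, - a, - b]))"

definition W :: "(real^4 \<Rightarrow> real) \<Rightarrow> real \<Rightarrow> real" where
  "W V G = V (vector [G, 2 * G, - G, - 2 * G])"


section \<open>Coupling problem\<close>

definition E_ac :: "mesh \<Rightarrow> (real^4 \<Rightarrow> real) \<Rightarrow> (int \<Rightarrow> real) \<Rightarrow> (int \<Rightarrow> real) \<Rightarrow> real" where
  "E_ac M V f y =
     eps M * (\<Sum>k = mK1 M + 1 .. mK2 M - 1.
        V (vector [Dq M 1 y (node M k), Dq M 2 y (node M k),
                   Dq M (- 1) y (node M k), Dq M (- 2) y (node M k)]))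
   + eps M * (\<Sum>k\<in>{mK1 M - 1, mK1 M}.
        V (vector [Dq M 1 y (node M k), Dq M 2 y (node M k),
                   Dq M (- 1) y (node M k), 2 * Dq M (- 1) y (node M k)]))
   + eps M * (\<Sum>k\<in>{mK2 M, mK2 M + 1}.
        V (vector [Dq M 1 y (node M k), 2 * Dq M 1 y (node M k),
                   Dq M (- 1) y (node M k), Dq M (- 2) y (node M k)]))
   + (\<Sum>k\<in>KcT M. hT M k * W V (grad M y k))
   + eps M / 2 * (W V (grad M y (mK1 M - 1)) + W V (grad M y (mK2 M + 2)))
   - eps M * (\<Sum>l\<in>sites M. f l * y l)"

definition admissible :: "mesh \<Rightarrow> real \<Rightarrow> (int \<Rightarrow> real) set" where
  "admissible M F = {y \<in> deformations_h M F. \<forall>k. 0 < grad M y k}"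

definition coupling_solution ::
  "mesh \<Rightarrow> real \<Rightarrow> (real^4 \<Rightarrow> real) \<Rightarrow> (int \<Rightarrow> real) \<Rightarrow> (int \<Rightarrow> real) \<Rightarrow> bool" where
  "coupling_solution M F V f y \<longleftrightarrow>
     y \<in> admissible M F \<and> (\<forall>z\<in>admissible M F. E_ac M V f y \<le> E_ac M V f z)"


section \<open>Coarse-graining estimator\<close>

text \<open>
  In this section \<open>fb k\<close> is the average chosen on element \<open>k\<close>. As element indices are periodic,
  \<open>fb\<close> is meant to be \<open>mK M\<close>-periodic (index \<open>mK M + 1\<close> does occur).
\<close>

definition eta_cg_T :: "mesh \<Rightarrow> (int \<Rightarrow> real) \<Rightarrow> int \<Rightarrow> real" where
  "eta_cg_T M fb k = sqrt (1 / 2 * (hT M k)\<^sup>2 * (l2norm M (elem_sites M k) (\<lambda>_. fb k))\<^sup>2)"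

definition eta_cg_node :: "mesh \<Rightarrow> (int \<Rightarrow> real) \<Rightarrow> int \<Rightarrow> real" where
  "eta_cg_node M fb k =
     (if k = mK1 M - 2 then sqrt 2 / 2 * eta_cg_T M fb (mK1 M - 2)
      else if k = mK2 M + 2 then sqrt 2 / 2 * eta_cg_T M fb (mK2 M + 3)
      else sqrt 2 / 2 * sqrt ((eta_cg_T M fb k)\<^sup>2 + (eta_cg_T M fb (k + 1))\<^sup>2))"

definition eta_cg :: "mesh \<Rightarrow> (int \<Rightarrow> real) \<Rightarrow> real" where
  "eta_cg M fb = sqrt (\<Sum>k\<in>KcT M. (eta_cg_T M fb k)\<^sup>2)"

text \<open>Unlike \<^const>\<open>sgn\<close>, this sign function takes the value 1 at 0.\<close>

definition sgn1 :: "real \<Rightarrow> real" where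
  "sgn1 t = (if 0 \<le> t then 1 else - 1)"

definition fb_patch :: "mesh \<Rightarrow> (int \<Rightarrow> real) \<Rightarrow> int \<Rightarrow> real" where
  "fb_patch M fb k =
     (if k = mK1 M - 2 then fb (mK1 M - 2)
      else if k = mK2 M + 2 then fb (mK2 M + 3)
      else sgn1 ((hT M k * fb k + hT M (k + 1) * fb (k + 1)) / (hT M k + hT M (k + 1)))
           * ((hT M k * \<bar>fb k\<bar> + hT M (k + 1) * \<bar>fb (k + 1)\<bar>) / (hT M k + hT M (k + 1))))"


section \<open>Gradient recovery estimator\<close>

text \<open>
  The sets \<open>elem_sites M k\<close> partition the integers; \<open>elem M l\<close> is the index of the element containing \<open>l\<close>.
  Node \<open>0\<close>, the left end of element \<open>1\<close>, is the periodic copy of node \<open>mK M\<close>, and the weighted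
  average below is periodic in \<open>k\<close>.
\<close>

definition elem :: "mesh \<Rightarrow> int \<Rightarrow> int" where
  "elem M l = (THE k. l \<in> elem_sites M k)"

definition G_node :: "mesh \<Rightarrow> (int \<Rightarrow> real) \<Rightarrow> int \<Rightarrow> real" where
  "G_node M y k =
     (if k = mK1 M - 1 then grad M y (mK1 M - 1)
      else if k = mK2 M + 1 then grad M y (mK2 M + 2)
      else (hT M k * grad M y k + hT M (k + 1) * grad M y (k + 1)) / (hT M k + hT M (k + 1)))"

definition G_rec :: "mesh \<Rightarrow> (int \<Rightarrow> real) \<Rightarrow> int \<Rightarrow> real" where
  "G_rec M y l =
     (let k = elem M l;
          t = real_of_int (l - node M (k - 1)) / real_of_int (node M k - node M (k - 1))
      in (1 - t) * G_node M y (k - 1) + t * G_node M y k)"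

definition grad_site :: "mesh \<Rightarrow> (int \<Rightarrow> real) \<Rightarrow> int \<Rightarrow> real" where
  "grad_site M y l = grad M y (elem M l)"

definition eta_z_T :: "mesh \<Rightarrow> (int \<Rightarrow> real) \<Rightarrow> int \<Rightarrow> real" where
  "eta_z_T M y k =
     l2norm M
       (if k = mK1 M - 2 then elem_sites M k \<union> elem_sites M (k + 1)
        else if k = mK2 M + 3 then elem_sites M k \<union> elem_sites M (k - 1)
        else elem_sites M k)
       (\<lambda>l. G_rec M y l - grad_site M y l)"

definition eta_z :: "mesh \<Rightarrow> (int \<Rightarrow> real) \<Rightarrow> real" where
  "eta_z M y = sqrt (\<Sum>k\<in>KcT M. (eta_z_T M y k)\<^sup>2)"


section \<open>Assumption on the second derivatives\<close>

definition E_int :: "mesh \<Rightarrow> (int \<Rightarrow> real) \<Rightarrow> real set" where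
  "E_int M y =
     (let R = grad M y ` (Kc M \<union> Ki M \<union> {mK1 M + 1}) in {Min R .. Max R})"

definition E4 :: "mesh \<Rightarrow> (int \<Rightarrow> real) \<Rightarrow> (real^4) set" where
  "E4 M y =
     {vector [a, 2 * b, - c, - 2 * d] | a b c d.
        a \<in> E_int M y \<and> b \<in> E_int M y \<and> c \<in> E_int M y \<and> d \<in> E_int M y}"

definition S1 :: "(int \<times> int) set" where
  "S1 = {(1, - 1), (- 1, 1), (2, 2), (- 2, - 2)}"

definition S2 :: "(int \<times> int) set" where
  "S2 = {(1, 2), (- 1, - 2), (2, 1), (- 2, - 1), (- 2, 1), (2, - 1), (- 1, 2), (1, - 2)}"

definition S3 :: "(int \<times> int) set" where
  "S3 = {(2, - 2), (- 2, 2)}"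

definition sup_d2 :: "(real^4 \<Rightarrow> real) \<Rightarrow> (real^4) set \<Rightarrow> (int \<times> int) set \<Rightarrow> real" where
  "sup_d2 V B S = (SUP (g, (i, j)) \<in> B \<times> S. \<bar>partial2 V i j g\<bar>)"

definition inf_d2 :: "(real^4 \<Rightarrow> real) \<Rightarrow> (real^4) set \<Rightarrow> (int \<times> int) set \<Rightarrow> real" where
  "inf_d2 V B S = (INF (g, (i, j)) \<in> B \<times> S. \<bar>partial2 V i j g\<bar>)"

definition m2NN :: "(real^4 \<Rightarrow> real) \<Rightarrow> (real^4) set \<Rightarrow> real" where
  "m2NN V B = inf_d2 V B {(1, 1), (- 1, - 1)}"

definition M2NN :: "(real^4 \<Rightarrow> real) \<Rightarrow> (real^4) set \<Rightarrow> real" where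
  "M2NN V B = sup_d2 V B {(1, 1), (- 1, - 1)}"

definition assumption_A :: "mesh \<Rightarrow> (real^4 \<Rightarrow> real) \<Rightarrow> (int \<Rightarrow> real) \<Rightarrow> bool" where
  "assumption_A M V y \<longleftrightarrow>
     sup_d2 V (E4 M y) S1 \<le> 1 / 50 * m2NN V (E4 M y) \<and>
     sup_d2 V (E4 M y) S2 \<le> 1 / 10 * inf_d2 V (E4 M y) S1 \<and>
     sup_d2 V (E4 M y) S3 \<le> 1 / 10 * inf_d2 V (E4 M y) S2 \<and>
     (\<forall>g\<in>E4 M y. (\<forall>i\<in>{1, - 1}. 0 < partial2 V i i g) \<and> (\<forall>j\<in>{2, - 2}. partial2 V j j g < 0))"

end

theory Submission
  imports Defs
begin

text \<open>
  Testing the first-order optimality condition with the hat function of a node \<open>k\<close> of the continuum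
  region gives \<open>W'(G\<^sub>k) - W'(G\<^sub>k\<^sub>+\<^sub>1) + r\<^sub>k = \<langle>f, hat\<^sub>k\<rangle>\<close>, where \<open>G\<^sub>k\<close> is the gradient on element \<open>k\<close> and the
  interface term \<open>r\<^sub>k\<close> occurs only at the two outermost nodes; there it is a difference of first
  derivatives of \<open>V\<close>, by the reflection symmetry, and small compared with the jump by (iii).
  Hence by Assumption (A) the load \<open>\<langle>f, hat\<^sub>k\<rangle>\<close> is comparable with the jump \<open>G\<^sub>k - G\<^sub>k\<^sub>+\<^sub>1\<close>. By (ii) the
  load is also comparable with the nodal coarse-graining estimator, while the error of the
  recovered gradient on an element is a quadratic form in the jumps at the two end nodes.
\<close>


section \<open>First and second derivatives of the potential\<close>

text \<open>Both estimators are brought into the form of a sum over \<open>Kc M\<close> whose k-th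
  term belongs to node k: \<open>eta_cg\<close> by giving each end node of an element half of its
  square, \<open>eta_z\<close> by matching element k with its right end node. In the site sums the
  right end of an element counts and the left end does not, so a one-site element sees only its
  right node; the surplus terms at the interfaces therefore vanish when sums are regrouped by nodes,
  and the comparison is made node by node. The interfaces cost accuracy: there the load deviates
  from the jump of W' by up to 0.0936 m times the jump of the gradient. This is paid for by the
  outermost patches, whose average comes from a single element of at least the patch size, so that
  the load is bounded below with \<kappa>^3 in place of \<kappa>/4. The constants of the theorem are
  the square roots of the nodewise ones, 2 (\<kappa>/(2\<kappa>-1))^2 / m^2 for \<open>eta_z\<close>
  against \<open>eta_cg\<close> and 300 \<kappa> \<open>Mx\<close>^2 / (2\<kappa>-1)^2 in the other
  direction.\<close>

lemma has_derivative_continuous_partials: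
  fixes \<phi> :: "real^'n::finite \<Rightarrow> real"
  assumes S: "open S" "g \<in> S"
    and diff: "\<And>i x. x \<in> S \<Longrightarrow> (\<lambda>t. \<phi> (x + t *\<^sub>R axis i 1)) field_differentiable at 0"
    and cont: "\<And>i. continuous_on S (partial i \<phi>)"
  shows "(\<phi> has_derivative (\<lambda>h. \<Sum>i\<in>UNIV. h $ i * partial i \<phi> g)) (at g)"
proof -
  \<comment> \<open>Coordinates outside \<open>I\<close> stay frozen at those of \<open>g\<close>.
    Enlarging \<open>I\<close> by one coordinate at a time leads from \<open>g\<close> to
    \<open>g + h\<close> along axis-parallel segments, the only directions in which
    differentiability is given.\<close>
  define P where "P I h = (\<Sum>i\<in>I. (h $ i) *\<^sub>R axis i (1::real))" for I and h :: "real^'n"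
  have P_nth: "P I h $ j = (if j \<in> I then h $ j else 0)" for I h j
    by (simp add: P_def axis_def if_distrib sum.delta cong: if_cong)
  have deriv_line: "((\<lambda>t. \<phi> (x + t *\<^sub>R axis i 1)) has_real_derivative partial i \<phi> (x + t *\<^sub>R axis i 1)) (at t)"
    if "x + t *\<^sub>R axis i 1 \<in> S" for x t i
  proof -
    have "((\<lambda>s. \<phi> ((x + t *\<^sub>R axis i 1) + s *\<^sub>R axis i 1)) has_real_derivative partial i \<phi> (x + t *\<^sub>R axis i 1)) (at 0)"
      unfolding partial_def using diff[OF that] DERIV_deriv_iff_field_differentiable by blast
    then have "((\<lambda>s. \<phi> (x + (t + s) *\<^sub>R axis i 1)) has_real_derivative partial i \<phi> (x + t *\<^sub>R axis i 1)) (at 0)"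
      by (simp add: algebra_simps)
    then show ?thesis
      using DERIV_shift[of "\<lambda>s. \<phi> (x + s *\<^sub>R axis i 1)" "partial i \<phi> (x + t *\<^sub>R axis i 1)" 0 t]
      by (simp add: add.commute)
  qed
  have main: "\<exists>d>0. \<forall>h. norm h < d \<longrightarrow>
      \<bar>\<phi> (g + P I h) - \<phi> g - (\<Sum>i\<in>I. h $ i * partial i \<phi> g)\<bar> \<le> e * (\<Sum>i\<in>I. \<bar>h $ i\<bar>)"
    if "finite I" "0 < e" for I e
    using that
  proof (induction I rule: finite_induct)
    case empty
    then show ?case by (auto simp: P_def intro!: exI[of _ 1])
  next
    case (insert j I)
    obtain d1 where d1: "d1 > 0" and IH: "\<And>h. norm h < d1 \<Longrightarrow>
      \<bar>\<phi> (g + P I h) - \<phi> g - (\<Sum>i\<in>I. h $ i * partial i \<phi> g)\<bar> \<le> e * (\<Sum>i\<in>I. \<bar>h $ i\<bar>)"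
      using insert by blast
    obtain d2 where d2: "d2 > 0" "\<And>x. dist x g < d2 \<Longrightarrow> x \<in> S"
      using S open_dist by metis
    have "continuous (at g) (partial j \<phi>)"
      using cont S continuous_on_eq_continuous_at by blast
    then obtain d3 where d3: "d3 > 0" "\<And>x. dist x g < d3 \<Longrightarrow> dist (partial j \<phi> x) (partial j \<phi> g) < e"
      using \<open>0 < e\<close> unfolding continuous_at_eps_delta by metis
    show ?case
    proof (intro exI[of _ "min d1 (min d2 d3)"] conjI allI impI)
      show "0 < min d1 (min d2 d3)" using d1 d2 d3 by simp
      fix h :: "real^'n" assume h: "norm h < min d1 (min d2 d3)"
      let ?x = "\<lambda>t. (g + P I h) + t *\<^sub>R axis j (1::real)"
      \<comment> \<open>No component of the displacement exceeds that of \<open>h\<close>, so the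
        whole segment stays in the ball on which the j-th partial derivative is
        \<open>e\<close>-close to its value at \<open>g\<close>.\<close>
      have near: "dist (?x (s * h $ j)) g \<le> norm h" if "0 \<le> s" "s \<le> 1" for s
      proof -
        have "dist (?x (s * h $ j)) g = norm (P I h + (s * h $ j) *\<^sub>R axis j (1::real))"
          by (simp add: dist_norm algebra_simps)
        also have "\<dots> \<le> norm h"
        proof (rule norm_le_componentwise_cart)
          fix i
          have "\<bar>s * h $ j\<bar> \<le> \<bar>h $ j\<bar>"
            using that by (simp add: abs_mult mult_left_le_one_le)
          then show "norm ((P I h + (s * h $ j) *\<^sub>R axis j 1) $ i) \<le> norm (h $ i)"
            using insert.hyps(2) by (auto simp: P_nth axis_def)
        qed
        finally show ?thesis .
      qed
      have "\<exists>z. \<bar>z - partial j \<phi> g\<bar> \<le> e \<and> \<phi> (?x (1 * h $ j)) - \<phi> (?x (0 * h $ j)) = h $ j * z"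
      proof -
        have "((\<lambda>s. \<phi> (?x (s * h $ j))) has_real_derivative (h $ j * partial j \<phi> (?x (s * h $ j)))) (at s)"
          if "0 \<le> s" "s \<le> 1" for s
        proof -
          have "((\<lambda>t. \<phi> (?x t)) has_real_derivative partial j \<phi> (?x (s * h $ j))) (at (s * h $ j))"
            using deriv_line d2 near[OF that] h by force
          then have "((\<lambda>s. (\<lambda>t. \<phi> (?x t)) (s * h $ j)) has_real_derivative (partial j \<phi> (?x (s * h $ j)) * h $ j)) (at s)"
            by (rule DERIV_chain2) (auto intro!: derivative_eq_intros)
          then show ?thesis by (simp add: mult.commute)
        qed
        then obtain s where s: "0 < s" "s < 1"
            "\<phi> (?x (1 * h $ j)) - \<phi> (?x (0 * h $ j)) = (1 - 0) * (h $ j * partial j \<phi> (?x (s * h $ j)))"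
          using MVT2[of 0 1 "\<lambda>s. \<phi> (?x (s * h $ j))" "\<lambda>s. h $ j * partial j \<phi> (?x (s * h $ j))"]
          by auto
        have "dist (?x (s * h $ j)) g < d3" using near[of s] s h by simp
        then have "\<bar>partial j \<phi> (?x (s * h $ j)) - partial j \<phi> g\<bar> \<le> e"
          using d3 by (fastforce simp: dist_real_def)
        then show ?thesis using s by auto
      qed
      then obtain z where z: "\<bar>z - partial j \<phi> g\<bar> \<le> e"
        "\<phi> (g + P I h + (h $ j) *\<^sub>R axis j 1) - \<phi> (g + P I h) = h $ j * z" by auto
      have "P (insert j I) h = P I h + (h $ j) *\<^sub>R axis j 1"
        using insert.hyps by (simp add: P_def add.commute)
      then have "\<phi> (g + P (insert j I) h) = \<phi> (g + P I h) + h $ j * z"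
        using z(2) by (simp add: add.assoc)
      then have "\<phi> (g + P (insert j I) h) - \<phi> g - (\<Sum>i\<in>insert j I. h $ i * partial i \<phi> g)
          = (\<phi> (g + P I h) - \<phi> g - (\<Sum>i\<in>I. h $ i * partial i \<phi> g)) + h $ j * (z - partial j \<phi> g)"
        using insert.hyps by (simp add: algebra_simps)
      moreover have "\<bar>h $ j * (z - partial j \<phi> g)\<bar> \<le> e * \<bar>h $ j\<bar>"
        using mult_left_mono[OF z(1), of "\<bar>h $ j\<bar>"] by (simp add: abs_mult mult.commute)
      ultimately show "\<bar>\<phi> (g + P (insert j I) h) - \<phi> g - (\<Sum>i\<in>insert j I. h $ i * partial i \<phi> g)\<bar>
          \<le> e * (\<Sum>i\<in>insert j I. \<bar>h $ i\<bar>)"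
        using IH[of h] h insert.hyps by (simp add: distrib_left)
    qed
  qed
  have P_UNIV: "P UNIV h = h" for h by (simp add: vec_eq_iff P_nth)
  show ?thesis
    unfolding has_derivative_within_alt
  proof (intro conjI allI impI)
    show "bounded_linear (\<lambda>h. \<Sum>i\<in>UNIV. h $ i * partial i \<phi> g)"
      by (intro bounded_linear_sum bounded_linear_mult_left[THEN bounded_linear_compose] bounded_linear_vec_nth)
    fix e :: real assume e: "0 < e"
    \<comment> \<open>The induction produces the sum of the moduli of the components, which is at
      most \<open>CARD('n)\<close> times the Euclidean norm.\<close>
    define c where "c = real CARD('n)"
    have c: "c > 0" by (simp add: c_def)
    obtain d where d: "d > 0" "\<And>h. norm h < d \<Longrightarrow>
      \<bar>\<phi> (g + P UNIV h) - \<phi> g - (\<Sum>i\<in>UNIV. h $ i * partial i \<phi> g)\<bar> \<le> e / c * (\<Sum>i\<in>UNIV. \<bar>h $ i\<bar>)"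
      using main[of UNIV "e / c"] e c by auto
    show "\<exists>d>0. \<forall>y\<in>UNIV. norm (y - g) < d \<longrightarrow>
        norm (\<phi> y - \<phi> g - (\<Sum>i\<in>UNIV. (y - g) $ i * partial i \<phi> g)) \<le> e * norm (y - g)"
    proof (intro exI[of _ d] conjI ballI impI)
      fix y assume y: "norm (y - g) < d"
      have "\<bar>\<phi> y - \<phi> g - (\<Sum>i\<in>UNIV. (y - g) $ i * partial i \<phi> g)\<bar> \<le> e / c * (\<Sum>i\<in>UNIV. \<bar>(y - g) $ i\<bar>)"
        using d(2)[OF y] by (simp only: P_UNIV) simp
      also have "\<dots> \<le> e / c * (\<Sum>i\<in>(UNIV::'n set). norm (y - g))"
        using e c by (intro mult_left_mono sum_mono component_le_norm_cart) auto
      also have "\<dots> = e * norm (y - g)" using c by (simp add: c_def)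
      finally show "norm (\<phi> y - \<phi> g - (\<Sum>i\<in>UNIV. (y - g) $ i * partial i \<phi> g)) \<le> e * norm (y - g)" by simp
    qed (use d in auto)
  qed
qed

lemma Ck_on_continuous: "Ck_on k S \<phi> \<Longrightarrow> continuous_on S \<phi>"
  by (cases k) auto

lemma Ck_on_has_derivative:
  assumes "Ck_on (Suc k) S \<phi>" "open S" "g \<in> S"
  shows "(\<phi> has_derivative (\<lambda>h. \<Sum>i\<in>UNIV. h $ i * partial i \<phi> g)) (at g)"
  using assms by (intro has_derivative_continuous_partials[of S]) (auto dest: Ck_on_continuous)

text \<open>Changing one gradient changes several arguments of \<open>V\<close> at once, so oblique
  directions \<open>d\<close> are needed; \<open>Ck_on\<close> by itself speaks only of the
  axes.\<close>

lemma Ck_on_line_derivative: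
  assumes "Ck_on (Suc k) S \<phi>" "open S" "p + t *\<^sub>R d \<in> S"
  shows "((\<lambda>s. \<phi> (p + s *\<^sub>R d)) has_real_derivative
           (\<Sum>i\<in>UNIV. d $ i * partial i \<phi> (p + t *\<^sub>R d))) (at t)"
proof -
  have "((\<lambda>s. p + s *\<^sub>R d) has_derivative (\<lambda>s. s *\<^sub>R d)) (at t)"
    by (auto intro!: derivative_eq_intros)
  from has_derivative_compose[OF this Ck_on_has_derivative[OF assms]]
  show ?thesis
    unfolding has_field_derivative_def
    by (rule has_derivative_eq_rhs) (simp add: fun_eq_iff sum_distrib_left mult_ac)
qed

lemma Ck_on_mvt:
  assumes "Ck_on (Suc k) S \<phi>" "open S" "convex B" "B \<subseteq> S" "p \<in> B" "q \<in> B"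
  shows "\<exists>z\<in>B. \<phi> q - \<phi> p = (\<Sum>i\<in>UNIV. (q - p) $ i * partial i \<phi> z)"
proof -
  have in_B: "p + t *\<^sub>R (q - p) \<in> B" if "0 \<le> t" "t \<le> 1" for t
    using convexD_alt[OF assms(3,5,6) that] by (simp add: algebra_simps)
  have "((\<lambda>s. \<phi> (p + s *\<^sub>R (q - p))) has_real_derivative
           (\<Sum>i\<in>UNIV. (q - p) $ i * partial i \<phi> (p + t *\<^sub>R (q - p)))) (at t)" if "0 \<le> t" "t \<le> 1" for t
    using in_B[OF that] assms by (intro Ck_on_line_derivative[of k S]) auto
  then obtain t where "0 < t" "t < 1"
    "\<phi> (p + 1 *\<^sub>R (q - p)) - \<phi> (p + 0 *\<^sub>R (q - p)) = (1 - 0) * (\<Sum>i\<in>UNIV. (q - p) $ i * partial i \<phi> (p + t *\<^sub>R (q - p)))"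
    using MVT2[of 0 1 "\<lambda>s. \<phi> (p + s *\<^sub>R (q - p))" "\<lambda>t. \<Sum>i\<in>UNIV. (q - p) $ i * partial i \<phi> (p + t *\<^sub>R (q - p))"]
    by auto
  then show ?thesis using in_B[of t] by (intro bexI[of _ "p + t *\<^sub>R (q - p)"]) auto
qed

lemma sum_slot:
  "(\<Sum>i\<in>(UNIV::4 set). c i) = c (slot 1) + c (slot 2) + c (slot (- 1)) + c (slot (- 2))"
  by (simp add: slot_def sum_4)

lemma slot_eq: "slot 1 = 1" "slot 2 = 2" "slot (- 1) = 3" "slot (- 2) = 4"
  by (simp_all add: slot_def)

lemma vec4_nth:
  fixes a b c d :: real
  defines "g \<equiv> (vector [a, b, c, d] :: real^4)"
  shows "g $ 1 = a" "g $ 2 = b" "g $ 3 = c" "g $ 4 = d"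
  using vector_4[of a b c d] by (simp_all add: g_def slot_eq)

lemma vec4_eqI:
  fixes p q :: "real^4"
  shows "p $ 1 = q $ 1 \<Longrightarrow> p $ 2 = q $ 2 \<Longrightarrow> p $ 3 = q $ 3 \<Longrightarrow> p $ 4 = q $ 4 \<Longrightarrow> p = q"
  by (simp add: vec_eq_iff forall_4)

lemma open_V_dom: "open V_dom"
proof -
  have eq: "V_dom = {g. 0 < g $ 1} \<inter> {g. 0 < g $ 2} \<inter> {g. g $ 3 < 0} \<inter> {g. g $ 4 < 0}"
    by (auto simp: V_dom_def slot_eq)
  show ?thesis
    unfolding eq by (intro open_Int open_halfspace_component_lt_cart open_halfspace_component_gt_cart)
qed

lemma vector_V_dom: "vector [a, b, c, d] \<in> V_dom \<longleftrightarrow> 0 < a \<and> 0 < b \<and> c < 0 \<and> d < 0"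
  by (simp add: V_dom_def slot_eq vec4_nth)

lemma V_curve_derivative:
  assumes "Ck_on (Suc k) V_dom V" "vector [a, b, c, d] \<in> V_dom"
  shows "((\<lambda>t. V (vector [a + t * a', b + t * b', c + t * c', d + t * d'])) has_real_derivative
     a' * partial (slot 1) V (vector [a, b, c, d]) + b' * partial (slot 2) V (vector [a, b, c, d])
     + c' * partial (slot (- 1)) V (vector [a, b, c, d]) + d' * partial (slot (- 2)) V (vector [a, b, c, d])) (at 0)"
proof -
  have "vector [a + t * a', b + t * b', c + t * c', d + t * d']
      = (vector [a, b, c, d] :: real^4) + t *\<^sub>R vector [a', b', c', d']" for t
    by (rule vec4_eqI) (simp_all add: vec4_nth)
  then show ?thesis
    using Ck_on_line_derivative[OF assms(1) open_V_dom, of "vector [a, b, c, d]" 0 "vector [a', b', c', d']"] assms(2)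
    by (simp add: sum_slot vec4_nth slot_eq)
qed

definition diag4 :: "real \<Rightarrow> real^4" where
  "diag4 G = vector [G, 2 * G, - G, - 2 * G]"

lemma diag4_V_dom: "0 < G \<Longrightarrow> diag4 G \<in> V_dom"
  by (simp add: diag4_def vector_V_dom)

text \<open>\<open>diag4 G\<close> is a fixed point of the reflection, and a step t along one axis
  there is mirrored to a step -t along the partner axis. Differentiating the symmetry at t = 0 gives
  the sign change.\<close>

lemma partial_reflection:
  assumes sym: "reflection_symmetric V" and C: "Ck_on (Suc k) V_dom V" and G: "0 < G"
  shows "partial (slot (- 1)) V (diag4 G) = - partial (slot 1) V (diag4 G)"
    and "partial (slot (- 2)) V (diag4 G) = - partial (slot 2) V (diag4 G)"
proof -
  have key: "partial i V (diag4 G) = - partial j V (diag4 G)"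
    if "\<And>t. diag4 G + t *\<^sub>R axis i 1 \<in> V_dom \<Longrightarrow>
          V (diag4 G + t *\<^sub>R axis i 1) = V (diag4 G + (- t) *\<^sub>R axis j 1)" for i j
  proof -
    have d: "((\<lambda>s. V (diag4 G + s *\<^sub>R axis i 1)) has_real_derivative partial i V (diag4 G)) (at 0)" for i
    proof -
      have "(\<Sum>j\<in>UNIV. axis i 1 $ j * c j) = (\<Sum>j\<in>UNIV. if j = i then c j else 0)" for c :: "4 \<Rightarrow> real"
        by (rule sum.cong) (auto simp: axis_def)
      then have "(\<Sum>j\<in>UNIV. axis i 1 $ j * c j) = c i" for c :: "4 \<Rightarrow> real"
        by simp
      then show ?thesis
        using Ck_on_line_derivative[OF C open_V_dom, of "diag4 G" 0 "axis i 1"] diag4_V_dom[OF G] by simp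
    qed
    have "((\<lambda>t. V (diag4 G + (- t) *\<^sub>R axis j 1)) has_real_derivative - partial j V (diag4 G)) (at 0)"
      using d[of j] by (subst DERIV_mirror[symmetric]) simp
    \<comment> \<open>The symmetry is given on \<open>V_dom\<close> only; openness of
      \<open>V_dom\<close> makes it available for small t, which suffices for derivatives.\<close>
    moreover have "\<forall>\<^sub>F t in nhds 0. V (diag4 G + t *\<^sub>R axis i 1) = V (diag4 G + (- t) *\<^sub>R axis j 1)"
    proof -
      have "open ((\<lambda>t::real. diag4 G + t *\<^sub>R axis i 1) -` V_dom)"
        by (rule open_vimage[OF open_V_dom]) (intro continuous_intros)
      moreover have "0 \<in> (\<lambda>t::real. diag4 G + t *\<^sub>R axis i 1) -` V_dom"
        using diag4_V_dom[OF G] by simp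
      ultimately have "\<forall>\<^sub>F t in nhds 0. t \<in> (\<lambda>t::real. diag4 G + t *\<^sub>R axis i 1) -` V_dom"
        using eventually_nhds_in_open by blast
      then show ?thesis by (rule eventually_mono) (rule that, simp)
    qed
    ultimately have "((\<lambda>t. V (diag4 G + t *\<^sub>R axis i 1)) has_real_derivative - partial j V (diag4 G)) (at 0)"
      by (rule iffD2[OF DERIV_cong_ev[OF refl _ refl], rotated])
    then show ?thesis by (rule DERIV_unique[OF d])
  qed
  have mirror: "V p = V (vector [- p $ 3, - p $ 4, - p $ 1, - p $ 2])" if "p \<in> V_dom" for p
  proof -
    have "p = vector [p $ 1, p $ 2, p $ 3, p $ 4]" by (rule vec4_eqI) (simp_all add: vec4_nth)
    then show ?thesis using sym that unfolding reflection_symmetric_def by metis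
  qed
  show "partial (slot (- 1)) V (diag4 G) = - partial (slot 1) V (diag4 G)"
  proof (rule key)
    fix t assume "diag4 G + t *\<^sub>R axis (slot (- 1)) 1 \<in> V_dom"
    note mirror[OF this]
    also have "vector [- (diag4 G + t *\<^sub>R axis (slot (- 1)) 1) $ 3, - (diag4 G + t *\<^sub>R axis (slot (- 1)) 1) $ 4,
        - (diag4 G + t *\<^sub>R axis (slot (- 1)) 1) $ 1, - (diag4 G + t *\<^sub>R axis (slot (- 1)) 1) $ 2]
        = diag4 G + (- t) *\<^sub>R axis (slot 1) 1"
      by (rule vec4_eqI) (simp_all add: vec4_nth diag4_def axis_def slot_eq)
    finally show "V (diag4 G + t *\<^sub>R axis (slot (- 1)) 1) = V (diag4 G + (- t) *\<^sub>R axis (slot 1) 1)" .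
  qed
  show "partial (slot (- 2)) V (diag4 G) = - partial (slot 2) V (diag4 G)"
  proof (rule key)
    fix t assume "diag4 G + t *\<^sub>R axis (slot (- 2)) 1 \<in> V_dom"
    note mirror[OF this]
    also have "vector [- (diag4 G + t *\<^sub>R axis (slot (- 2)) 1) $ 3, - (diag4 G + t *\<^sub>R axis (slot (- 2)) 1) $ 4,
        - (diag4 G + t *\<^sub>R axis (slot (- 2)) 1) $ 1, - (diag4 G + t *\<^sub>R axis (slot (- 2)) 1) $ 2]
        = diag4 G + (- t) *\<^sub>R axis (slot 2) 1"
      by (rule vec4_eqI) (simp_all add: vec4_nth diag4_def axis_def slot_eq)
    finally show "V (diag4 G + t *\<^sub>R axis (slot (- 2)) 1) = V (diag4 G + (- t) *\<^sub>R axis (slot 2) 1)" .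
  qed
qed

section \<open>Second-derivative bounds on the box of arguments\<close>

definition box4 :: "real \<Rightarrow> real \<Rightarrow> (real^4) set" where
  "box4 lo hi = cbox (vector [lo, 2 * lo, - hi, - 2 * hi]) (vector [hi, 2 * hi, - lo, - 2 * lo])"

lemma mem_box4:
  "g \<in> box4 lo hi \<longleftrightarrow> g $ 1 \<in> {lo..hi} \<and> g $ 2 \<in> {2 * lo..2 * hi} \<and> g $ 3 \<in> {- hi..- lo} \<and> g $ 4 \<in> {- 2 * hi..- 2 * lo}"
  by (auto simp: box4_def mem_box_cart forall_4 vec4_nth)

lemma box4_V_dom: "0 < lo \<Longrightarrow> box4 lo hi \<subseteq> V_dom"
  by (auto simp: mem_box4 V_dom_def slot_eq)

lemma diag4_box4: "G \<in> {lo..hi} \<Longrightarrow> diag4 G \<in> box4 lo hi"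
  by (simp add: mem_box4 diag4_def vec4_nth)

text \<open>The four arguments range independently over intervals, so the set is a closed box:
  compact, which makes the suprema finite, and convex, which keeps the intermediate points of the
  mean value theorem inside.\<close>

lemma E4_eq_box4:
  assumes "E_int M y = {lo..hi}"
  shows "E4 M y = box4 lo hi"
proof (intro equalityI subsetI)
  fix g assume "g \<in> box4 lo hi"
  moreover have "g = vector [g $ 1, 2 * (g $ 2 / 2), - (- g $ 3), - 2 * (- g $ 4 / 2)]"
    by (rule vec4_eqI) (simp_all add: vec4_nth)
  ultimately show "g \<in> E4 M y"
    unfolding E4_def assms mem_box4
    by (intro CollectI exI[of _ "g $ 1"] exI[of _ "g $ 2 / 2"] exI[of _ "- g $ 3"] exI[of _ "- g $ 4 / 2"]) auto
qed (auto simp: E4_def assms mem_box4 vec4_nth)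

text \<open>The derivative of \<open>W V\<close>: the chain rule along the direction (1, 2, -1,
  -2).\<close>

definition W1 :: "(real^4 \<Rightarrow> real) \<Rightarrow> real \<Rightarrow> real" where
  "W1 V G = partial (slot 1) V (diag4 G) + 2 * partial (slot 2) V (diag4 G)
     - partial (slot (- 1)) V (diag4 G) - 2 * partial (slot (- 2)) V (diag4 G)"

text \<open>The derivative of \<open>V\<close> along (1, 2, 0, 0), towards the right neighbours;
  \<open>dL\<close> is its counterpart along (0, 0, 1, 2). On the diagonal the reflection symmetry
  gives W' = 2 \<open>dR\<close> = -2 \<open>dL\<close>, which is what cancels the half-weighted
  interface elements.\<close>

definition dR :: "(real^4 \<Rightarrow> real) \<Rightarrow> real^4 \<Rightarrow> real" where
  "dR V g = partial (slot 1) V g + 2 * partial (slot 2) V g"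

definition dL :: "(real^4 \<Rightarrow> real) \<Rightarrow> real^4 \<Rightarrow> real" where
  "dL V g = partial (slot (- 1)) V g + 2 * partial (slot (- 2)) V g"

lemma W_curve_derivative:
  assumes "Ck_on (Suc k) V_dom V" "0 < G"
  shows "((\<lambda>t. W V (G + t * d)) has_real_derivative d * W1 V G) (at 0)"
proof -
  have "((\<lambda>t. V (vector [G + t * d, 2 * G + t * (2 * d), - G + t * (- d), - 2 * G + t * (- 2 * d)])) has_real_derivative
    d * partial (slot 1) V (diag4 G) + (2 * d) * partial (slot 2) V (diag4 G)
     + (- d) * partial (slot (- 1)) V (diag4 G) + (- 2 * d) * partial (slot (- 2)) V (diag4 G)) (at 0)"
    using assms unfolding diag4_def by (intro V_curve_derivative) (auto simp: vector_V_dom)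
  then show ?thesis
    unfolding W_def W1_def by (simp add: algebra_simps)
qed

text \<open>Assumption (A) with its chain resolved: an infimum is at most the corresponding
  supremum, so the factors 1/50, 1/10, 1/10 multiply up to bounds in terms of \<open>m\<close>
  alone.\<close>

locale potential_bounds =
  fixes V :: "real^4 \<Rightarrow> real" and lo hi m Mx :: real
  assumes C3: "Ck_on 3 V_dom V"
    and sym: "reflection_symmetric V"
    and lo: "0 < lo"
    and S1: "\<And>i j g. (i, j) \<in> S1 \<Longrightarrow> g \<in> box4 lo hi \<Longrightarrow> \<bar>partial2 V i j g\<bar> \<le> m / 50"
    and S2: "\<And>i j g. (i, j) \<in> S2 \<Longrightarrow> g \<in> box4 lo hi \<Longrightarrow> \<bar>partial2 V i j g\<bar> \<le> m / 500"
    and S3: "\<And>i j g. (i, j) \<in> S3 \<Longrightarrow> g \<in> box4 lo hi \<Longrightarrow> \<bar>partial2 V i j g\<bar> \<le> m / 5000"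
    and NN: "\<And>i g. i \<in> {1, - 1} \<Longrightarrow> g \<in> box4 lo hi \<Longrightarrow> m \<le> partial2 V i i g \<and> partial2 V i i g \<le> Mx"
    and NNN: "\<And>i g. i \<in> {2, - 2} \<Longrightarrow> g \<in> box4 lo hi \<Longrightarrow> partial2 V i i g < 0"
begin

lemma C3': "Ck_on (Suc (Suc 1)) V_dom V"
  using C3 by (simp only: numeral_3_eq_3 One_nat_def)

lemma W1_eq_dR: "0 < G \<Longrightarrow> W1 V G = 2 * dR V (diag4 G)"
  using partial_reflection[OF sym C3'] by (simp add: W1_def dR_def)

lemma W1_eq_dL: "0 < G \<Longrightarrow> W1 V G = - 2 * dL V (diag4 G)"
  using partial_reflection[OF sym C3'] by (simp add: W1_def dL_def)

lemma partial_diff: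
  assumes "p \<in> box4 lo hi" "q \<in> box4 lo hi"
  shows "\<exists>z\<in>box4 lo hi. partial (slot j) V q - partial (slot j) V p =
    (q $ 1 - p $ 1) * partial2 V 1 j z + (q $ 2 - p $ 2) * partial2 V 2 j z
    + (q $ 3 - p $ 3) * partial2 V (- 1) j z + (q $ 4 - p $ 4) * partial2 V (- 2) j z"
proof -
  have "Ck_on (Suc 1) V_dom (partial (slot j) V)"
    using C3' by (subst (asm) Ck_on.simps(2)) blast
  from Ck_on_mvt[OF this open_V_dom _ box4_V_dom[OF lo] assms]
  show ?thesis by (simp add: sum_slot slot_eq partial2_def box4_def)
qed

text \<open>Strict positivity comes from the second neighbours: a strictly negative second
  derivative is bounded in modulus by \<open>m / 50\<close>.\<close>

lemma m_nonneg: assumes "g \<in> box4 lo hi" shows "0 < m" "m \<le> Mx"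
  using S1[of 2 2 g] NNN[of 2 g] NN[of 1 g] assms by (auto simp: S1_def)

text \<open>The mean value theorem gives each of the four first derivatives its own point. The two
  nearest-neighbour terms contribute between 2 \<open>m\<close> and 2 \<open>Mx\<close>. The rest
  consists of two mixed S1 terms with weight 1, the two pure second-neighbour terms with weight 4,
  eight S2 terms with weight 2 and two S3 terms with weight 4. Below: 2 - 2/50 - 8/50 - 16/500 -
  8/5000 = 1.7664. Above, the pure second-neighbour terms are negative and drop out, leaving 2 +
  2/50 + 16/500 + 8/5000 = 2.0736.\<close>

lemma W1_diff:
  assumes "a \<in> {lo..hi}" "b \<in> {lo..hi}"
  shows "\<exists>w. W1 V a - W1 V b = w * (a - b) \<and> 1.766 * m \<le> w \<and> w \<le> 2.0736 * Mx"
proof -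
  note d = partial_diff[OF diag4_box4[OF assms(2)] diag4_box4[OF assms(1)]]
  obtain z1 where z1: "z1 \<in> box4 lo hi" "partial (slot 1) V (diag4 a) - partial (slot 1) V (diag4 b)
      = (a - b) * (partial2 V 1 1 z1 + 2 * partial2 V 2 1 z1 - partial2 V (- 1) 1 z1 - 2 * partial2 V (- 2) 1 z1)"
    using d[of 1] by (auto simp: diag4_def vec4_nth algebra_simps)
  obtain z2 where z2: "z2 \<in> box4 lo hi" "partial (slot 2) V (diag4 a) - partial (slot 2) V (diag4 b)
      = (a - b) * (partial2 V 1 2 z2 + 2 * partial2 V 2 2 z2 - partial2 V (- 1) 2 z2 - 2 * partial2 V (- 2) 2 z2)"
    using d[of 2] by (auto simp: diag4_def vec4_nth algebra_simps)
  obtain z3 where z3: "z3 \<in> box4 lo hi" "partial (slot (- 1)) V (diag4 a) - partial (slot (- 1)) V (diag4 b)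
      = (a - b) * (partial2 V 1 (- 1) z3 + 2 * partial2 V 2 (- 1) z3 - partial2 V (- 1) (- 1) z3 - 2 * partial2 V (- 2) (- 1) z3)"
    using d[of "- 1"] by (auto simp: diag4_def vec4_nth algebra_simps)
  obtain z4 where z4: "z4 \<in> box4 lo hi" "partial (slot (- 2)) V (diag4 a) - partial (slot (- 2)) V (diag4 b)
      = (a - b) * (partial2 V 1 (- 2) z4 + 2 * partial2 V 2 (- 2) z4 - partial2 V (- 1) (- 2) z4 - 2 * partial2 V (- 2) (- 2) z4)"
    using d[of "- 2"] by (auto simp: diag4_def vec4_nth algebra_simps)
  define w where "w = (partial2 V 1 1 z1 + 2 * partial2 V 2 1 z1 - partial2 V (- 1) 1 z1 - 2 * partial2 V (- 2) 1 z1)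
    + 2 * (partial2 V 1 2 z2 + 2 * partial2 V 2 2 z2 - partial2 V (- 1) 2 z2 - 2 * partial2 V (- 2) 2 z2)
    - (partial2 V 1 (- 1) z3 + 2 * partial2 V 2 (- 1) z3 - partial2 V (- 1) (- 1) z3 - 2 * partial2 V (- 2) (- 1) z3)
    - 2 * (partial2 V 1 (- 2) z4 + 2 * partial2 V 2 (- 2) z4 - partial2 V (- 1) (- 2) z4 - 2 * partial2 V (- 2) (- 2) z4)"
  have "W1 V a - W1 V b = (a - b) * w"
  proof -
    have "W1 V a - W1 V b = (partial (slot 1) V (diag4 a) - partial (slot 1) V (diag4 b))
      + 2 * (partial (slot 2) V (diag4 a) - partial (slot 2) V (diag4 b))
      - (partial (slot (- 1)) V (diag4 a) - partial (slot (- 1)) V (diag4 b))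
      - 2 * (partial (slot (- 2)) V (diag4 a) - partial (slot (- 2)) V (diag4 b))"
      by (simp add: W1_def)
    then show ?thesis unfolding z1(2) z2(2) z3(2) z4(2) w_def by (simp add: algebra_simps)
  qed
  moreover have "1.766 * m \<le> w \<and> w \<le> 2.0736 * Mx"
  proof -
    have mM: "0 < m" "m \<le> Mx" using m_nonneg[OF z1(1)] by auto
    have s1: "(- 1, 1) \<in> S1" "(2, 2) \<in> S1" "(1, - 1) \<in> S1" "(- 2, - 2) \<in> S1" by (auto simp: S1_def)
    have s2: "(2, 1) \<in> S2" "(- 2, 1) \<in> S2" "(1, 2) \<in> S2" "(- 1, 2) \<in> S2"
      "(2, - 1) \<in> S2" "(- 2, - 1) \<in> S2" "(1, - 2) \<in> S2" "(- 1, - 2) \<in> S2" by (auto simp: S2_def)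
    have s3: "(2, - 2) \<in> S3" "(- 2, 2) \<in> S3" by (auto simp: S3_def)
    note S1[OF s1(1) z1(1)] S1[OF s1(2) z2(1)] S1[OF s1(3) z3(1)] S1[OF s1(4) z4(1)]
      S2[OF s2(1) z1(1)] S2[OF s2(2) z1(1)] S2[OF s2(3) z2(1)] S2[OF s2(4) z2(1)]
      S2[OF s2(5) z3(1)] S2[OF s2(6) z3(1)] S2[OF s2(7) z4(1)] S2[OF s2(8) z4(1)]
      S3[OF s3(1) z4(1)] S3[OF s3(2) z2(1)]
    note this[unfolded abs_le_iff]
    moreover have "m \<le> partial2 V 1 1 z1" "partial2 V 1 1 z1 \<le> Mx"
       "m \<le> partial2 V (- 1) (- 1) z3" "partial2 V (- 1) (- 1) z3 \<le> Mx"
       "partial2 V 2 2 z2 < 0" "partial2 V (- 2) (- 2) z4 < 0"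
      using NN z1 z3 NNN z2 z4 by blast+
    ultimately show ?thesis using mM unfolding w_def by simp
  qed
  ultimately show ?thesis by (metis mult.commute)
qed

text \<open>
  At an interface site, hypothesis (iii) bounds the two free arguments of \<open>V\<close> by \<open>3\<delta>\<close> and
  \<open>3\<delta> + 2 * 3\<delta> = 9\<delta>\<close>, where \<open>\<delta>\<close> is the jump at the outermost continuum node.
\<close>

lemma dL_diff:
  assumes "c \<in> {lo..hi}" "vector [q1, q2, - c, - 2 * c] \<in> box4 lo hi"
    and "\<bar>q1 - c\<bar> \<le> 3 * \<delta>" "\<bar>q2 - 2 * c\<bar> \<le> 9 * \<delta>"
  shows "\<bar>dL V (vector [q1, q2, - c, - 2 * c]) - dL V (diag4 c)\<bar> \<le> 0.0936 * (\<delta> * m)"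
proof -
  let ?q = "vector [q1, q2, - c, - 2 * c] :: real^4"
  note d = partial_diff[OF diag4_box4[OF assms(1)] assms(2)]
  obtain z3 where z3: "z3 \<in> box4 lo hi" "partial (slot (- 1)) V ?q - partial (slot (- 1)) V (diag4 c)
      = (q1 - c) * partial2 V 1 (- 1) z3 + (q2 - 2 * c) * partial2 V 2 (- 1) z3"
    using d[of "- 1"] by (auto simp: diag4_def vec4_nth)
  obtain z4 where z4: "z4 \<in> box4 lo hi" "partial (slot (- 2)) V ?q - partial (slot (- 2)) V (diag4 c)
      = (q1 - c) * partial2 V 1 (- 2) z4 + (q2 - 2 * c) * partial2 V 2 (- 2) z4"
    using d[of "- 2"] by (auto simp: diag4_def vec4_nth)
  \<comment> \<open>The last two arguments agree with the diagonal, so only derivatives mixing a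
    right with a left label enter. Together with the factor 2 in \<open>dL\<close> the total is 3/50
    + 9/500 + 2 (3/500 + 9/5000) = 0.0936.\<close>
  have "\<bar>(q1 - c) * partial2 V 1 (- 1) z3\<bar> \<le> 3 * \<delta> * (m / 50)"
    "\<bar>(q2 - 2 * c) * partial2 V 2 (- 1) z3\<bar> \<le> 9 * \<delta> * (m / 500)"
    "\<bar>(q1 - c) * partial2 V 1 (- 2) z4\<bar> \<le> 3 * \<delta> * (m / 500)"
    "\<bar>(q2 - 2 * c) * partial2 V 2 (- 2) z4\<bar> \<le> 9 * \<delta> * (m / 5000)"
    unfolding abs_mult
    using mult_mono[OF assms(3) S1[OF _ z3(1)]] mult_mono[OF assms(4) S2[OF _ z3(1)]]
      mult_mono[OF assms(3) S2[OF _ z4(1)]] mult_mono[OF assms(4) S3[OF _ z4(1)]] assms(3,4)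
    by (simp_all add: S1_def S2_def S3_def)
  moreover have "dL V ?q - dL V (diag4 c) = (q1 - c) * partial2 V 1 (- 1) z3 + (q2 - 2 * c) * partial2 V 2 (- 1) z3
     + 2 * ((q1 - c) * partial2 V 1 (- 2) z4 + (q2 - 2 * c) * partial2 V 2 (- 2) z4)"
    using z3(2) z4(2) by (simp add: dL_def)
  ultimately show ?thesis by (simp add: mult.assoc abs_if split: if_splits)
qed

lemma dR_diff:
  assumes "c \<in> {lo..hi}" "vector [c, 2 * c, - q1, - q2] \<in> box4 lo hi"
    and "\<bar>q1 - c\<bar> \<le> 3 * \<delta>" "\<bar>q2 - 2 * c\<bar> \<le> 9 * \<delta>"
  shows "\<bar>dR V (vector [c, 2 * c, - q1, - q2]) - dR V (diag4 c)\<bar> \<le> 0.0936 * (\<delta> * m)"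
proof -
  let ?q = "vector [c, 2 * c, - q1, - q2] :: real^4"
  note d = partial_diff[OF diag4_box4[OF assms(1)] assms(2)]
  obtain z3 where z3: "z3 \<in> box4 lo hi" "partial (slot 1) V ?q - partial (slot 1) V (diag4 c)
      = - ((q1 - c) * partial2 V (- 1) 1 z3) - (q2 - 2 * c) * partial2 V (- 2) 1 z3"
    using d[of 1] by (auto simp: diag4_def vec4_nth algebra_simps)
  obtain z4 where z4: "z4 \<in> box4 lo hi" "partial (slot 2) V ?q - partial (slot 2) V (diag4 c)
      = - ((q1 - c) * partial2 V (- 1) 2 z4) - (q2 - 2 * c) * partial2 V (- 2) 2 z4"
    using d[of 2] by (auto simp: diag4_def vec4_nth algebra_simps)
  have "\<bar>(q1 - c) * partial2 V (- 1) 1 z3\<bar> \<le> 3 * \<delta> * (m / 50)"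
    "\<bar>(q2 - 2 * c) * partial2 V (- 2) 1 z3\<bar> \<le> 9 * \<delta> * (m / 500)"
    "\<bar>(q1 - c) * partial2 V (- 1) 2 z4\<bar> \<le> 3 * \<delta> * (m / 500)"
    "\<bar>(q2 - 2 * c) * partial2 V (- 2) 2 z4\<bar> \<le> 9 * \<delta> * (m / 5000)"
    unfolding abs_mult
    using mult_mono[OF assms(3) S1[OF _ z3(1)]] mult_mono[OF assms(4) S2[OF _ z3(1)]]
      mult_mono[OF assms(3) S2[OF _ z4(1)]] mult_mono[OF assms(4) S3[OF _ z4(1)]] assms(3,4)
    by (simp_all add: S1_def S2_def S3_def)
  moreover have "dR V ?q - dR V (diag4 c) = - ((q1 - c) * partial2 V (- 1) 1 z3) - (q2 - 2 * c) * partial2 V (- 2) 1 z3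
     + 2 * (- ((q1 - c) * partial2 V (- 1) 2 z4) - (q2 - 2 * c) * partial2 V (- 2) 2 z4)"
    using z3(2) z4(2) by (simp add: dR_def)
  ultimately show ?thesis by (simp add: mult.assoc abs_if split: if_splits)
qed

end

text \<open>A supremum of reals bounds its terms only if the set is bounded; here this is continuity
  on a compact box, which lies in \<open>V_dom\<close> because \<open>0 < lo\<close>.\<close>

lemma partial2_bdd:
  assumes "Ck_on 3 V_dom V" "0 < lo" "finite S"
  shows "bdd_above ((\<lambda>(g, (i, j)). \<bar>partial2 V i j g\<bar>) ` (box4 lo hi \<times> S))"
    and "bdd_below ((\<lambda>(g, (i, j)). \<bar>partial2 V i j g\<bar>) ` (box4 lo hi \<times> S))"
proof -
  have cont: "continuous_on (box4 lo hi) (\<lambda>g. \<bar>partial2 V i j g\<bar>)" for i j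
  proof -
    have "continuous_on V_dom (partial2 V i j)"
      using assms(1) by (auto simp: numeral_3_eq_3 partial2_def)
    then show ?thesis
      using continuous_on_subset[OF _ box4_V_dom[OF assms(2)]] by (intro continuous_intros) auto
  qed
  have "bdd_above ((\<lambda>g. \<bar>partial2 V i j g\<bar>) ` box4 lo hi)" for i j
    by (intro bounded_imp_bdd_above compact_imp_bounded compact_continuous_image cont)
       (simp add: box4_def)
  then have "bdd_above (\<Union>(i, j)\<in>S. (\<lambda>g. \<bar>partial2 V i j g\<bar>) ` box4 lo hi)"
    using assms(3) by auto
  moreover have "(\<lambda>(g, (i, j)). \<bar>partial2 V i j g\<bar>) ` (box4 lo hi \<times> S) = (\<Union>(i, j)\<in>S. (\<lambda>g. \<bar>partial2 V i j g\<bar>) ` box4 lo hi)"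
    by force
  ultimately show "bdd_above ((\<lambda>(g, (i, j)). \<bar>partial2 V i j g\<bar>) ` (box4 lo hi \<times> S))" by simp
  show "bdd_below ((\<lambda>(g, (i, j)). \<bar>partial2 V i j g\<bar>) ` (box4 lo hi \<times> S))"
    by (rule bdd_belowI[of _ 0]) auto
qed

lemma sup_d2_upper:
  assumes "Ck_on 3 V_dom V" "0 < lo" "finite S" "g \<in> box4 lo hi" "(i, j) \<in> S"
  shows "\<bar>partial2 V i j g\<bar> \<le> sup_d2 V (box4 lo hi) S"
  unfolding sup_d2_def using cSUP_upper[OF _ partial2_bdd(1)[OF assms(1,2,3)], of "(g, (i, j))" hi] assms by auto

lemma inf_d2_lower:
  assumes "Ck_on 3 V_dom V" "0 < lo" "finite S" "g \<in> box4 lo hi" "(i, j) \<in> S"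
  shows "inf_d2 V (box4 lo hi) S \<le> \<bar>partial2 V i j g\<bar>"
  unfolding inf_d2_def using cINF_lower[OF partial2_bdd(2)[OF assms(1,2,3)], of "(g, (i, j))" hi] assms by auto

lemma potential_bounds_assumption_A:
  assumes C: "Ck_on 3 V_dom V" and "reflection_symmetric V" and A: "assumption_A M V y"
    and E: "E_int M y = {lo..hi}" "0 < lo" "lo \<le> hi"
  shows "potential_bounds V lo hi (m2NN V (E4 M y)) (M2NN V (E4 M y))"
proof -
  have B: "E4 M y = box4 lo hi" by (rule E4_eq_box4[OF E(1)])
  let ?B = "box4 lo hi"
  note A' = A[unfolded assumption_A_def B]
  have fin: "finite S1" "finite S2" "finite S3" by (auto simp: S1_def S2_def S3_def)
  \<comment> \<open>Infimum at most supremum requires a point of the box.\<close>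
  have g0: "diag4 lo \<in> ?B" using E by (intro diag4_box4) auto
  have i1: "inf_d2 V ?B S1 \<le> sup_d2 V ?B S1"
    using inf_d2_lower[OF C E(2) fin(1) g0, of 1 "- 1"] sup_d2_upper[OF C E(2) fin(1) g0, of 1 "- 1"]
    by (simp add: S1_def)
  have i2: "inf_d2 V ?B S2 \<le> sup_d2 V ?B S2"
    using inf_d2_lower[OF C E(2) fin(2) g0, of 1 "2"] sup_d2_upper[OF C E(2) fin(2) g0, of 1 "2"]
    by (simp add: S2_def)
  show ?thesis
    unfolding B
  proof
    fix i j g assume g: "g \<in> ?B"
    show "\<bar>partial2 V i j g\<bar> \<le> m2NN V ?B / 50" if "(i, j) \<in> S1"
      using sup_d2_upper[OF C E(2) fin(1) g that] A' by simp
    show "\<bar>partial2 V i j g\<bar> \<le> m2NN V ?B / 500" if "(i, j) \<in> S2"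
      using sup_d2_upper[OF C E(2) fin(2) g that] A' i1 by simp
    show "\<bar>partial2 V i j g\<bar> \<le> m2NN V ?B / 5000" if "(i, j) \<in> S3"
      using sup_d2_upper[OF C E(2) fin(3) g that] A' i1 i2 by simp
  next
    fix i :: int and g assume g: "g \<in> ?B"
    show "partial2 V i i g < 0" if "i \<in> {2, - 2}"
      using A' g that by blast
    have "0 < partial2 V i i g" if "i \<in> {1, - 1}"
      using A' g that by blast
    then show "m2NN V ?B \<le> partial2 V i i g \<and> partial2 V i i g \<le> M2NN V ?B" if "i \<in> {1, - 1}"
      using inf_d2_lower[OF C E(2) _ g, of "{(1, 1), (- 1, - 1)}" i i]
        sup_d2_upper[OF C E(2) _ g, of "{(1, 1), (- 1, - 1)}" i i] that
      by (force simp: m2NN_def M2NN_def)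
  qed (use assms in auto)
qed


section \<open>Mesh combinatorics and interpolation\<close>

lemma int_shift_invariant:
  fixes P :: "int \<Rightarrow> bool"
  assumes "\<And>k. P (k + 1) = P k"
  shows "P k = P 0"
proof (induction k rule: int_induct[where k = 0])
  case (step2 i) then show ?case using assms[of "i - 1"] by simp
qed (use assms in simp_all)

lemma sum_int_telescope:
  fixes g :: "int \<Rightarrow> real"
  assumes "m \<le> n + 1"
  shows "(\<Sum>k=m..n. g (k + 1)) = (\<Sum>k=m..n. g k) + g (n + 1) - g m"
  using assms
proof (induction "n + 1" arbitrary: n rule: int_ge_induct)
  case base
  then show ?case by simp
next
  case (step i)
  have "{m..n} = insert n {m..n - 1}" using step by auto
  then show ?case using step.hyps(2)[of "n - 1"] step.hyps(1,3) by simp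
qed

text \<open>Allows the load to be summed over a period that starts at the patch of the node instead
  of over \<open>sites M\<close>.\<close>

lemma sum_periodic_window:
  fixes g :: "int \<Rightarrow> real"
  assumes per: "\<And>l. g (l + p) = g l" and "0 \<le> p"
  shows "(\<Sum>l=a + 1..a + p. g l) = (\<Sum>l=b + 1..b + p. g l)"
proof -
  define S where "S a = (\<Sum>l=a + 1..a + p. g l)" for a
  have S: "S (a + 1) = S a" for a
  proof -
    have "S (a + 1) = (\<Sum>l=a + 1..a + p. g (l + 1))"
      unfolding S_def by (rule sum.reindex_bij_witness[of _ "\<lambda>l. l + 1" "\<lambda>l. l - 1"]) auto
    also have "\<dots> = S a + g (a + p + 1) - g (a + 1)"
      unfolding S_def using \<open>0 \<le> p\<close> by (subst sum_int_telescope) auto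
    also have "g (a + p + 1) = g (a + 1)"
      using per[of "a + 1"] by (simp add: algebra_simps)
    finally show ?thesis by simp
  qed
  have "(S a = c) = (S 0 = c)" for a c
    using S by (intro int_shift_invariant[of "\<lambda>a. S a = c"]) simp
  then show ?thesis unfolding S_def by metis
qed

locale mesh =
  fixes M :: mesh
  assumes valid: "valid_mesh M"
begin

abbreviation "N \<equiv> int (mN M)"
abbreviation "K \<equiv> mK M"
abbreviation "K1 \<equiv> mK1 M"
abbreviation "K2 \<equiv> mK2 M"
abbreviation "nd \<equiv> node M"
abbreviation "h \<equiv> hT M"

lemma N_pos: "0 < mN M" and eps_pos: "0 < eps M"
  using valid by (auto simp: valid_mesh_def eps_def)

lemma indices: "3 \<le> K1" "K1 + 2 < K2 - 1" "K2 + 3 \<le> K"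
  using valid by (auto simp: valid_mesh_def)

lemma node_shift: "nd (k + K) = nd k + 2 * N"
  using valid by (auto simp: valid_mesh_def)

lemma node_shift_mult: "nd (k + q * K) = nd k + q * (2 * N)"
proof (induction q rule: int_induct[where k = 0])
  case (step1 i)
  then show ?case using node_shift[of "k + i * K"] by (simp add: algebra_simps)
next
  case (step2 i)
  then show ?case using node_shift[of "k + (i - 1) * K"] by (simp add: algebra_simps)
qed simp

text \<open>Monotonicity is given within one period only. At the seam, node 1 is a site and thus at
  least \<open>- N + 1\<close>, so its copy lies beyond \<open>N\<close>, the position of node
  \<open>K\<close>.\<close>

lemma node_step: "nd k < nd (k + 1)"
proof -
  define j q where "j = (k - 1) mod K + 1" and "q = (k - 1) div K"
  have Kpos: "0 < K" using indices by simp
  have k: "k = j + q * K" by (simp add: j_def q_def)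
  have j: "1 \<le> j" "j \<le> K" using Kpos by (auto simp: j_def add1_zle_eq)
  have "nd j < nd (j + 1)"
  proof (cases "j = K")
    case True
    have "nd 1 \<in> sites M" "nd K = N" "nd (1 + K) = nd 1 + 2 * N"
      using valid Kpos by (auto simp: valid_mesh_def)
    then show ?thesis using True N_pos by (auto simp: sites_def add.commute)
  next
    case False
    then show ?thesis using valid j by (auto simp: valid_mesh_def intro: strict_mono_onD)
  qed
  then show ?thesis
    using node_shift_mult[of j q] node_shift_mult[of "j + 1" q] unfolding k by (simp add: algebra_simps)
qed

lemma node_less: "i < j \<Longrightarrow> nd i < nd j"
proof (induction j rule: int_gr_induct)
  case base show ?case by (rule node_step)
next
  case (step j) then show ?case using node_step[of j] by simp
qed

lemma node_le: "i \<le> j \<Longrightarrow> nd i \<le> nd j"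
  using node_less[of i j] by (cases "i = j") auto

lemma node_pred: "nd (k - 1) < nd k"
  by (rule node_less) simp

lemma node_grow: "0 \<le> m \<Longrightarrow> nd k + m \<le> nd (k + m)"
proof (induction m rule: int_ge_induct)
  case (step i) then show ?case using node_step[of "k + i"] by (simp add: algebra_simps)
qed simp

lemma elem_exists: "\<exists>k. l \<in> elem_sites M k"
proof -
  \<comment> \<open>Nodes advance by at least one site per index, so going back by more than the
    distance from node 0 to \<open>l\<close> passes \<open>l\<close>.\<close>
  define k0 where "k0 = - \<bar>l - nd 0\<bar> - 1"
  have k0: "nd k0 < l" using node_grow[of "- k0" k0] by (simp add: k0_def)
  have "l \<le> nd (k0 + int (nat (l - nd k0)))" using node_grow[of "l - nd k0" k0] k0 by simp
  then have ex: "\<exists>m. l \<le> nd (k0 + int m)" by blast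
  define m where "m = (LEAST m. l \<le> nd (k0 + int m))"
  have m: "l \<le> nd (k0 + int m)" unfolding m_def using ex by (rule LeastI_ex)
  have "m \<noteq> 0" using m k0 by (cases "m = 0") auto
  then have "\<not> l \<le> nd (k0 + int (m - 1))" unfolding m_def by (intro not_less_Least) (simp add: m_def)
  then have "l \<in> elem_sites M (k0 + int m)"
    using m \<open>m \<noteq> 0\<close> by (auto simp: elem_sites_def of_nat_diff algebra_simps)
  then show ?thesis by blast
qed

lemma elem_sites_unique:
  assumes "l \<in> elem_sites M i" "l \<in> elem_sites M j" shows "i = j"
proof (rule ccontr)
  assume "i \<noteq> j"
  then consider "i \<le> j - 1" | "j \<le> i - 1" by linarith
  then show False
    using assms node_le[of i "j - 1"] node_le[of j "i - 1"] by cases (auto simp: elem_sites_def)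
qed

lemma elem_eqI: "l \<in> elem_sites M k \<Longrightarrow> elem M l = k"
  unfolding elem_def using elem_sites_unique by blast

lemma elem_in: "l \<in> elem_sites M (elem M l)"
  using elem_exists[of l] elem_eqI by metis

lemma node_in_elem: "nd k \<in> elem_sites M k"
  using node_pred[of k] by (simp add: elem_sites_def)

lemma node_shift_pred: "nd (k + K - 1) = nd (k - 1) + 2 * N"
  using node_shift[of "k - 1"] by (simp add: algebra_simps)

lemma elem_sites_shift: "l + 2 * N \<in> elem_sites M (k + K) \<longleftrightarrow> l \<in> elem_sites M k"
  using node_shift[of k] node_shift_pred[of k] by (simp add: elem_sites_def)

lemma elem_shift: "elem M (l + 2 * N) = elem M l + K"
  using elem_sites_shift elem_in elem_eqI by blast

lemma h_eq: "h k = eps M * real_of_int (nd k - nd (k - 1))"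
  by (simp add: hT_def)

lemma h_ge: "eps M \<le> h k"
  using node_pred[of k] eps_pos by (simp add: h_eq)

lemma h_pos: "0 < h k"
  using h_ge[of k] eps_pos by simp

lemma h_shift: "h (k + K) = h k"
  using node_shift[of k] node_shift_pred[of k] by (simp add: h_eq)

lemma unit_element:
  assumes "K1 - 1 \<le> k" "k \<le> K2 + 2"
  shows "nd k - nd (k - 1) = 1" "h k = eps M"
  using valid assms by (auto simp: valid_mesh_def h_eq)

lemma node_atomistic:
  assumes "K1 - 2 \<le> k" "k \<le> K2 + 2"
  shows "nd k = nd (K1 - 2) + (k - (K1 - 2))"
  using assms
proof (induction k rule: int_ge_induct)
  case (step i) then show ?case using unit_element(1)[of "i + 1"] by simp
qed simp

lemma Kc_split: "Kc M = {1..K1 - 2} \<union> {K2 + 2..K}" "{1..K1 - 2} \<inter> {K2 + 2..K} = {}"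
  using indices by (auto simp: Kc_def)

lemma Kc_range: "k \<in> Kc M \<Longrightarrow> 1 \<le> k \<and> k \<le> K"
  using indices by (auto simp: Kc_def)

lemma finite_Kc: "finite (Kc M)" "finite (KcT M)"
  by (auto simp: Kc_def KcT_def)

lemma KcT_insert: "Kc M = insert (K2 + 2) (KcT M)" "K2 + 2 \<notin> KcT M"
  using indices by (auto simp: Kc_def KcT_def)

lemma sum_Kc: "(\<Sum>k\<in>Kc M. g k) = g (K2 + 2) + (\<Sum>k\<in>KcT M. g k)" for g :: "int \<Rightarrow> real"
  using KcT_insert finite_Kc by simp

text \<open>Across the periodic seam the continuum region is a single interval: the terms at
  \<open>K + 1\<close> and 1 cancel, and a shift leaves only the two interface ends.\<close>

lemma sum_Kc_shift:
  fixes g :: "int \<Rightarrow> real"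
  assumes "g (K + 1) = g 1"
  shows "(\<Sum>k\<in>Kc M. g (k + 1)) = (\<Sum>k\<in>Kc M. g k) + g (K1 - 1) - g (K2 + 2)"
  using assms indices unfolding Kc_split(1)
  by (simp add: sum.union_disjoint[OF _ _ Kc_split(2)] sum_int_telescope)

section \<open>Piecewise affine interpolation of nodal values\<close>

definition interp :: "(int \<Rightarrow> real) \<Rightarrow> int \<Rightarrow> real" where
  "interp u l = (let k = elem M l; t = real_of_int (l - nd (k - 1)) / real_of_int (nd k - nd (k - 1))
     in (1 - t) * u (k - 1) + t * u k)"

lemma G_rec_eq_interp: "G_rec M y = interp (G_node M y)"
  by (simp add: fun_eq_iff G_rec_def interp_def)

lemma interp_elem:
  assumes "l \<in> elem_sites M k"
  shows "interp u l = (1 - real_of_int (l - nd (k - 1)) / real_of_int (nd k - nd (k - 1))) * u (k - 1)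
     + real_of_int (l - nd (k - 1)) / real_of_int (nd k - nd (k - 1)) * u k"
  by (simp add: interp_def elem_eqI[OF assms] Let_def)

lemma interp_node: "interp u (nd k) = u k"
  using interp_elem[OF node_in_elem[of k], of u] node_pred[of k] by simp

lemma interp_affine:
  assumes "l \<in> {nd (k - 1)..nd k}"
  shows "interp u l = u (k - 1) + (u k - u (k - 1)) * (real_of_int (l - nd (k - 1)) / real_of_int (nd k - nd (k - 1)))"
proof (cases "l = nd (k - 1)")
  case True
  then show ?thesis using interp_node[of u "k - 1"] by simp
next
  case False
  then have "l \<in> elem_sites M k" using assms by (auto simp: elem_sites_def)
  then have "interp u l = (1 - t) * u (k - 1) + t * u k"
    if "t = real_of_int (l - nd (k - 1)) / real_of_int (nd k - nd (k - 1))" for t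
    unfolding that by (rule interp_elem)
  then show ?thesis by (simp only: left_diff_distrib) (simp add: algebra_simps)
qed

lemma interp_shift:
  assumes "\<And>k. u (k + K) = u k"
  shows "interp u (l + 2 * N) = interp u l"
proof -
  have "u (k + K - 1) = u (k - 1)" for k using assms[of "k - 1"] by (simp add: algebra_simps)
  then show ?thesis
    using assms by (simp add: interp_def elem_shift node_shift node_shift_pred Let_def)
qed

definition piecewise_affine :: "(int \<Rightarrow> real) \<Rightarrow> bool" where
  "piecewise_affine y \<longleftrightarrow>
     (\<forall>k. \<exists>a b. \<forall>l\<in>{nd (k - 1)..nd k}. y l = a + b * (eps M * real_of_int l))"

lemma deformations_h_iff: "y \<in> deformations_h M F \<longleftrightarrow> y \<in> deformations M F \<and> piecewise_affine y"
  by (simp add: deformations_h_def piecewise_affine_def)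

lemma piecewise_affine_interp: "piecewise_affine (interp u)"
  unfolding piecewise_affine_def
proof
  fix k
  define s where "s = (u k - u (k - 1)) / real_of_int (nd k - nd (k - 1))"
  have "interp u l = (u (k - 1) - s * real_of_int (nd (k - 1))) + s / eps M * (eps M * real_of_int l)"
    if "l \<in> {nd (k - 1)..nd k}" for l
  proof -
    have "interp u l = u (k - 1) + s * (real_of_int l - real_of_int (nd (k - 1)))"
      unfolding interp_affine[OF that] s_def by simp
    then show ?thesis using eps_pos by (simp add: right_diff_distrib)
  qed
  then show "\<exists>a b. \<forall>l\<in>{nd (k - 1)..nd k}. interp u l = a + b * (eps M * real_of_int l)" by blast
qed

lemma piecewise_affine_lincomb:
  assumes "piecewise_affine y" "piecewise_affine z"
  shows "piecewise_affine (\<lambda>l. y l + t * (z l - c))"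
  unfolding piecewise_affine_def
proof
  fix k
  obtain a b a' b' where
    "\<forall>l\<in>{nd (k - 1)..nd k}. y l = a + b * (eps M * real_of_int l)"
    "\<forall>l\<in>{nd (k - 1)..nd k}. z l = a' + b' * (eps M * real_of_int l)"
    using assms unfolding piecewise_affine_def by metis
  then have "\<forall>l\<in>{nd (k - 1)..nd k}. y l + t * (z l - c) = (a + t * (a' - c)) + (b + t * b') * (eps M * real_of_int l)"
    by (simp add: algebra_simps)
  then show "\<exists>a b. \<forall>l\<in>{nd (k - 1)..nd k}. y l + t * (z l - c) = a + b * (eps M * real_of_int l)" by blast
qed

lemma grad_nodes:
  assumes "piecewise_affine y"
  shows "y (nd k) - y (nd (k - 1)) = h k * grad M y k"
proof -
  obtain a b where ab: "\<forall>l\<in>{nd (k - 1)..nd k}. y l = a + b * (eps M * real_of_int l)"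
    using assms unfolding piecewise_affine_def by metis
  then have "grad M y k = b"
    using node_pred[of k] eps_pos by (simp add: grad_def bdiff_def field_simps)
  moreover have "y (nd k) - y (nd (k - 1)) = b * h k"
    using ab node_pred[of k] by (simp add: h_eq algebra_simps)
  ultimately show ?thesis by simp
qed

lemma grad_shift:
  assumes "y \<in> deformations M F"
  shows "grad M y (k + K) = grad M y k"
proof -
  obtain v where v: "\<And>l. v (l + 2 * N) = v l" "\<And>l. y l = eps M * F * real_of_int l + v l"
    using assms by (auto simp: deformations_def displacements_def)
  have "v (nd k + 2 * N - 1) = v (nd k - 1)" using v(1)[of "nd k - 1"] by (simp add: algebra_simps)
  then show ?thesis
    using v by (simp add: grad_def bdiff_def node_shift algebra_simps)
qed

lemma sites_window: "sites M = {- N + 1..- N + 2 * N}"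
  by (simp add: sites_def)

lemma elem_sites_param:
  "elem_sites M k = (\<lambda>j. nd (k - 1) + int j) ` {1..nat (nd k - nd (k - 1))}"
proof (intro equalityI subsetI)
  fix l assume "l \<in> elem_sites M k"
  then show "l \<in> (\<lambda>j. nd (k - 1) + int j) ` {1..nat (nd k - nd (k - 1))}"
    by (intro image_eqI[of _ _ "nat (l - nd (k - 1))"]) (auto simp: elem_sites_def)
qed (auto simp: elem_sites_def)

lemma sum_elem_sites:
  fixes g :: "real \<Rightarrow> real"
  assumes "n = nat (nd k - nd (k - 1))"
  shows "(\<Sum>l\<in>elem_sites M k. g (real_of_int (l - nd (k - 1)) / real_of_int (nd k - nd (k - 1))))
     = (\<Sum>j = 1..n. g (real j / real n))"
  unfolding elem_sites_param assms using node_pred[of k]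
  by (subst sum.reindex) (auto simp: inj_on_def)

lemma elem_sites_disjoint: "i \<noteq> j \<Longrightarrow> elem_sites M i \<inter> elem_sites M j = {}"
  using elem_sites_unique by blast

lemma finite_elem_sites: "finite (elem_sites M k)"
  by (simp add: elem_sites_def)

end


section \<open>Optimality condition\<close>

context mesh
begin

lemma node_add:
  assumes "K1 - 2 \<le> k" "k \<le> K2 + 2" "K1 - 2 \<le> k + j" "k + j \<le> K2 + 2"
  shows "nd k + j = nd (k + j)"
  using node_atomistic[of k] node_atomistic[of "k + j"] assms by simp

lemma Dq_atomistic:
  assumes "piecewise_affine y"
  shows "K1 - 2 \<le> k \<Longrightarrow> k + 1 \<le> K2 + 2 \<Longrightarrow> Dq M 1 y (nd k) = grad M y (k + 1)"
    and "K1 - 2 \<le> k \<Longrightarrow> k + 2 \<le> K2 + 2 \<Longrightarrow> Dq M 2 y (nd k) = grad M y (k + 1) + grad M y (k + 2)"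
    and "K1 - 2 \<le> k - 1 \<Longrightarrow> k \<le> K2 + 2 \<Longrightarrow> Dq M (- 1) y (nd k) = - grad M y k"
    and "K1 - 2 \<le> k - 2 \<Longrightarrow> k \<le> K2 + 2 \<Longrightarrow> Dq M (- 2) y (nd k) = - (grad M y k + grad M y (k - 1))"
proof -
  have g: "y (nd (k + 1)) - y (nd k) = eps M * grad M y (k + 1)"
    if "K1 - 2 \<le> k" "k + 1 \<le> K2 + 2" for k
    using grad_nodes[OF assms, of "k + 1"] unit_element(2)[of "k + 1"] that by simp
  show "Dq M 1 y (nd k) = grad M y (k + 1)" if "K1 - 2 \<le> k" "k + 1 \<le> K2 + 2"
    using g[of k] node_add[of k 1] that eps_pos by (simp add: Dq_def)
  show "Dq M 2 y (nd k) = grad M y (k + 1) + grad M y (k + 2)" if "K1 - 2 \<le> k" "k + 2 \<le> K2 + 2"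
    using g[of k] g[of "k + 1"] node_add[of k 2] that eps_pos by (simp add: Dq_def field_simps)
  show "Dq M (- 1) y (nd k) = - grad M y k" if "K1 - 2 \<le> k - 1" "k \<le> K2 + 2"
    using g[of "k - 1"] node_add[of k "- 1"] that eps_pos by (simp add: Dq_def field_simps)
  show "Dq M (- 2) y (nd k) = - (grad M y k + grad M y (k - 1))" if "K1 - 2 \<le> k - 2" "k \<le> K2 + 2"
    using g[of "k - 1"] g[of "k - 2"] node_add[of k "- 2"] that eps_pos by (simp add: Dq_def field_simps)
qed

lemma periodic_mod:
  fixes g :: "int \<Rightarrow> 'a"
  assumes "\<And>k. g (k + K) = g k"
  shows "g k = g ((k - 1) mod K + 1)"
proof -
  have "g (k + q * K) = g k" for k q
  proof (induction q rule: int_induct[where k = 0])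
    case (step1 i)
    then show ?case using assms[of "k + i * K"] by (simp add: algebra_simps)
  next
    case (step2 i)
    then show ?case using assms[of "k + (i - 1) * K"] by (simp add: algebra_simps)
  qed simp
  from this[of "(k - 1) mod K + 1" "(k - 1) div K"] show ?thesis by simp
qed

lemma grad_lincomb: "grad M (\<lambda>l. y l + t * (z l - c)) k = grad M y k + t * grad M z k"
  using eps_pos by (simp add: grad_def bdiff_def field_simps)

lemma Dq_lincomb: "Dq M j (\<lambda>l. y l + t * (z l - c)) l = Dq M j y l + t * Dq M j z l"
  using eps_pos by (simp add: Dq_def field_simps)

end

locale coupled = mesh M for M :: mesh +
  fixes F :: real and V :: "real^4 \<Rightarrow> real" and f y :: "int \<Rightarrow> real"
  assumes V_C3: "Ck_on 3 V_dom V"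
    and f: "f \<in> displacements M"
    and sol: "coupling_solution M F V f y"
begin

abbreviation "G \<equiv> grad M y"

lemma y_pw: "piecewise_affine y" and y_def: "y \<in> deformations M F" and G_pos: "0 < G k"
  using sol by (auto simp: coupling_solution_def admissible_def deformations_h_iff)

lemma G_shift: "G (k + K) = G k"
  by (rule grad_shift[OF y_def])

lemma f_shift: "f (l + 2 * N) = f l" and f_mean: "(\<Sum>l\<in>sites M. f l) = 0"
  using f by (auto simp: displacements_def)

text \<open>Subtracting the mean \<open>c\<close> from a test function does not change the energy because \<open>f\<close> has mean zero.\<close>

lemma perturbation_admissible:
  assumes per: "\<And>l. \<phi> (l + 2 * N) = \<phi> l" and pw: "piecewise_affine \<phi>"
    and c: "(\<Sum>l\<in>sites M. \<phi> l - c) = 0"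
  shows "\<exists>d>0. \<forall>t. \<bar>t\<bar> < d \<longrightarrow> (\<lambda>l. y l + t * (\<phi> l - c)) \<in> admissible M F"
proof -
  have defo: "(\<lambda>l. y l + t * (\<phi> l - c)) \<in> deformations M F" for t
  proof -
    obtain v where v: "v \<in> displacements M" "\<And>l. y l = eps M * F * real_of_int l + v l"
      using y_def by (auto simp: deformations_def)
    have "(\<lambda>l. v l + t * (\<phi> l - c)) \<in> displacements M"
      using v(1) per c by (simp add: displacements_def sum.distrib flip: sum_distrib_left)
    then show ?thesis
      using v(2) by (auto simp: deformations_def intro!: bexI[of _ "\<lambda>l. v l + t * (\<phi> l - c)"])
  qed
  \<comment> \<open>Positivity is an open condition on each of finitely many elements; periodicity
    then carries it to all indices.\<close>
  have "\<forall>\<^sub>F t in nhds 0. \<forall>k\<in>{1..K}. 0 < G k + t * grad M \<phi> k"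
  proof (rule eventually_ball_finite, simp, rule ballI)
    fix k
    have "((\<lambda>t. G k + t * grad M \<phi> k) \<longlongrightarrow> G k + 0 * grad M \<phi> k) (nhds 0)"
      by (intro tendsto_intros filterlim_ident)
    then show "\<forall>\<^sub>F t in nhds 0. 0 < G k + t * grad M \<phi> k"
      using G_pos[of k] by (intro order_tendstoD(1)) auto
  qed
  then obtain d where d: "d > 0" "\<And>t. dist t 0 < d \<Longrightarrow> \<forall>k\<in>{1..K}. 0 < G k + t * grad M \<phi> k"
    unfolding eventually_nhds_metric by blast
  have "(\<lambda>l. y l + t * (\<phi> l - c)) \<in> admissible M F" if "\<bar>t\<bar> < d" for t
  proof -
    let ?z = "\<lambda>l. y l + t * (\<phi> l - c)"
    have "0 < grad M ?z k" for k
    proof -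
      have "(k - 1) mod K + 1 \<in> {1..K}" using indices by (simp add: add1_zle_eq)
      then have "0 < grad M ?z ((k - 1) mod K + 1)"
        using d(2)[of t] that by (simp add: grad_lincomb)
      then show ?thesis using periodic_mod[of "grad M ?z" k] grad_shift[OF defo] by simp
    qed
    then show ?thesis
      using defo piecewise_affine_lincomb[OF y_pw pw] by (simp add: admissible_def deformations_h_iff)
  qed
  then show ?thesis using d(1) by blast
qed

text \<open>The argument of the site energy at node \<open>K1 - 1\<close>. Among the interface and
  atomistic sites only this one and node \<open>K2 + 1\<close>, with argument \<open>PR\<close>,
  have a stencil reaching beyond the nodes \<open>K1 - 1\<close> to \<open>K2 + 1\<close>, on which
  the test functions vanish.\<close>

definition PL :: "real^4" where
  "PL = vector [G K1, G K1 + G (K1 + 1), - G (K1 - 1), - 2 * G (K1 - 1)]"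

definition PR :: "real^4" where
  "PR = vector [G (K2 + 2), 2 * G (K2 + 2), - G (K2 + 1), - (G (K2 + 1) + G K2)]"

text \<open>Everything in the atomistic region except the two outer interface sites is constant in t
  and goes into \<open>C\<close>. The summands \<open>t * 0\<close> give both sites the shape that
  \<open>V_curve_derivative\<close> differentiates.\<close>

lemma E_ac_perturbation:
  assumes pw: "piecewise_affine \<phi>" and zero: "\<And>k. K1 - 1 \<le> k \<Longrightarrow> k \<le> K2 + 1 \<Longrightarrow> \<phi> (nd k) = 0"
  defines "a \<equiv> grad M \<phi> (K1 - 1)" and "b \<equiv> grad M \<phi> (K2 + 2)"
  shows "\<exists>C. \<forall>t. E_ac M V f (\<lambda>l. y l + t * (\<phi> l - c)) = C
     + eps M * V (vector [G K1 + t * 0, G K1 + G (K1 + 1) + t * 0, - G (K1 - 1) + t * (- a), - 2 * G (K1 - 1) + t * (- 2 * a)])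
     + eps M * V (vector [G (K2 + 2) + t * b, 2 * G (K2 + 2) + t * (2 * b), - G (K2 + 1) + t * 0, - (G (K2 + 1) + G K2) + t * 0])
     + (\<Sum>k\<in>KcT M. h k * W V (G k + t * grad M \<phi> k))
     + eps M / 2 * (W V (G (K1 - 1) + t * a) + W V (G (K2 + 2) + t * b))
     - t * (eps M * (\<Sum>l\<in>sites M. f l * \<phi> l))"
proof -
  note D = Dq_atomistic[OF y_pw] and D\<phi> = Dq_atomistic[OF pw]
  have Dzero: "Dq M j \<phi> (nd k) = 0" if "K1 - 1 \<le> k" "k \<le> K2 + 1" "K1 - 1 \<le> k + j" "k + j \<le> K2 + 1" for j k
    using node_add[of k j] zero[of k] zero[of "k + j"] that by (simp add: Dq_def)
  define A where "A = (\<Sum>k = K1 + 1 .. K2 - 1. V (vector [Dq M 1 y (nd k), Dq M 2 y (nd k), Dq M (- 1) y (nd k), Dq M (- 2) y (nd k)]))"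
  define B where "B = V (vector [Dq M 1 y (nd K1), Dq M 2 y (nd K1), Dq M (- 1) y (nd K1), 2 * Dq M (- 1) y (nd K1)])"
  define B' where "B' = V (vector [Dq M 1 y (nd K2), 2 * Dq M 1 y (nd K2), Dq M (- 1) y (nd K2), Dq M (- 2) y (nd K2)])"
  show ?thesis
  proof (intro exI[of _ "eps M * A + eps M * B + eps M * B' - eps M * (\<Sum>l\<in>sites M. f l * y l)"] allI)
    fix t
    have s1: "(\<Sum>k = K1 + 1 .. K2 - 1. V (vector [Dq M 1 y (nd k) + t * Dq M 1 \<phi> (nd k), Dq M 2 y (nd k) + t * Dq M 2 \<phi> (nd k),
         Dq M (- 1) y (nd k) + t * Dq M (- 1) \<phi> (nd k), Dq M (- 2) y (nd k) + t * Dq M (- 2) \<phi> (nd k)])) = A"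
      unfolding A_def by (rule sum.cong) (simp_all add: Dzero)
    have s2: "(\<Sum>l\<in>sites M. f l * (y l + t * (\<phi> l - c))) = (\<Sum>l\<in>sites M. f l * y l) + t * (\<Sum>l\<in>sites M. f l * \<phi> l)"
    proof -
      have "(\<Sum>l\<in>sites M. f l * (y l + t * (\<phi> l - c)))
          = (\<Sum>l\<in>sites M. f l * y l) + t * (\<Sum>l\<in>sites M. f l * \<phi> l) - (t * c) * (\<Sum>l\<in>sites M. f l)"
        by (simp only: sum_distrib_left flip: sum.distrib sum_subtractf) (simp add: algebra_simps)
      then show ?thesis by (simp add: f_mean)
    qed
    have K: "K1 - 1 \<noteq> K1" "K2 \<noteq> K2 + 1" by auto
    have d1: "Dq M 1 \<phi> (nd (K1 - 1)) = 0" "Dq M 2 \<phi> (nd (K1 - 1)) = 0" "Dq M (- 1) \<phi> (nd (K1 - 1)) = - a"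
      "Dq M 1 \<phi> (nd K1) = 0" "Dq M 2 \<phi> (nd K1) = 0" "Dq M (- 1) \<phi> (nd K1) = 0"
      "Dq M 1 \<phi> (nd K2) = 0" "Dq M (- 1) \<phi> (nd K2) = 0" "Dq M (- 2) \<phi> (nd K2) = 0"
      "Dq M 1 \<phi> (nd (K2 + 1)) = b" "Dq M (- 1) \<phi> (nd (K2 + 1)) = 0" "Dq M (- 2) \<phi> (nd (K2 + 1)) = 0"
      using indices D\<phi>(3)[of "K1 - 1"] D\<phi>(1)[of "K2 + 1"] by (auto simp: Dzero a_def b_def algebra_simps)
    have d2: "Dq M 1 y (nd (K1 - 1)) = G K1" "Dq M 2 y (nd (K1 - 1)) = G K1 + G (K1 + 1)"
      "Dq M (- 1) y (nd (K1 - 1)) = - G (K1 - 1)" "Dq M 1 y (nd (K2 + 1)) = G (K2 + 2)"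
      "Dq M (- 1) y (nd (K2 + 1)) = - G (K2 + 1)" "Dq M (- 2) y (nd (K2 + 1)) = - (G (K2 + 1) + G K2)"
      using indices D(1,2,3)[of "K1 - 1"] D(1,3,4)[of "K2 + 1"] by (auto simp: algebra_simps)
    have s3: "2 * (- G (K1 - 1) + t * - a) = - 2 * G (K1 - 1) + t * (- 2 * a)"
      "2 * (G (K2 + 2) + t * b) = 2 * G (K2 + 2) + t * (2 * b)" by simp_all
    show "E_ac M V f (\<lambda>l. y l + t * (\<phi> l - c)) = eps M * A + eps M * B + eps M * B' - eps M * (\<Sum>l\<in>sites M. f l * y l)
     + eps M * V (vector [G K1 + t * 0, G K1 + G (K1 + 1) + t * 0, - G (K1 - 1) + t * (- a), - 2 * G (K1 - 1) + t * (- 2 * a)])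
     + eps M * V (vector [G (K2 + 2) + t * b, 2 * G (K2 + 2) + t * (2 * b), - G (K2 + 1) + t * 0, - (G (K2 + 1) + G K2) + t * 0])
     + (\<Sum>k\<in>KcT M. h k * W V (G k + t * grad M \<phi> k))
     + eps M / 2 * (W V (G (K1 - 1) + t * a) + W V (G (K2 + 2) + t * b))
     - t * (eps M * (\<Sum>l\<in>sites M. f l * \<phi> l))"
      unfolding E_ac_def Dq_lincomb grad_lincomb s1 s2
      using K by (simp only: sum.insert[OF finite.insertI[OF finite.emptyI]] sum.insert[OF finite.emptyI]
        finite.intros sum.empty insert_iff empty_iff simp_thms d1 d2 s3 B_def B'_def a_def[symmetric] b_def[symmetric])
        (simp add: algebra_simps)
  qed
qed

lemma first_variation:
  assumes per: "\<And>l. \<phi> (l + 2 * N) = \<phi> l" and pw: "piecewise_affine \<phi>"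
    and zero: "\<And>k. K1 - 1 \<le> k \<Longrightarrow> k \<le> K2 + 1 \<Longrightarrow> \<phi> (nd k) = 0"
  defines "a \<equiv> grad M \<phi> (K1 - 1)" and "b \<equiv> grad M \<phi> (K2 + 2)"
  shows "- (eps M * a * dL V PL) + eps M * b * dR V PR
     + (\<Sum>k\<in>KcT M. h k * grad M \<phi> k * W1 V (G k))
     + eps M / 2 * (a * W1 V (G (K1 - 1)) + b * W1 V (G (K2 + 2)))
     = eps M * (\<Sum>l\<in>sites M. f l * \<phi> l)"
proof -
  define c where "c = (\<Sum>l\<in>sites M. \<phi> l) / real (card (sites M))"
  have "card (sites M) \<noteq> 0" using N_pos by (simp add: sites_def)
  then have c: "(\<Sum>l\<in>sites M. \<phi> l - c) = 0" by (simp add: sum_subtractf c_def)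
  define e where "e t = E_ac M V f (\<lambda>l. y l + t * (\<phi> l - c))" for t
  obtain C where C: "\<And>t. e t = C
     + eps M * V (vector [G K1 + t * 0, G K1 + G (K1 + 1) + t * 0, - G (K1 - 1) + t * (- a), - 2 * G (K1 - 1) + t * (- 2 * a)])
     + eps M * V (vector [G (K2 + 2) + t * b, 2 * G (K2 + 2) + t * (2 * b), - G (K2 + 1) + t * 0, - (G (K2 + 1) + G K2) + t * 0])
     + (\<Sum>k\<in>KcT M. h k * W V (G k + t * grad M \<phi> k))
     + eps M / 2 * (W V (G (K1 - 1) + t * a) + W V (G (K2 + 2) + t * b))
     - t * (eps M * (\<Sum>l\<in>sites M. f l * \<phi> l))"
    using E_ac_perturbation[OF pw zero, of c] unfolding e_def a_def b_def by blast
  have V': "Ck_on (Suc 2) V_dom V" using V_C3 by (simp only: numeral_3_eq_3 numeral_2_eq_2)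
  have dPL: "((\<lambda>t. V (vector [G K1 + t * 0, G K1 + G (K1 + 1) + t * 0, - G (K1 - 1) + t * (- a), - 2 * G (K1 - 1) + t * (- 2 * a)]))
       has_real_derivative - (a * dL V PL)) (at 0)"
    by (rule DERIV_cong[OF V_curve_derivative[OF V']])
       (auto simp: vector_V_dom G_pos add_pos_pos dL_def PL_def algebra_simps)
  have pos: "- G K2 < G (1 + K2)"
    using G_pos[of "1 + K2"] G_pos[of K2] by linarith
  have dPR: "((\<lambda>t. V (vector [G (K2 + 2) + t * b, 2 * G (K2 + 2) + t * (2 * b), - G (K2 + 1) + t * 0, - (G (K2 + 1) + G K2) + t * 0]))
       has_real_derivative b * dR V PR) (at 0)"
    by (rule DERIV_cong[OF V_curve_derivative[OF V']])
       (use pos in \<open>auto simp: vector_V_dom G_pos dR_def PR_def algebra_simps\<close>)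
  have dW: "((\<lambda>t. W V (G k + t * d)) has_real_derivative d * W1 V (G k)) (at 0)" for k d
    by (rule W_curve_derivative[OF V' G_pos])
  have "(e has_real_derivative 0
     + eps M * - (a * dL V PL) + eps M * (b * dR V PR)
     + (\<Sum>k\<in>KcT M. h k * (grad M \<phi> k * W1 V (G k)))
     + eps M / 2 * (a * W1 V (G (K1 - 1)) + b * W1 V (G (K2 + 2)))
     - 1 * (eps M * (\<Sum>l\<in>sites M. f l * \<phi> l))) (at 0)"
    unfolding C
    by (intro DERIV_diff DERIV_add DERIV_const DERIV_cmult DERIV_cmult_right DERIV_ident DERIV_sum dPL dPR dW)
  moreover obtain d where "d > 0" "\<And>t. \<bar>t\<bar> < d \<Longrightarrow> (\<lambda>l. y l + t * (\<phi> l - c)) \<in> admissible M F"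
    using perturbation_admissible[OF per pw c] by blast
  moreover then have "\<forall>t. \<bar>0 - t\<bar> < d \<longrightarrow> e 0 \<le> e t"
    using sol by (simp add: e_def coupling_solution_def)
  ultimately have "0 + eps M * - (a * dL V PL) + eps M * (b * dR V PR)
     + (\<Sum>k\<in>KcT M. h k * (grad M \<phi> k * W1 V (G k)))
     + eps M / 2 * (a * W1 V (G (K1 - 1)) + b * W1 V (G (K2 + 2)))
     - 1 * (eps M * (\<Sum>l\<in>sites M. f l * \<phi> l)) = 0"
    using DERIV_local_min by blast
  then show ?thesis by (simp add: mult.assoc)
qed

text \<open>Divisibility by \<open>K\<close> places a peak at every periodic copy of node k, so that
  the interpolant is a periodic test function.\<close>

definition hat :: "int \<Rightarrow> int \<Rightarrow> real" where
  "hat k = interp (\<lambda>j. if K dvd j - k then 1 else 0)"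

text \<open>The one-site elements \<open>K1 - 1\<close> and \<open>K2 + 2\<close> enter the energy
  with weight one half only. Writing a full jump of W' at every node leaves
  \<open>W1 V .. / 2\<close> as a correction at the two outermost nodes; there it meets
  \<open>dL\<close> or \<open>dR\<close>, to which it is opposite on the diagonal.\<close>

lemma nodal_equation:
  assumes k: "k \<in> Kc M"
  shows "W1 V (G k) - W1 V (G (k + 1))
     + (if k = K1 - 2 then dL V PL + W1 V (G (K1 - 1)) / 2 else 0)
     + (if k = K2 + 2 then dR V PR - W1 V (G (K2 + 2)) / 2 else 0)
     = eps M * (\<Sum>l\<in>sites M. f l * hat k l)"
proof -
  define u :: "int \<Rightarrow> real" where "u j = (if K dvd j - k then 1 else 0)" for j
  have hat: "hat k = interp u" by (simp add: hat_def u_def[abs_def])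
  have u_shift: "u (j + K) = u j" for j
    by (simp add: u_def diff_add_eq[symmetric])
  have u: "u j = (if j = k then 1 else 0)" if "1 \<le> j" "j \<le> K" for j
  proof -
    have "j = k" if "K dvd j - k"
    proof -
      have "\<bar>j - k\<bar> < K" using Kc_range[OF k] \<open>1 \<le> j\<close> \<open>j \<le> K\<close> by linarith
      then show ?thesis using dvd_imp_le_int[of "j - k" K] that by linarith
    qed
    then show ?thesis by (auto simp: u_def)
  qed
  have zero: "u j = 0" if "K1 - 1 \<le> j" "j \<le> K2 + 1" for j
    using u[of j] that k indices by (auto simp: Kc_def)
  note fv = first_variation[OF interp_shift[of u, OF u_shift] piecewise_affine_interp, unfolded interp_node, OF zero]
  have g: "h j * grad M (interp u) j = u j - u (j - 1)" for j
    using grad_nodes[OF piecewise_affine_interp[of u], of j] by (simp add: interp_node)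
  define w where "w j = W1 V (G j)" for j
  have a: "eps M * grad M (interp u) (K1 - 1) = - u (K1 - 2)"
    using g[of "K1 - 1"] unit_element(2)[of "K1 - 1"] zero[of "K1 - 1"] indices by simp
  have b: "eps M * grad M (interp u) (K2 + 2) = u (K2 + 2)"
    using g[of "K2 + 2"] unit_element(2)[of "K2 + 2"] zero[of "1 + K2"] indices by simp
  have "(\<Sum>j\<in>KcT M. h j * grad M (interp u) j * W1 V (G j)) = (\<Sum>j\<in>KcT M. w j * u j) - (\<Sum>j\<in>KcT M. w j * u (j - 1))"
    unfolding g w_def by (simp add: algebra_simps sum_subtractf)
  also have "(\<Sum>j\<in>KcT M. w j * u j) = (\<Sum>j\<in>Kc M. w j * u j) - w (K2 + 2) * u (K2 + 2)"
    by (simp add: sum_Kc)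
  also have "(\<Sum>j\<in>Kc M. w j * u j) = (\<Sum>j\<in>Kc M. if j = k then w k else 0)"
    using u Kc_range by (intro sum.cong) auto
  also have "\<dots> = w k" using k finite_Kc by simp
  also have "(\<Sum>j\<in>KcT M. w j * u (j - 1)) = (\<Sum>j\<in>Kc M. w (j + 1) * u j) - w (K1 - 1) * u (K1 - 2)"
  proof -
    have "w (K + 1) * u (K + 1 - 1) = w 1 * u (1 - 1)"
      using u_shift[of 0] G_shift[of 1] by (simp add: w_def add.commute)
    from sum_Kc_shift[of "\<lambda>j. w j * u (j - 1)", OF this] sum_Kc[of "\<lambda>j. w j * u (j - 1)"] zero[of "K2 + 1"] indices
    show ?thesis by simp
  qed
  also have "(\<Sum>j\<in>Kc M. w (j + 1) * u j) = (\<Sum>j\<in>Kc M. if j = k then w (k + 1) else 0)"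
    using u Kc_range by (intro sum.cong) auto
  also have "\<dots> = w (k + 1)" using k finite_Kc by simp
  finally have S: "(\<Sum>j\<in>KcT M. h j * grad M (interp u) j * W1 V (G j))
      = w k - w (K2 + 2) * u (K2 + 2) - (w (k + 1) - w (K1 - 1) * u (K1 - 2))" .
  have e: "eps M / 2 * (grad M (interp u) (K1 - 1) * W1 V (G (K1 - 1)) + grad M (interp u) (K2 + 2) * W1 V (G (K2 + 2)))
     = (- u (K1 - 2) * w (K1 - 1) + u (K2 + 2) * w (K2 + 2)) / 2"
    unfolding a[symmetric] b[symmetric] w_def by (simp add: field_simps)
  have uu: "u (K1 - 2) = (if k = K1 - 2 then 1 else 0)" "u (K2 + 2) = (if k = K2 + 2 then 1 else 0)"
    using u[of "K1 - 2"] u[of "K2 + 2"] indices by auto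
  show ?thesis
    using fv indices unfolding S e hat unfolding a b uu w_def by (auto split: if_splits)
qed

end


section \<open>Load and coarse-graining estimator\<close>

lemma sum_real_Suc: "(\<Sum>j = 1..n. real j) = real n * (real n + 1) / 2"
  by (induction n) (simp_all add: algebra_simps)

lemma sum_real_Suc_square: "(\<Sum>j = 1..n. (real j)\<^sup>2) = real n * (real n + 1) * (2 * real n + 1) / 6"
  by (induction n) (simp_all add: field_simps power2_eq_square)

text \<open>With H the mean size, both H - \<kappa> h and H - \<kappa> h' are nonnegative; since h +
  h' = 2 H, their product is H^2 - 2 \<kappa> H^2 + \<kappa>^2 h h'.\<close>

lemma patch_ratio:
  fixes h h' \<kappa> :: real
  assumes "0 < h" "0 < h'" "0 < \<kappa>" "\<kappa> * h \<le> (h + h') / 2" "\<kappa> * h' \<le> (h + h') / 2"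
  shows "((h + h') / 2)\<^sup>2 * (2 * \<kappa> - 1) \<le> \<kappa>\<^sup>2 * (h * h')"
    and "((h + h') / 2) * (2 * \<kappa> - 1) \<le> \<kappa> * h'"
proof -
  define H where "H = (h + h') / 2"
  have h': "h' = 2 * H - h" by (simp add: H_def field_simps)
  have "0 \<le> (H - \<kappa> * h) * (H - \<kappa> * h')"
    using assms by (intro mult_nonneg_nonneg) (auto simp: H_def)
  then show "((h + h') / 2)\<^sup>2 * (2 * \<kappa> - 1) \<le> \<kappa>\<^sup>2 * (h * h')"
    unfolding H_def[symmetric] h' by (simp add: algebra_simps power2_eq_square)
  show "((h + h') / 2) * (2 * \<kappa> - 1) \<le> \<kappa> * h'"
    using assms(4) by (simp add: algebra_simps)
qed

text \<open>\<open>e\<close> is the squared nodal estimator at an interior node and \<open>p\<close>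
  the modulus of the patch average. The average is formed from absolute values, so the cross term is
  nonnegative and may be dropped in the lower bound; averages of opposite sign cannot
  cancel.\<close>

lemma patch_mean_bounds:
  fixes h h' \<kappa> x x' :: real
  assumes h: "0 < h" "0 < h'" and \<kappa>: "1 / 2 < \<kappa>" "\<kappa> < 1"
    and r: "\<kappa> * h \<le> (h + h') / 2" "\<kappa> * h' \<le> (h + h') / 2"
  defines "H \<equiv> (h + h') / 2" and "p \<equiv> (h * \<bar>x\<bar> + h' * \<bar>x'\<bar>) / (h + h')"
    and "e \<equiv> (h ^ 3 * x\<^sup>2 + h' ^ 3 * x'\<^sup>2) / 4"
  shows "\<kappa> * e \<le> H ^ 3 * p\<^sup>2" and "H ^ 3 * p\<^sup>2 \<le> (2 * \<kappa> / (2 * \<kappa> - 1))\<^sup>2 * e"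
proof -
  define X X' where "X = \<bar>x\<bar>" and "X' = \<bar>x'\<bar>"
  have X: "0 \<le> X" "0 \<le> X'" "x\<^sup>2 = X\<^sup>2" "x'\<^sup>2 = X'\<^sup>2" by (auto simp: X_def X'_def)
  have H: "0 < H" using h by (simp add: H_def)
  have "H * p = (h * X + h' * X') / 2" using h by (simp add: H_def p_def X_def X'_def field_simps)
  then have Hp: "H ^ 3 * p\<^sup>2 = H * ((h * X + h' * X') / 2)\<^sup>2"
    by (metis power_mult_distrib power3_eq_cube power2_eq_square mult.assoc)
  have e: "e = (h ^ 3 * X\<^sup>2 + h' ^ 3 * X'\<^sup>2) / 4" by (simp add: e_def X)
  have "\<kappa> * e = (\<kappa> * h * (h * X)\<^sup>2 + \<kappa> * h' * (h' * X')\<^sup>2) / 4"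
    by (simp add: e power2_eq_square power3_eq_cube algebra_simps)
  also have "\<dots> \<le> (H * (h * X)\<^sup>2 + H * (h' * X')\<^sup>2) / 4"
    using r by (intro divide_right_mono add_mono mult_right_mono) (auto simp: H_def)
  also have "\<dots> \<le> H * ((h * X + h' * X') / 2)\<^sup>2"
  proof -
    have "0 \<le> H * ((h * X) * (h' * X'))" using H h X by simp
    then show ?thesis by (simp add: power2_eq_square algebra_simps)
  qed
  finally show "\<kappa> * e \<le> H ^ 3 * p\<^sup>2" by (simp add: Hp)
  have "(h * h') * (H * ((h * X + h' * X') / 2)\<^sup>2) \<le> 2 * H\<^sup>2 * e"
  proof -
    have H2: "2 * H = h + h'" by (simp add: H_def)
    \<comment> \<open>Lagrange's identity for a weighted Cauchy-Schwarz inequality, with the defect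
      as explicit square.\<close>
    have "(h * h') * (h * X + h' * X')\<^sup>2 + (h\<^sup>2 * X - h'\<^sup>2 * X')\<^sup>2 = (h + h') * (4 * e)"
      by (simp add: e power2_eq_square power3_eq_cube algebra_simps)
    then have "(h * h') * (h * X + h' * X')\<^sup>2 \<le> 2 * H * (4 * e)"
      using zero_le_power2[of "h\<^sup>2 * X - h'\<^sup>2 * X'"] unfolding H2 by linarith
    then have "H * ((h * h') * (h * X + h' * X')\<^sup>2) \<le> H * (2 * H * (4 * e))"
      using H by (intro mult_left_mono) auto
    then show ?thesis by (simp add: power2_eq_square field_simps)
  qed
  then have *: "(h * h') * (H ^ 3 * p\<^sup>2) \<le> 2 * H\<^sup>2 * e" by (simp add: Hp)
  have "H\<^sup>2 * (2 * \<kappa> - 1) * (H ^ 3 * p\<^sup>2) \<le> \<kappa>\<^sup>2 * (h * h') * (H ^ 3 * p\<^sup>2)"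
    using patch_ratio(1)[OF h _ r] \<kappa> H by (intro mult_right_mono) (auto simp: H_def)
  also have "\<dots> \<le> \<kappa>\<^sup>2 * (2 * H\<^sup>2 * e)"
    unfolding mult.assoc[of "\<kappa>\<^sup>2"] using * by (rule mult_left_mono) simp
  finally have "H\<^sup>2 * ((2 * \<kappa> - 1) * (H ^ 3 * p\<^sup>2)) \<le> H\<^sup>2 * (2 * \<kappa>\<^sup>2 * e)"
    by (simp add: algebra_simps)
  then have **: "(2 * \<kappa> - 1) * (H ^ 3 * p\<^sup>2) \<le> 2 * \<kappa>\<^sup>2 * e" using H by simp
  have e0: "0 \<le> e" using h X by (simp add: e)
  \<comment> \<open>The sharper factor 2 \<kappa>^2 / (2\<kappa> - 1) is relaxed to a perfect
    square, using 2\<kappa> - 1 < 1.\<close>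
  have "(2 * \<kappa> - 1) * ((2 * \<kappa> - 1) * (H ^ 3 * p\<^sup>2)) \<le> 1 * (2 * \<kappa>\<^sup>2 * e)"
    by (rule mult_mono) (use ** \<kappa> e0 H in auto)
  also have "\<dots> \<le> (2 * \<kappa>)\<^sup>2 * e" using e0 by (simp add: power_mult_distrib mult_right_mono)
  finally show "H ^ 3 * p\<^sup>2 \<le> (2 * \<kappa> / (2 * \<kappa> - 1))\<^sup>2 * e"
    using \<kappa> unfolding power_divide times_divide_eq_left
    by (subst pos_le_divide_eq) (simp_all add: power2_eq_square mult_ac)
qed

text \<open>
  \<open>F\<close> is the load, \<open>p\<close> the patch average and \<open>\<nu>\<close> the oscillation; all terms are compared after
  multiplication by \<open>sqrt H\<close>. The factor \<open>\<alpha>\<close> is 1 at interior nodes and \<open>2\<kappa>\<close> at the outermost ones.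
\<close>

lemma force_bounds:
  fixes F H p \<nu> \<eta> \<kappa> \<alpha> \<rho> :: real
  assumes H: "0 < H" and \<nu>: "0 \<le> \<nu>" and \<eta>: "0 \<le> \<eta>" and \<kappa>: "0 < \<kappa>" and \<alpha>: "1 / 2 \<le> \<alpha>" and \<rho>: "0 \<le> \<rho>"
    and F: "\<bar>F - p * H\<bar> \<le> \<nu> * sqrt H"
    and osc: "H\<^sup>2 * \<nu>\<^sup>2 \<le> min (\<kappa> / 4) (\<rho>\<^sup>2) * \<eta>\<^sup>2"
    and low: "\<alpha>\<^sup>2 * \<kappa> * \<eta>\<^sup>2 \<le> H ^ 3 * p\<^sup>2" and up: "H ^ 3 * p\<^sup>2 \<le> (2 * \<rho>)\<^sup>2 * \<eta>\<^sup>2"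
  shows "(\<alpha> - 1 / 2)\<^sup>2 * \<kappa> * \<eta>\<^sup>2 \<le> H * F\<^sup>2" and "H * F\<^sup>2 \<le> 9 * \<rho>\<^sup>2 * \<eta>\<^sup>2"
proof -
  define s0 where "s0 = sqrt H * H * \<bar>p\<bar>"
  have s0: "0 \<le> s0" "s0\<^sup>2 = H ^ 3 * p\<^sup>2"
    using H by (simp_all add: s0_def power_mult_distrib) (simp add: power3_eq_cube power2_eq_square)
  have "\<bar>sqrt H * F - sqrt H * (p * H)\<bar> = sqrt H * \<bar>F - p * H\<bar>"
    using H by (simp add: abs_mult flip: right_diff_distrib)
  also have "\<dots> \<le> sqrt H * (\<nu> * sqrt H)" using F H by (intro mult_left_mono) auto
  also have "\<dots> = H * \<nu>" using H by simp
  finally have "\<bar>\<bar>sqrt H * F\<bar> - \<bar>sqrt H * (p * H)\<bar>\<bar> \<le> H * \<nu>"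
    using abs_triangle_ineq3 order.trans by blast
  moreover have "\<bar>sqrt H * (p * H)\<bar> = s0" using H by (simp add: s0_def abs_mult)
  ultimately have s: "s0 - H * \<nu> \<le> \<bar>sqrt H * F\<bar>" "\<bar>sqrt H * F\<bar> \<le> s0 + H * \<nu>" by auto
  have sq: "\<bar>sqrt H * F\<bar>\<^sup>2 = H * F\<^sup>2" using H by (simp add: power_mult_distrib)
  \<comment> \<open>The two entries of the minimum serve one bound each:
    \<open>sqrt \<kappa> / 2 * \<eta>\<close> is what the lower bound can lose, half of the main
    term when \<open>\<alpha>\<close> is 1, and \<open>\<rho> * \<eta>\<close> is what raises the
    factor 2 of the upper bound to 3.\<close>
  have "(H * \<nu>)\<^sup>2 \<le> (sqrt \<kappa> / 2 * \<eta>)\<^sup>2"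
    using order.trans[OF osc mult_right_mono[OF min.cobounded1 zero_le_power2]] \<kappa>
    by (simp add: power_mult_distrib power_divide)
  then have o1: "H * \<nu> \<le> sqrt \<kappa> / 2 * \<eta>" by (rule power2_le_imp_le) (use \<eta> \<kappa> in auto)
  have "(H * \<nu>)\<^sup>2 \<le> (\<rho> * \<eta>)\<^sup>2"
    using order.trans[OF osc mult_right_mono[OF min.cobounded2 zero_le_power2]]
    by (simp add: power_mult_distrib)
  then have o2: "H * \<nu> \<le> \<rho> * \<eta>" by (rule power2_le_imp_le) (use \<eta> \<rho> in auto)
  have "(\<alpha> * sqrt \<kappa> * \<eta>)\<^sup>2 \<le> s0\<^sup>2" using low \<kappa> by (simp add: power_mult_distrib s0)
  then have b1: "\<alpha> * sqrt \<kappa> * \<eta> \<le> s0" using s0(1) by (rule power2_le_imp_le)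
  have "s0\<^sup>2 \<le> (2 * \<rho> * \<eta>)\<^sup>2" using up by (simp add: power_mult_distrib s0)
  then have b2: "s0 \<le> 2 * \<rho> * \<eta>" by (rule power2_le_imp_le) (use \<eta> \<rho> in auto)
  have "(\<alpha> - 1 / 2) * sqrt \<kappa> * \<eta> \<le> \<bar>sqrt H * F\<bar>"
    using s(1) o1 b1 by (simp add: algebra_simps)
  then have "((\<alpha> - 1 / 2) * sqrt \<kappa> * \<eta>)\<^sup>2 \<le> \<bar>sqrt H * F\<bar>\<^sup>2"
    using \<alpha> \<kappa> \<eta> by (intro power_mono) auto
  then show "(\<alpha> - 1 / 2)\<^sup>2 * \<kappa> * \<eta>\<^sup>2 \<le> H * F\<^sup>2"
    using \<kappa> unfolding sq by (simp add: power_mult_distrib)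
  have "\<bar>sqrt H * F\<bar> \<le> 3 * \<rho> * \<eta>" using s(2) o2 b2 by simp
  then have "\<bar>sqrt H * F\<bar>\<^sup>2 \<le> (3 * \<rho> * \<eta>)\<^sup>2" by (intro power_mono) auto
  then show "H * F\<^sup>2 \<le> 9 * \<rho>\<^sup>2 * \<eta>\<^sup>2" unfolding sq by (simp add: power_mult_distrib)
qed

context mesh
begin

lemma h_patch_pos: "0 < h_patch M k"
  using h_pos[of k] h_pos[of "k + 1"] by (simp add: h_patch_def)

lemma l2norm_sq: "(l2norm M D v)\<^sup>2 = eps M * (\<Sum>l\<in>D. (v l)\<^sup>2)"
  using eps_pos by (simp add: l2norm_def sum_nonneg)

lemma l2norm_nonneg: "0 \<le> l2norm M D v"
  using eps_pos by (simp add: l2norm_def sum_nonneg)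

lemma l2norm_const: "(l2norm M (elem_sites M k) (\<lambda>_. c))\<^sup>2 = h k * c\<^sup>2"
  using node_pred[of k] by (simp add: l2norm_sq h_eq elem_sites_def)

lemma eta_cg_T_sq: "(eta_cg_T M fb k)\<^sup>2 = h k ^ 3 * (fb k)\<^sup>2 / 2"
  unfolding eta_cg_T_def l2norm_const using h_pos[of k]
  by (simp add: power2_eq_square power3_eq_cube)

lemma eta_cg_node_nonneg: "0 \<le> eta_cg_node M fb k"
  using h_pos l2norm_nonneg by (simp add: eta_cg_node_def eta_cg_T_def)

lemma eta_cg_node_sq:
  "(eta_cg_node M fb k)\<^sup>2 =
     (if k = K1 - 2 then h k ^ 3 * (fb k)\<^sup>2 / 4
      else if k = K2 + 2 then h (k + 1) ^ 3 * (fb (k + 1))\<^sup>2 / 4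
      else (h k ^ 3 * (fb k)\<^sup>2 + h (k + 1) ^ 3 * (fb (k + 1))\<^sup>2) / 4)"
proof -
  have sq: "(sqrt 2 * x / 2)\<^sup>2 = x\<^sup>2 / 2" for x :: real by (simp add: power_mult_distrib power_divide)
  have "0 \<le> h j ^ 3 * x\<^sup>2 / 2" for j x using h_pos[of j] by simp
  then show ?thesis
    unfolding eta_cg_node_def by (simp add: eta_cg_T_sq sq add_nonneg_nonneg add.commute[of K2])
qed

lemma eta_cg_nodes:
  assumes "\<And>k. fb (k + K) = fb k"
  shows "(eta_cg M fb)\<^sup>2 = (\<Sum>k\<in>Kc M. (eta_cg_node M fb k)\<^sup>2)"
proof -
  \<comment> \<open>The half of an element's square that each of its end nodes receives; zero on the
    two one-site elements that carry no estimator. A node then collects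
    \<open>\<theta> k + \<theta> (k + 1)\<close>, at the outermost nodes too.\<close>
  define \<theta> where "\<theta> k = (if k = K1 - 1 \<or> k = K2 + 2 then 0 else (eta_cg_T M fb k)\<^sup>2 / 2)" for k
  have "\<theta> (K + 1) = \<theta> 1"
    using indices assms[of 1] h_shift[of 1] by (simp add: \<theta>_def eta_cg_T_sq add.commute)
  then have shift: "(\<Sum>k\<in>Kc M. \<theta> (k + 1)) = (\<Sum>k\<in>Kc M. \<theta> k)"
    by (subst sum_Kc_shift) (simp_all add: \<theta>_def)
  have "(\<Sum>k\<in>Kc M. (eta_cg_node M fb k)\<^sup>2) = (\<Sum>k\<in>Kc M. \<theta> k + \<theta> (k + 1))"
    using indices by (intro sum.cong) (auto simp: Kc_def eta_cg_node_sq \<theta>_def eta_cg_T_sq algebra_simps)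
  also have "\<dots> = 2 * (\<Sum>k\<in>Kc M. \<theta> k)" by (simp add: sum.distrib shift)
  also have "\<dots> = (\<Sum>k\<in>KcT M. 2 * \<theta> k)" by (simp add: sum_Kc sum_distrib_left) (simp add: \<theta>_def)
  also have "\<dots> = (\<Sum>k\<in>KcT M. (eta_cg_T M fb k)\<^sup>2)"
    using indices by (intro sum.cong) (auto simp: \<theta>_def KcT_def Kc_def)
  also have "\<dots> = (eta_cg M fb)\<^sup>2" by (simp add: eta_cg_def sum_nonneg)
  finally show ?thesis by simp
qed

lemma fb_patch_sq:
  "(fb_patch M fb k)\<^sup>2 =
     (if k = K1 - 2 then (fb k)\<^sup>2 else if k = K2 + 2 then (fb (k + 1))\<^sup>2
      else ((h k * \<bar>fb k\<bar> + h (k + 1) * \<bar>fb (k + 1)\<bar>) / (h k + h (k + 1)))\<^sup>2)"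
proof -
  have "(sgn1 s * x)\<^sup>2 = x\<^sup>2" for s x by (simp add: sgn1_def)
  then show ?thesis by (simp add: fb_patch_def add.commute[of K2] del: times_divide_eq_right)
qed

end

context coupled
begin

section \<open>Hat functions and the load on a node patch\<close>

lemma hat_shift: "hat k (l + 2 * N) = hat k l"
  unfolding hat_def by (rule interp_shift) (simp add: diff_add_eq[symmetric])

lemma hat_values:
  shows "l \<in> elem_sites M k \<Longrightarrow> hat k l = real_of_int (l - nd (k - 1)) / real_of_int (nd k - nd (k - 1))"
    and "l \<in> elem_sites M (k + 1) \<Longrightarrow> hat k l = 1 - real_of_int (l - nd k) / real_of_int (nd (k + 1) - nd k)"
    and "l \<in> elem_sites M j \<Longrightarrow> k + 2 \<le> j \<Longrightarrow> j \<le> k + K - 1 \<Longrightarrow> hat k l = 0"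
proof -
  have no: "\<not> K dvd i" if "0 < \<bar>i\<bar>" "\<bar>i\<bar> < K" for i
    using dvd_imp_le_int[of i K] that by auto
  show "hat k l = real_of_int (l - nd (k - 1)) / real_of_int (nd k - nd (k - 1))" if "l \<in> elem_sites M k"
    unfolding hat_def interp_elem[OF that] using no[of "- 1"] indices by simp
  show "hat k l = 1 - real_of_int (l - nd k) / real_of_int (nd (k + 1) - nd k)" if "l \<in> elem_sites M (k + 1)"
    unfolding hat_def interp_elem[OF that] using no[of 1] indices by simp
  show "hat k l = 0" if "l \<in> elem_sites M j" "k + 2 \<le> j" "j \<le> k + K - 1"
    unfolding hat_def interp_elem[OF that(1)] using no[of "j - k"] no[of "j - 1 - k"] that by simp
qed

abbreviation "patch k \<equiv> elem_sites M k \<union> elem_sites M (k + 1)"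

lemma hat_range:
  assumes "l \<in> patch k" shows "0 \<le> hat k l" "hat k l \<le> 1"
proof -
  have "0 \<le> hat k l \<and> hat k l \<le> 1"
  proof (cases "l \<in> elem_sites M k")
    case True
    then show ?thesis unfolding hat_values(1)[OF True] by (auto simp: elem_sites_def)
  next
    case False
    then have l: "l \<in> elem_sites M (k + 1)" using assms by simp
    then show ?thesis unfolding hat_values(2)[OF l] by (auto simp: elem_sites_def)
  qed
  then show "0 \<le> hat k l" "hat k l \<le> 1" by auto
qed

lemma sum_patch: "(\<Sum>l\<in>patch k. g l) = (\<Sum>l\<in>elem_sites M k. g l) + (\<Sum>l\<in>elem_sites M (k + 1). g l)"
  for g :: "int \<Rightarrow> real"
  by (rule sum.union_disjoint) (auto simp: finite_elem_sites dest: elem_sites_unique)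

text \<open>The peak counts to the left element only, giving (n + 1)/2 there and (n' - 1)/2 on the
  right; the offsets cancel, so the discrete mass is exactly the mean element size.\<close>

lemma hat_mass: "eps M * (\<Sum>l\<in>patch k. hat k l) = h_patch M k"
proof -
  define n n' where "n = nat (nd k - nd (k - 1))" and "n' = nat (nd (k + 1) - nd k)"
  have n: "0 < n" "0 < n'" using node_pred[of k] node_step[of k] by (auto simp: n_def n'_def)
  have hn: "h k = eps M * n" "h (k + 1) = eps M * n'"
    using node_pred[of k] node_step[of k] by (auto simp: n_def n'_def h_eq)
  have "(\<Sum>l\<in>elem_sites M k. hat k l) = (\<Sum>j = 1..n. real j / n)"
    using sum_elem_sites[of n k "\<lambda>x. x"] by (simp add: n_def hat_values(1) cong: sum.cong)
  also have "\<dots> = (n + 1) / 2"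
    unfolding sum_divide_distrib[symmetric] sum_real_Suc using n by simp
  finally have 1: "(\<Sum>l\<in>elem_sites M k. hat k l) = (n + 1) / 2" .
  have "(\<Sum>l\<in>elem_sites M (k + 1). hat k l) = (\<Sum>j = 1..n'. 1 - real j / n')"
    using sum_elem_sites[of n' "k + 1" "\<lambda>x. 1 - x"] by (simp add: n'_def hat_values(2) cong: sum.cong)
  also have "\<dots> = n' - (n' + 1) / 2"
    unfolding sum_subtractf sum_divide_distrib[symmetric] sum_real_Suc using n by simp
  finally have 2: "(\<Sum>l\<in>elem_sites M (k + 1). hat k l) = n' - (n' + 1) / 2" .
  show ?thesis
    unfolding sum_patch 1 2 h_patch_def hn by (simp add: field_simps)
qed

definition load :: "int \<Rightarrow> real" where
  "load k = eps M * (\<Sum>l\<in>sites M. f l * hat k l)"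

text \<open>The patch may straddle the end of \<open>sites M\<close>. In the period beginning at its
  left end it is contiguous, and the hat vanishes on the remainder.\<close>

lemma load_patch: "load k = eps M * (\<Sum>l\<in>patch k. f l * hat k l)"
proof -
  have "(\<Sum>l\<in>sites M. f l * hat k l) = (\<Sum>l=nd (k - 1) + 1..nd (k - 1) + 2 * N. f l * hat k l)"
    unfolding sites_window by (rule sum_periodic_window) (simp_all add: f_shift hat_shift)
  also have "\<dots> = (\<Sum>l\<in>patch k. f l * hat k l)"
  proof (rule sum.mono_neutral_right)
    have "nd (k + 1) \<le> nd (k - 1) + 2 * N"
      using node_le[of "k + 1" "k + K - 1"] node_shift_pred[of k] indices by simp
    then show "patch k \<subseteq> {nd (k - 1) + 1..nd (k - 1) + 2 * N}"
      using node_pred[of k] node_step[of k] by (auto simp: elem_sites_def)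
    show "\<forall>l\<in>{nd (k - 1) + 1..nd (k - 1) + 2 * N} - patch k. f l * hat k l = 0"
    proof
      fix l assume l: "l \<in> {nd (k - 1) + 1..nd (k - 1) + 2 * N} - patch k"
      define j where "j = elem M l"
      have j: "l \<in> elem_sites M j" unfolding j_def by (rule elem_in)
      have "\<not> j \<le> k - 1" using node_le[of j "k - 1"] j l by (auto simp: elem_sites_def)
      moreover have "j \<noteq> k" "j \<noteq> k + 1" using j l by auto
      moreover have "\<not> k + K \<le> j"
        using node_le[of "k + K - 1" "j - 1"] node_shift_pred[of k] j l by (auto simp: elem_sites_def)
      ultimately have "hat k l = 0" by (intro hat_values(3)[OF j]) auto
      then show "f l * hat k l = 0" by simp
    qed
  qed simp
  finally show ?thesis by (simp add: load_def)
qed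

text \<open>Since \<open>0 \<le> hat \<le> 1\<close>, the squared norm of a hat function is at most its integral.\<close>

lemma load_approx:
  "\<bar>load k - c * h_patch M k\<bar> \<le> l2norm M (patch k) (\<lambda>l. f l - c) * sqrt (h_patch M k)"
proof -
  have "load k - c * h_patch M k = eps M * (\<Sum>l\<in>patch k. (f l - c) * hat k l)"
    unfolding load_patch hat_mass[symmetric]
    by (simp add: left_diff_distrib sum_subtractf sum_distrib_left[of c] algebra_simps)
  then have "(load k - c * h_patch M k)\<^sup>2 = (eps M)\<^sup>2 * (\<Sum>l\<in>patch k. (f l - c) * hat k l)\<^sup>2"
    by (simp add: power_mult_distrib)
  also have "\<dots> \<le> (eps M)\<^sup>2 * ((\<Sum>l\<in>patch k. (f l - c)\<^sup>2) * (\<Sum>l\<in>patch k. (hat k l)\<^sup>2))"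
    by (intro mult_left_mono Cauchy_Schwarz_ineq_sum) auto
  also have "\<dots> \<le> (eps M)\<^sup>2 * ((\<Sum>l\<in>patch k. (f l - c)\<^sup>2) * (\<Sum>l\<in>patch k. hat k l))"
    using hat_range by (intro mult_left_mono sum_mono sum_nonneg) (auto simp: power2_eq_square mult_left_le)
  also have "\<dots> = (l2norm M (patch k) (\<lambda>l. f l - c))\<^sup>2 * h_patch M k"
    unfolding l2norm_sq hat_mass[symmetric] by (simp add: power2_eq_square)
  also have "\<dots> = (l2norm M (patch k) (\<lambda>l. f l - c) * sqrt (h_patch M k))\<^sup>2"
    using h_patch_pos[of k] by (simp add: power_mult_distrib)
  finally have "\<bar>load k - c * h_patch M k\<bar>\<^sup>2 \<le> (l2norm M (patch k) (\<lambda>l. f l - c) * sqrt (h_patch M k))\<^sup>2"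
    by simp
  then show ?thesis
    by (rule power2_le_imp_le) (use l2norm_nonneg h_patch_pos[of k] in \<open>simp add: less_imp_le\<close>)
qed

lemma load_bounds:
  assumes \<kappa>: "1 / 2 < \<kappa>" "\<kappa> < 1"
    and i: "\<kappa> \<le> h_patch M k / h k" "\<kappa> \<le> h_patch M k / h (k + 1)"
    and ii: "(h_patch M k)\<^sup>2 * (l2norm M (patch k) (\<lambda>l. f l - fb_patch M fb k))\<^sup>2
        \<le> min (\<kappa> / 4) (\<kappa>\<^sup>2 / (2 * \<kappa> - 1)\<^sup>2) * (eta_cg_node M fb k)\<^sup>2"
  shows "(if k = K1 - 2 \<or> k = K2 + 2 then \<kappa> ^ 3 else \<kappa> / 4) * (eta_cg_node M fb k)\<^sup>2 \<le> h_patch M k * (load k)\<^sup>2"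
    and "h_patch M k * (load k)\<^sup>2 \<le> 9 * (\<kappa> / (2 * \<kappa> - 1))\<^sup>2 * (eta_cg_node M fb k)\<^sup>2"
proof -
  define H where "H = h_patch M k"
  have H: "0 < H" "H = (h k + h (k + 1)) / 2" using h_patch_pos by (auto simp: H_def h_patch_def)
  have r: "\<kappa> * h k \<le> (h k + h (k + 1)) / 2" "\<kappa> * h (k + 1) \<le> (h k + h (k + 1)) / 2"
    using i h_pos[of k] h_pos[of "k + 1"] by (simp_all add: h_patch_def field_simps)
  define \<rho> where "\<rho> = \<kappa> / (2 * \<kappa> - 1)"
  have \<rho>: "1 \<le> \<rho>" using \<kappa> by (simp add: \<rho>_def)
  define \<alpha> where "\<alpha> = (if k = K1 - 2 \<or> k = K2 + 2 then 2 * \<kappa> else 1)"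
  have "\<alpha>\<^sup>2 * \<kappa> * (eta_cg_node M fb k)\<^sup>2 \<le> H ^ 3 * (fb_patch M fb k)\<^sup>2 \<and>
        H ^ 3 * (fb_patch M fb k)\<^sup>2 \<le> (2 * \<rho>)\<^sup>2 * (eta_cg_node M fb k)\<^sup>2"
  proof -
    \<comment> \<open>At an outermost node the other element has a single site, so the mean size H
      is at most the size \<open>a\<close> of the coarse one. The patch average is that of the
      coarse element, and H >= \<kappa> a then yields \<kappa>^3 = (2\<kappa>)^2 \<kappa> /
      4.\<close>
    have boundary: "(2 * \<kappa>)\<^sup>2 * \<kappa> * (a ^ 3 * x\<^sup>2 / 4) \<le> H ^ 3 * x\<^sup>2 \<and> H ^ 3 * x\<^sup>2 \<le> (2 * \<rho>)\<^sup>2 * (a ^ 3 * x\<^sup>2 / 4)"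
      if "\<kappa> * a \<le> H" "H \<le> a" for a x
    proof
      have "0 < a" using that H by simp
      have "(\<kappa> * a) ^ 3 * x\<^sup>2 \<le> H ^ 3 * x\<^sup>2"
        using that \<kappa> \<open>0 < a\<close> by (intro mult_right_mono power_mono) auto
      then show "(2 * \<kappa>)\<^sup>2 * \<kappa> * (a ^ 3 * x\<^sup>2 / 4) \<le> H ^ 3 * x\<^sup>2"
        by (simp add: power_mult_distrib power2_eq_square power3_eq_cube mult_ac)
      have "H ^ 3 * x\<^sup>2 \<le> 1 * (a ^ 3 * x\<^sup>2)"
        using that H by (simp add: mult_right_mono power_mono)
      also have "\<dots> \<le> \<rho>\<^sup>2 * (a ^ 3 * x\<^sup>2)"
        using \<open>0 < a\<close> \<rho> by (intro mult_right_mono) auto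
      finally have "H ^ 3 * x\<^sup>2 \<le> \<rho>\<^sup>2 * (a ^ 3 * x\<^sup>2)" .
      then show "H ^ 3 * x\<^sup>2 \<le> (2 * \<rho>)\<^sup>2 * (a ^ 3 * x\<^sup>2 / 4)" by (simp add: power_mult_distrib)
    qed
    consider "k = K1 - 2" | "k = K2 + 2" "k \<noteq> K1 - 2" | "k \<noteq> K1 - 2" "k \<noteq> K2 + 2" by blast
    then show ?thesis
    proof cases
      case 1
      then have "h (k + 1) = eps M" using unit_element(2)[of "k + 1"] indices by simp
      then have "H \<le> h k" using h_ge[of k] by (simp add: H)
      then show ?thesis using boundary[of "h k" "fb k"] r(1) 1 by (simp add: fb_patch_sq eta_cg_node_sq \<alpha>_def H)
    next
      case 2
      then have "h k = eps M" using unit_element(2)[of k] indices by simp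
      then have "H \<le> h (k + 1)" using h_ge[of "k + 1"] by (simp add: H)
      then show ?thesis
        using boundary[of "h (k + 1)" "fb (k + 1)"] r(2) 2 by (simp add: fb_patch_sq eta_cg_node_sq \<alpha>_def H)
    next
      case 3
      then show ?thesis
        using patch_mean_bounds[OF h_pos h_pos \<kappa> r, of "fb k" "fb (k + 1)"]
        by (simp add: fb_patch_sq eta_cg_node_sq \<alpha>_def H \<rho>_def)
    qed
  qed
  moreover have "1 / 2 \<le> \<alpha>" using \<kappa> by (simp add: \<alpha>_def)
  moreover have "H\<^sup>2 * (l2norm M (patch k) (\<lambda>l. f l - fb_patch M fb k))\<^sup>2 \<le> min (\<kappa> / 4) (\<rho>\<^sup>2) * (eta_cg_node M fb k)\<^sup>2"
    using ii by (simp add: H_def \<rho>_def power_divide)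
  ultimately have *: "(\<alpha> - 1 / 2)\<^sup>2 * \<kappa> * (eta_cg_node M fb k)\<^sup>2 \<le> H * (load k)\<^sup>2"
    "H * (load k)\<^sup>2 \<le> 9 * \<rho>\<^sup>2 * (eta_cg_node M fb k)\<^sup>2"
    using force_bounds[OF H(1) l2norm_nonneg eta_cg_node_nonneg, where \<kappa> = \<kappa> and \<rho> = \<rho> and \<alpha> = \<alpha>] \<kappa> \<rho>
      load_approx[of k "fb_patch M fb k"] unfolding H_def by auto
  \<comment> \<open>For \<open>\<alpha>\<close> = 2\<kappa> the remaining 2\<kappa> - 1/2 is at
    least \<kappa> because \<kappa> > 1/2; for \<open>\<alpha>\<close> = 1 the factor is exactly
    \<kappa>/4.\<close>
  have "\<kappa>\<^sup>2 * \<kappa> \<le> (2 * \<kappa> - 1 / 2)\<^sup>2 * \<kappa>" using \<kappa> by (intro mult_right_mono power_mono) auto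
  then have "(if k = K1 - 2 \<or> k = K2 + 2 then \<kappa> ^ 3 else \<kappa> / 4) \<le> (\<alpha> - 1 / 2)\<^sup>2 * \<kappa>"
    by (simp add: \<alpha>_def power2_eq_square power3_eq_cube)
  from order.trans[OF mult_right_mono[OF this] *(1)]
  show "(if k = K1 - 2 \<or> k = K2 + 2 then \<kappa> ^ 3 else \<kappa> / 4) * (eta_cg_node M fb k)\<^sup>2 \<le> h_patch M k * (load k)\<^sup>2"
    by (simp add: H_def)
  show "h_patch M k * (load k)\<^sup>2 \<le> 9 * (\<kappa> / (2 * \<kappa> - 1))\<^sup>2 * (eta_cg_node M fb k)\<^sup>2"
    using *(2) by (simp add: H_def \<rho>_def)
qed

end


section \<open>Recovered gradient\<close>

lemma interpolant_sum:
  fixes a b :: real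
  assumes n: "0 < n"
  shows "(\<Sum>j = 1..n. ((1 - real j / n) * a + real j / n * b)\<^sup>2)
     = n * a\<^sup>2 + (real n + 1) * a * (b - a) + (b - a)\<^sup>2 * (real n + 1) * (2 * real n + 1) / (6 * real n)"
proof -
  have "((1 - real j / n) * a + real j / n * b)\<^sup>2
      = a\<^sup>2 + (2 * a * (b - a) / n) * real j + ((b - a)\<^sup>2 / (real n)\<^sup>2) * (real j)\<^sup>2" for j
    using n by (simp add: field_simps power2_eq_square)
  then have "(\<Sum>j = 1..n. ((1 - real j / n) * a + real j / n * b)\<^sup>2)
      = n * a\<^sup>2 + (2 * a * (b - a) / n) * (\<Sum>j = 1..n. real j) + ((b - a)\<^sup>2 / (real n)\<^sup>2) * (\<Sum>j = 1..n. (real j)\<^sup>2)"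
    by (simp only: sum.distrib sum_distrib_left[symmetric]) simp
  also have "\<dots> = n * a\<^sup>2 + (real n + 1) * a * (b - a) + (b - a)\<^sup>2 * (real n + 1) * (2 * real n + 1) / (6 * real n)"
    unfolding sum_real_Suc sum_real_Suc_square using n by (simp add: field_simps power2_eq_square)
  finally show ?thesis .
qed

text \<open>The sum starts at j = 1 and so favours the right value \<open>b\<close>. In the lower
  bound \<open>a\<close> is eliminated; 1/4 is the limit for large n, where the mean (a^2 + a b +
  b^2)/3 is minimal at a = -b/2.\<close>

lemma interpolant_sum_bounds:
  fixes a b :: real
  assumes n: "0 < n"
  defines "q \<equiv> (\<Sum>j = 1..n. ((1 - real j / n) * a + real j / n * b)\<^sup>2)"
  shows "real n * b\<^sup>2 / 4 \<le> q" and "q \<le> (real n - 1) / 2 * a\<^sup>2 + (real n + 1) / 2 * b\<^sup>2"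
proof -
  define x where "x = real n"
  have x: "1 \<le> x" using n by (simp add: x_def)
  have q: "q = x * a\<^sup>2 + (x + 1) * a * (b - a) + (b - a)\<^sup>2 * (x + 1) * (2 * x + 1) / (6 * x)"
    unfolding q_def interpolant_sum[OF n] x_def ..
  have "(x - 1) / 2 * a\<^sup>2 + (x + 1) / 2 * b\<^sup>2 - q = (x\<^sup>2 - 1) / (6 * x) * (a - b)\<^sup>2"
    unfolding q using x by (simp add: field_simps power2_eq_square)
  moreover have "0 \<le> (x\<^sup>2 - 1) / (6 * x) * (a - b)\<^sup>2" using x by simp
  ultimately show "q \<le> (real n - 1) / 2 * a\<^sup>2 + (real n + 1) / 2 * b\<^sup>2" by (simp add: x_def)
  \<comment> \<open>Completing the square in \<open>a\<close>, multiplied by a positive factor to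
    clear denominators.\<close>
  have "12 * x * (2 * x - 1) * (q - x * b\<^sup>2 / 4)
      = 2 * (x - 1) * ((2 * x - 1) * a + (x + 1) * b)\<^sup>2 + 9 * x\<^sup>2 * b\<^sup>2"
    unfolding q using x by (simp add: field_simps power2_eq_square)
  moreover have "0 \<le> 2 * (x - 1) * ((2 * x - 1) * a + (x + 1) * b)\<^sup>2 + 9 * x\<^sup>2 * b\<^sup>2"
    using x by simp
  ultimately have "0 \<le> 12 * x * (2 * x - 1) * (q - x * b\<^sup>2 / 4)" by simp
  moreover have "0 < 12 * x * (2 * x - 1)" using x by simp
  ultimately have "0 \<le> q - x * b\<^sup>2 / 4" by (metis zero_le_mult_iff not_less)
  then show "real n * b\<^sup>2 / 4 \<le> q" by (simp add: x_def)
qed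

lemma node_contribution_upper:
  fixes e h h' :: real
  assumes "0 < e" "e \<le> h" "e \<le> h'"
  shows "((h' - e) * h\<^sup>2 + (h + e) * h'\<^sup>2) / (2 * (h + h')\<^sup>2) \<le> (h + h') / 6"
proof -
  \<comment> \<open>The numerator factors as (h + h')(h h' + e (h' - h)). The claim thus becomes a
    quadratic inequality in \<open>h'\<close>, shown by completing the square; the remainder is
    nonnegative as h >= e.\<close>
  have "0 \<le> (h' - (h + 3 * e) / 2)\<^sup>2 + 3 * (h - e) * (h + 3 * e) / 4"
    using assms by simp
  also have "\<dots> = (h + h')\<^sup>2 - 3 * (h * h' + e * (h' - h))"
    by (simp add: field_simps power2_eq_square)
  finally have "(h + h') * (3 * (h * h' + e * (h' - h))) \<le> (h + h') * (h + h')\<^sup>2"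
    using assms by (intro mult_left_mono) auto
  then have "3 * ((h' - e) * h\<^sup>2 + (h + e) * h'\<^sup>2) \<le> (h + h') * (h + h')\<^sup>2"
    by (simp add: algebra_simps power2_eq_square)
  moreover have "0 < (h + h')\<^sup>2" using assms by simp
  ultimately show ?thesis by (simp add: pos_divide_le_eq)
qed

context coupled
begin

definition jump :: "int \<Rightarrow> real" where
  "jump k = G k - G (k + 1)"

definition recovery_error :: "int \<Rightarrow> real" where
  "recovery_error k = (l2norm M (elem_sites M k) (\<lambda>l. G_rec M y l - grad_site M y l))\<^sup>2"

text \<open>The lower bound retains the right end only and so ties element k to node k. In the upper
  bound the left weight vanishes on a one-site element.\<close>

lemma recovery_error_bounds:
  shows "h k * (G_node M y k - G k)\<^sup>2 / 4 \<le> recovery_error k"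
    and "recovery_error k \<le> (h k - eps M) / 2 * (G_node M y (k - 1) - G k)\<^sup>2 + (h k + eps M) / 2 * (G_node M y k - G k)\<^sup>2"
proof -
  define n where "n = nat (nd k - nd (k - 1))"
  have n: "0 < n" "real_of_int (nd k - nd (k - 1)) = real n" using node_pred[of k] by (auto simp: n_def)
  have h: "h k = eps M * n" using n by (simp add: h_eq)
  define a b where "a = G_node M y (k - 1) - G k" and "b = G_node M y k - G k"
  define q where "q = (\<Sum>j = 1..n. ((1 - real j / n) * a + real j / n * b)\<^sup>2)"
  have "recovery_error k = eps M * (\<Sum>l\<in>elem_sites M k.
      ((1 - real_of_int (l - nd (k - 1)) / real_of_int (nd k - nd (k - 1))) * a
        + real_of_int (l - nd (k - 1)) / real_of_int (nd k - nd (k - 1)) * b)\<^sup>2)"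
    unfolding recovery_error_def l2norm_sq
  proof (intro arg_cong[of _ _ "\<lambda>s. eps M * s"] sum.cong refl)
    fix l assume l: "l \<in> elem_sites M k"
    define t where "t = real_of_int (l - nd (k - 1)) / real_of_int (nd k - nd (k - 1))"
    have "G_rec M y l - grad_site M y l = (1 - t) * a + t * b"
      unfolding G_rec_eq_interp interp_elem[OF l] grad_site_def elem_eqI[OF l] t_def[symmetric] a_def b_def
      by (simp add: algebra_simps)
    then show "(G_rec M y l - grad_site M y l)\<^sup>2
      = ((1 - real_of_int (l - nd (k - 1)) / real_of_int (nd k - nd (k - 1))) * a
        + real_of_int (l - nd (k - 1)) / real_of_int (nd k - nd (k - 1)) * b)\<^sup>2"
      by (simp only: t_def)
  qed
  also have "\<dots> = eps M * q"
    unfolding q_def using sum_elem_sites[OF n_def, of "\<lambda>x. ((1 - x) * a + x * b)\<^sup>2"] by (simp only:)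
  finally have e: "recovery_error k = eps M * q" .
  note bounds = interpolant_sum_bounds[OF n(1), where a = a and b = b, folded q_def]
  have "eps M * (n * b\<^sup>2 / 4) \<le> eps M * q"
    using bounds(1) eps_pos by (intro mult_left_mono) auto
  then show "h k * (G_node M y k - G k)\<^sup>2 / 4 \<le> recovery_error k"
    unfolding e h b_def by (simp add: mult_ac)
  have "eps M * q \<le> eps M * ((real n - 1) / 2 * a\<^sup>2 + (real n + 1) / 2 * b\<^sup>2)"
    using bounds(2) eps_pos by (intro mult_left_mono) auto
  then show "recovery_error k \<le> (h k - eps M) / 2 * (G_node M y (k - 1) - G k)\<^sup>2 + (h k + eps M) / 2 * (G_node M y k - G k)\<^sup>2"
    unfolding e h a_def b_def by (simp add: field_simps)
qed

lemma G_node_right: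
  assumes "k \<noteq> K1 - 1" "k \<noteq> K2 + 1"
  shows "G_node M y k - G k = - (h (k + 1) * jump k / (h k + h (k + 1)))"
  using assms h_pos[of k] h_pos[of "k + 1"] by (simp add: G_node_def jump_def field_simps)

lemma G_node_left:
  assumes "k - 1 \<noteq> K1 - 1" "k - 1 \<noteq> K2 + 1"
  shows "G_node M y (k - 1) - G k = h (k - 1) * jump (k - 1) / (h (k - 1) + h k)"
  using assms h_pos[of k] h_pos[of "k - 1"] by (simp add: G_node_def jump_def field_simps)

text \<open>
  The element \<open>K1 - 1\<close> consists of a single site, where the recovered gradient is exact;
  the element \<open>K2 + 2\<close> consists of a single site as well, but there it is not exact.
\<close>

lemma eta_z_elements: "(eta_z M y)\<^sup>2 = (\<Sum>k\<in>Kc M. recovery_error k)"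
proof -
  have union: "(l2norm M (elem_sites M i \<union> elem_sites M j) v)\<^sup>2
     = (l2norm M (elem_sites M i) v)\<^sup>2 + (l2norm M (elem_sites M j) v)\<^sup>2" if "i \<noteq> j" for i j v
    unfolding l2norm_sq
    by (subst sum.union_disjoint) (simp_all add: finite_elem_sites elem_sites_disjoint[OF that] distrib_left)
  have exact: "recovery_error (K1 - 1) = 0"
  proof -
    have "G_node M y (K1 - 1) = G (K1 - 1)" by (simp add: G_node_def)
    then have "recovery_error (K1 - 1) \<le> 0"
      using recovery_error_bounds(2)[of "K1 - 1"] unit_element(2)[of "K1 - 1"] indices by simp
    then show ?thesis using zero_le_power2 unfolding recovery_error_def by (metis antisym)
  qed
  have "(eta_z_T M y k)\<^sup>2 = recovery_error k + (if k = K2 + 3 then recovery_error (K2 + 2) else 0)"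
    if "k \<in> KcT M" for k
  proof -
    consider "k = K1 - 2" | "k = K2 + 3" | "k \<noteq> K1 - 2" "k \<noteq> K2 + 3" by blast
    then show ?thesis
      using indices exact by cases (simp_all add: eta_z_T_def union recovery_error_def add.commute[of K2])
  qed
  then have "(\<Sum>k\<in>KcT M. (eta_z_T M y k)\<^sup>2)
     = (\<Sum>k\<in>KcT M. recovery_error k + (if k = K2 + 3 then recovery_error (K2 + 2) else 0))"
    by (intro sum.cong) auto
  also have "\<dots> = (\<Sum>k\<in>Kc M. recovery_error k)"
  proof -
    have "K2 + 3 \<in> KcT M" using indices by (simp add: KcT_def Kc_def)
    then show ?thesis using finite_Kc by (simp add: sum.distrib sum_Kc)
  qed
  finally show ?thesis by (metis eta_z_def real_sqrt_pow2 sum_nonneg zero_le_power2)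
qed

lemma jump_shift: "jump (k + K) = jump k"
  using G_shift[of k] G_shift[of "k + 1"] by (simp add: jump_def algebra_simps)

lemma eta_z_upper: "(eta_z M y)\<^sup>2 \<le> (\<Sum>k\<in>Kc M. h_patch M k * (jump k)\<^sup>2 / 3)"
proof -
  define \<alpha> where "\<alpha> k = (h k - eps M) / 2 * (h (k - 1) * jump (k - 1) / (h (k - 1) + h k))\<^sup>2" for k
  define \<beta> where "\<beta> k = (h k + eps M) / 2 * (h (k + 1) * jump k / (h k + h (k + 1)))\<^sup>2" for k
  have "recovery_error k \<le> \<alpha> k + \<beta> k" if k: "k \<in> Kc M" for k
  proof -
    \<comment> \<open>At k = \<open>K2 + 2\<close> the left nodal value is the prescribed one and
      not a weighted mean, but its weight is zero.\<close>
    have "(h k - eps M) / 2 * (G_node M y (k - 1) - G k)\<^sup>2 = \<alpha> k"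
    proof (cases "k = K2 + 2")
      case True
      then have "h k = eps M" using unit_element(2)[of k] indices by simp
      then show ?thesis by (simp add: \<alpha>_def)
    next
      case False
      then have "k - 1 \<noteq> K1 - 1" "k - 1 \<noteq> K2 + 1" using k indices by (auto simp: Kc_def)
      then show ?thesis by (simp add: \<alpha>_def G_node_left)
    qed
    moreover have "k \<noteq> K1 - 1" "k \<noteq> K2 + 1" using k indices by (auto simp: Kc_def)
    then have "(h k + eps M) / 2 * (G_node M y k - G k)\<^sup>2 = \<beta> k" by (simp add: \<beta>_def G_node_right)
    ultimately show ?thesis using recovery_error_bounds(2)[of k] by simp
  qed
  then have "(eta_z M y)\<^sup>2 \<le> (\<Sum>k\<in>Kc M. \<alpha> k + \<beta> k)"
    unfolding eta_z_elements by (rule sum_mono)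
  also have "\<dots> = (\<Sum>k\<in>Kc M. \<alpha> (k + 1) + \<beta> k)"
  proof -
    have "\<alpha> (K + 1) = \<alpha> 1"
      using h_shift[of 0] h_shift[of 1] jump_shift[of 0] by (simp add: \<alpha>_def add.commute)
    \<comment> \<open>The end terms at \<open>K1 - 1\<close> and \<open>K2 + 2\<close> contain the
      factor \<open>h k - eps M\<close> and vanish.\<close>
    from sum_Kc_shift[of \<alpha>, OF this] show ?thesis
      using unit_element(2)[of "K1 - 1"] unit_element(2)[of "K2 + 2"] indices by (simp add: sum.distrib \<alpha>_def)
  qed
  also have "\<dots> \<le> (\<Sum>k\<in>Kc M. h_patch M k * (jump k)\<^sup>2 / 3)"
  proof (rule sum_mono)
    fix k
    have "\<alpha> (k + 1) + \<beta> k = ((h (k + 1) - eps M) * (h k)\<^sup>2 + (h k + eps M) * (h (k + 1))\<^sup>2) / (2 * (h k + h (k + 1))\<^sup>2) * (jump k)\<^sup>2"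
      by (simp add: \<alpha>_def \<beta>_def power_mult_distrib power_divide add_divide_distrib diff_divide_distrib algebra_simps)
    also have "\<dots> \<le> (h k + h (k + 1)) / 6 * (jump k)\<^sup>2"
      by (intro mult_right_mono node_contribution_upper eps_pos h_ge) simp
    finally show "\<alpha> (k + 1) + \<beta> k \<le> h_patch M k * (jump k)\<^sup>2 / 3" by (simp add: h_patch_def)
  qed
  finally show ?thesis .
qed

text \<open>The right node gives an error of at least h h'^2 \<open>jump\<close>^2 / (16 H^2), and
  the product of the two patch ratios is (2\<kappa> - 1)^2 H^3 <= \<kappa>^3 h h'^2.\<close>

lemma recovery_error_lower:
  assumes k: "k \<in> Kc M" and \<kappa>: "1 / 2 < \<kappa>" "\<kappa> < 1"
    and i: "\<kappa> \<le> h_patch M k / h k" "\<kappa> \<le> h_patch M k / h (k + 1)"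
  shows "(2 * \<kappa> - 1)\<^sup>2 * (h_patch M k * (jump k)\<^sup>2) \<le> 16 * \<kappa> ^ 3 * recovery_error k"
proof -
  define H where "H = h_patch M k"
  have H: "0 < H" "H = (h k + h (k + 1)) / 2" using h_patch_pos by (auto simp: H_def h_patch_def)
  have r: "\<kappa> * h k \<le> (h k + h (k + 1)) / 2" "\<kappa> * h (k + 1) \<le> (h k + h (k + 1)) / 2"
    using i h_pos[of k] h_pos[of "k + 1"] by (simp_all add: h_patch_def field_simps)
  have ratio: "H\<^sup>2 * (2 * \<kappa> - 1) \<le> \<kappa>\<^sup>2 * (h k * h (k + 1))" "H * (2 * \<kappa> - 1) \<le> \<kappa> * h (k + 1)"
    unfolding H(2) using \<kappa> by (intro patch_ratio h_pos r; simp)+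
  have "(H\<^sup>2 * (2 * \<kappa> - 1)) * (H * (2 * \<kappa> - 1)) \<le> (\<kappa>\<^sup>2 * (h k * h (k + 1))) * (\<kappa> * h (k + 1))"
    by (rule mult_mono) (use ratio \<kappa> H(1) h_pos[of k] h_pos[of "k + 1"] in auto)
  then have "((H\<^sup>2 * (2 * \<kappa> - 1)) * (H * (2 * \<kappa> - 1))) * (jump k)\<^sup>2 \<le> ((\<kappa>\<^sup>2 * (h k * h (k + 1))) * (\<kappa> * h (k + 1))) * (jump k)\<^sup>2"
    by (rule mult_right_mono) simp
  then have 1: "H\<^sup>2 * ((2 * \<kappa> - 1)\<^sup>2 * (H * (jump k)\<^sup>2)) \<le> \<kappa> ^ 3 * (h k * (h (k + 1) * jump k)\<^sup>2)"
    by (simp add: power2_eq_square power3_eq_cube mult_ac)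
  have sum_h: "h k + h (k + 1) = 2 * H" by (simp add: H(2))
  have "k \<noteq> K1 - 1" "k \<noteq> K2 + 1" using k indices by (auto simp: Kc_def)
  then have "h k * (h (k + 1) * jump k / (2 * H))\<^sup>2 / 4 \<le> recovery_error k"
    using recovery_error_bounds(1)[of k] sum_h by (simp add: G_node_right)
  then have "h k * (h (k + 1) * jump k)\<^sup>2 \<le> H\<^sup>2 * (16 * recovery_error k)"
    using H(1) by (simp add: power_divide power_mult_distrib field_simps)
  then have "\<kappa> ^ 3 * (h k * (h (k + 1) * jump k)\<^sup>2) \<le> \<kappa> ^ 3 * (H\<^sup>2 * (16 * recovery_error k))"
    using \<kappa> by (intro mult_left_mono) auto
  with 1 have "H\<^sup>2 * ((2 * \<kappa> - 1)\<^sup>2 * (H * (jump k)\<^sup>2)) \<le> H\<^sup>2 * (16 * \<kappa> ^ 3 * recovery_error k)"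
    by (simp add: mult_ac)
  then show ?thesis using H(1) by (simp add: H_def)
qed

end


section \<open>Comparison of the estimators\<close>

lemma (in mesh) E_int_bounds:
  assumes "\<And>k. 0 < grad M y k"
  obtains lo hi where "E_int M y = {lo..hi}" "0 < lo" "lo \<le> hi"
    "\<And>k. k \<in> Kc M \<union> Ki M \<union> {K1 + 1} \<Longrightarrow> grad M y k \<in> {lo..hi}"
proof -
  let ?R = "grad M y ` (Kc M \<union> Ki M \<union> {K1 + 1})"
  have fin: "finite ?R" "?R \<noteq> {}" using finite_Kc by (auto simp: Ki_def)
  show ?thesis
  proof (rule that)
    show "E_int M y = {Min ?R..Max ?R}" by (simp add: E_int_def Let_def)
    have "Min ?R \<in> ?R" using fin by (rule Min_in)
    then show "0 < Min ?R" using assms by auto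
    then show "Min ?R \<le> Max ?R" using fin by (meson Max_ge Min_in)
    show "grad M y k \<in> {Min ?R..Max ?R}" if "k \<in> Kc M \<union> Ki M \<union> {K1 + 1}" for k
      using fin(1) that by (auto intro!: Min_le Max_ge)
  qed
qed

locale coupled_bounds = coupled M F V f y + potential_bounds V lo hi m Mx
  for M :: mesh and F :: real and V :: "real^4 \<Rightarrow> real" and f y :: "int \<Rightarrow> real" and lo hi m Mx :: real +
  assumes G_range: "\<And>k. k \<in> Kc M \<union> Ki M \<union> {mK1 M + 1} \<Longrightarrow> grad M y k \<in> {lo..hi}"
    and left: "\<bar>grad M y (mK1 M - 1) - grad M y (mK1 M)\<bar> \<le> 3 * \<bar>grad M y (mK1 M - 2) - grad M y (mK1 M - 1)\<bar>"
      "\<bar>grad M y (mK1 M) - grad M y (mK1 M + 1)\<bar> \<le> 3 * \<bar>grad M y (mK1 M - 2) - grad M y (mK1 M - 1)\<bar>"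
    and right: "\<bar>grad M y (mK2 M) - grad M y (mK2 M + 1)\<bar> \<le> 3 * \<bar>grad M y (mK2 M + 2) - grad M y (mK2 M + 3)\<bar>"
      "\<bar>grad M y (mK2 M + 1) - grad M y (mK2 M + 2)\<bar> \<le> 3 * \<bar>grad M y (mK2 M + 2) - grad M y (mK2 M + 3)\<bar>"
begin

lemma G_in: "k \<in> Kc M \<Longrightarrow> G k \<in> {lo..hi}" "k \<in> Kc M \<Longrightarrow> G (k + 1) \<in> {lo..hi}"
  "G (K1 - 1) \<in> {lo..hi}" "G K1 \<in> {lo..hi}" "G (K1 + 1) \<in> {lo..hi}"
  "G K2 \<in> {lo..hi}" "G (K2 + 1) \<in> {lo..hi}" "G (K2 + 2) \<in> {lo..hi}"
proof -
  show "G k \<in> {lo..hi}" if "k \<in> Kc M" using that by (intro G_range) auto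
  show "G (k + 1) \<in> {lo..hi}" if k: "k \<in> Kc M"
  proof (cases "k = K")
    case True
    have "1 \<in> Kc M" using indices by (simp add: Kc_def)
    then show ?thesis using True G_shift[of 1] G_range[of 1] by (simp add: add.commute)
  next
    case False
    then have "k + 1 \<in> Kc M \<union> Ki M" using k by (auto simp: Kc_def Ki_def)
    then show ?thesis by (intro G_range) auto
  qed
  show "G (K1 - 1) \<in> {lo..hi}" "G K1 \<in> {lo..hi}" "G (K1 + 1) \<in> {lo..hi}"
    "G K2 \<in> {lo..hi}" "G (K2 + 1) \<in> {lo..hi}" "G (K2 + 2) \<in> {lo..hi}"
    using indices by (intro G_range; simp add: Kc_def Ki_def)+
qed

lemma bounds_pos: "0 < m" "m \<le> Mx"
  using m_nonneg[OF diag4_box4[OF G_in(4)]] by auto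

lemma left_interface: "\<bar>dL V PL + W1 V (G (K1 - 1)) / 2\<bar> \<le> 0.0936 * (\<bar>jump (K1 - 2)\<bar> * m)"
proof -
  have "W1 V (G (K1 - 1)) / 2 = - dL V (diag4 (G (K1 - 1)))"
    using W1_eq_dL[OF G_pos] by simp
  moreover have "\<bar>dL V PL - dL V (diag4 (G (K1 - 1)))\<bar> \<le> 0.0936 * (\<bar>jump (K1 - 2)\<bar> * m)"
    unfolding PL_def
  proof (rule dL_diff[OF G_in(3)])
    show "vector [G K1, G K1 + G (K1 + 1), - G (K1 - 1), - 2 * G (K1 - 1)] \<in> box4 lo hi"
      using G_in(3-5) by (simp add: mem_box4 vec4_nth)
    have J: "jump (K1 - 2) = G (K1 - 2) - G (K1 - 1)" by (simp add: jump_def)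
    show "\<bar>G K1 - G (K1 - 1)\<bar> \<le> 3 * \<bar>jump (K1 - 2)\<bar>"
      unfolding J using left by linarith
    show "\<bar>G K1 + G (K1 + 1) - 2 * G (K1 - 1)\<bar> \<le> 9 * \<bar>jump (K1 - 2)\<bar>"
      unfolding J using left by linarith
  qed
  ultimately show ?thesis by simp
qed

lemma right_interface: "\<bar>dR V PR - W1 V (G (K2 + 2)) / 2\<bar> \<le> 0.0936 * (\<bar>jump (K2 + 2)\<bar> * m)"
proof -
  have "W1 V (G (K2 + 2)) / 2 = dR V (diag4 (G (K2 + 2)))"
    using W1_eq_dR[OF G_pos] by simp
  moreover have "\<bar>dR V PR - dR V (diag4 (G (K2 + 2)))\<bar> \<le> 0.0936 * (\<bar>jump (K2 + 2)\<bar> * m)"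
    unfolding PR_def
  proof (rule dR_diff[OF G_in(8)])
    show "vector [G (K2 + 2), 2 * G (K2 + 2), - G (K2 + 1), - (G (K2 + 1) + G K2)] \<in> box4 lo hi"
      using G_in(6-8) by (simp add: mem_box4 vec4_nth)
    have J: "jump (K2 + 2) = G (K2 + 2) - G (K2 + 3)" by (simp add: jump_def add.commute)
    show "\<bar>G (K2 + 1) - G (K2 + 2)\<bar> \<le> 3 * \<bar>jump (K2 + 2)\<bar>"
      unfolding J using right by linarith
    show "\<bar>G (K2 + 1) + G K2 - 2 * G (K2 + 2)\<bar> \<le> 9 * \<bar>jump (K2 + 2)\<bar>"
      unfolding J using right by linarith
  qed
  ultimately show ?thesis by simp
qed

text \<open>The constants are 1.766 - 0.0936 >= 1.6, and 2.0736 without or 2.0736 + 0.0936 = 2.1672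
  with an interface term, rounded up.\<close>

lemma load_jump:
  assumes k: "k \<in> Kc M"
  shows "1.6 * (m * \<bar>jump k\<bar>) \<le> \<bar>load k\<bar>"
    and "\<bar>load k\<bar> \<le> (if k = K1 - 2 \<or> k = K2 + 2 then 2.2 else 2.08) * (Mx * \<bar>jump k\<bar>)"
proof -
  obtain w where w: "W1 V (G k) - W1 V (G (k + 1)) = w * jump k" "1.766 * m \<le> w" "w \<le> 2.0736 * Mx"
    using W1_diff[OF G_in(1)[OF k] G_in(2)[OF k]] unfolding jump_def by blast
  define s where "s = (if k = K1 - 2 then dL V PL + W1 V (G (K1 - 1)) / 2 else 0)
     + (if k = K2 + 2 then dR V PR - W1 V (G (K2 + 2)) / 2 else 0)"
  have load: "load k = w * jump k + s"
    using nodal_equation[OF k] w(1) by (simp add: s_def load_def)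
  have s: "\<bar>s\<bar> \<le> (if k = K1 - 2 \<or> k = K2 + 2 then 0.0936 else 0) * (m * \<bar>jump k\<bar>)"
    using left_interface right_interface indices by (auto simp: s_def mult.commute[of m])
  have mM: "0 < m" "m \<le> Mx" by (fact bounds_pos)+
  have "\<bar>w * jump k\<bar> = w * \<bar>jump k\<bar>" using w mM by (simp add: abs_mult)
  moreover have "1.766 * m * \<bar>jump k\<bar> \<le> w * \<bar>jump k\<bar>" "w * \<bar>jump k\<bar> \<le> 2.0736 * Mx * \<bar>jump k\<bar>"
    "m * \<bar>jump k\<bar> \<le> Mx * \<bar>jump k\<bar>" "0 \<le> m * \<bar>jump k\<bar>"
    using mult_right_mono[OF w(2)] mult_right_mono[OF w(3)] mult_right_mono[OF mM(2)] mM(1) by simp_all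
  ultimately have b: "\<bar>w * jump k\<bar> = w * \<bar>jump k\<bar>" "1.766 * (m * \<bar>jump k\<bar>) \<le> w * \<bar>jump k\<bar>"
    "w * \<bar>jump k\<bar> \<le> 2.0736 * (Mx * \<bar>jump k\<bar>)" "m * \<bar>jump k\<bar> \<le> Mx * \<bar>jump k\<bar>" "0 \<le> m * \<bar>jump k\<bar>"
    by (simp_all add: mult.assoc)
  have tri: "\<bar>w * jump k\<bar> - \<bar>s\<bar> \<le> \<bar>w * jump k + s\<bar>" "\<bar>w * jump k + s\<bar> \<le> \<bar>w * jump k\<bar> + \<bar>s\<bar>"
    by linarith+
  show "1.6 * (m * \<bar>jump k\<bar>) \<le> \<bar>load k\<bar>"
    using b s tri(1) unfolding load by (auto split: if_splits)
  show "\<bar>load k\<bar> \<le> (if k = K1 - 2 \<or> k = K2 + 2 then 2.2 else 2.08) * (Mx * \<bar>jump k\<bar>)"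
    using b s tri(2) unfolding load by (auto split: if_splits)
qed

context
  fixes \<kappa> :: real and fb :: "int \<Rightarrow> real"
  assumes kappa: "1 / 2 < \<kappa>" "\<kappa> < 1"
    and ratio: "\<And>k. k \<in> Kc M \<Longrightarrow> \<kappa> \<le> h_patch M k / h k \<and> \<kappa> \<le> h_patch M k / h (k + 1)"
    and osc: "\<And>k. k \<in> Kc M \<Longrightarrow>
              (h_patch M k)\<^sup>2 * (l2norm M (patch k) (\<lambda>l. f l - fb_patch M fb k))\<^sup>2
              \<le> min (\<kappa> / 4) (\<kappa>\<^sup>2 / (2 * \<kappa> - 1)\<^sup>2) * (eta_cg_node M fb k)\<^sup>2"
    and fb_periodic: "\<And>k. fb (k + K) = fb k"
begin

lemma jump_le_eta_cg:
  assumes k: "k \<in> Kc M"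
  shows "m\<^sup>2 * (h_patch M k * (jump k)\<^sup>2 / 3) \<le> 2 * (\<kappa> / (2 * \<kappa> - 1))\<^sup>2 * (eta_cg_node M fb k)\<^sup>2"
proof -
  define e where "e = (\<kappa> / (2 * \<kappa> - 1))\<^sup>2 * (eta_cg_node M fb k)\<^sup>2"
  have e: "0 \<le> e" by (simp add: e_def)
  have "(1.6 * (m * \<bar>jump k\<bar>))\<^sup>2 \<le> \<bar>load k\<bar>\<^sup>2"
    using load_jump(1)[OF k] bounds_pos by (intro power_mono) auto
  then have "2.56 * (m\<^sup>2 * (jump k)\<^sup>2) \<le> (load k)\<^sup>2" by (simp add: power_mult_distrib power_divide)
  then have "h_patch M k * (2.56 * (m\<^sup>2 * (jump k)\<^sup>2)) \<le> h_patch M k * (load k)\<^sup>2"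
    using h_patch_pos[of k] by (intro mult_left_mono) auto
  also have "\<dots> \<le> 9 * e"
    using load_bounds(2)[OF kappa ratio[OF k, THEN conjunct1] ratio[OF k, THEN conjunct2] osc[OF k]]
    by (simp add: e_def mult.assoc)
  finally have "2.56 * (m\<^sup>2 * (h_patch M k * (jump k)\<^sup>2)) \<le> 9 * e" by (simp add: mult_ac)
  \<comment> \<open>9/2.56 is below 6, and the factor 1/3 from the recovered gradient turns 6 into
    the 2 of the claim.\<close>
  then have "m\<^sup>2 * (h_patch M k * (jump k)\<^sup>2) \<le> 6 * e" using e by simp
  then show ?thesis by (simp add: e_def mult.assoc)
qed

text \<open>
  At the two outermost nodes the load bound has the larger factor 2.2, with which \<open>\<kappa> / 4\<close> in the
  lower bound of the load would not give the constant 300; there \<open>\<kappa> ^ 3\<close> is available instead.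
\<close>

lemma eta_cg_le_recovery_error:
  assumes k: "k \<in> Kc M"
  shows "(eta_cg_node M fb k)\<^sup>2 \<le> 300 * \<kappa> * Mx\<^sup>2 / (2 * \<kappa> - 1)\<^sup>2 * recovery_error k"
proof -
  define b where "b \<longleftrightarrow> k = K1 - 2 \<or> k = K2 + 2"
  define A :: real where "A = (if b then 2.2 else 2.08)"
  define B where "B = (if b then \<kappa> ^ 3 else \<kappa> / 4)"
  define D where "D = (2 * \<kappa> - 1)\<^sup>2"
  define R where "R = Mx\<^sup>2 * recovery_error k"
  have pos: "0 < B" "0 < D" using kappa by (auto simp: B_def D_def)
  have R: "0 \<le> R" by (simp add: R_def recovery_error_def)
  have "\<bar>load k\<bar>\<^sup>2 \<le> (A * (Mx * \<bar>jump k\<bar>))\<^sup>2"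
    using load_jump(2)[OF k] by (intro power_mono) (auto simp: A_def b_def)
  then have l: "(load k)\<^sup>2 \<le> A\<^sup>2 * (Mx\<^sup>2 * (jump k)\<^sup>2)" by (simp add: power_mult_distrib)
  have "B * (eta_cg_node M fb k)\<^sup>2 \<le> h_patch M k * (load k)\<^sup>2"
    using load_bounds(1)[OF kappa ratio[OF k, THEN conjunct1] ratio[OF k, THEN conjunct2] osc[OF k]]
    by (simp add: B_def b_def)
  also have "\<dots> \<le> h_patch M k * (A\<^sup>2 * (Mx\<^sup>2 * (jump k)\<^sup>2))"
    using l h_patch_pos[of k] by (intro mult_left_mono) auto
  finally have "D * (B * (eta_cg_node M fb k)\<^sup>2) \<le> D * (h_patch M k * (A\<^sup>2 * (Mx\<^sup>2 * (jump k)\<^sup>2)))"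
    using pos by (intro mult_left_mono) auto
  also have "\<dots> = A\<^sup>2 * Mx\<^sup>2 * (D * (h_patch M k * (jump k)\<^sup>2))" by (simp add: mult_ac)
  also have "\<dots> \<le> A\<^sup>2 * Mx\<^sup>2 * (16 * \<kappa> ^ 3 * recovery_error k)"
    unfolding D_def using recovery_error_lower[OF k kappa ratio[OF k, THEN conjunct1] ratio[OF k, THEN conjunct2]]
    by (intro mult_left_mono) auto
  also have "\<dots> = (16 * A\<^sup>2 * \<kappa> ^ 3) * R" by (simp add: R_def mult_ac)
  also have "\<dots> \<le> (B * (300 * \<kappa>)) * R"
  proof (rule mult_right_mono[OF _ R])
    \<comment> \<open>Here 77.44 = 16 * 2.2^2 is below 150 < 300 \<kappa>, and 69.2224 = 16 * 2.08^2
      is below 75 = 300/4, with one power of \<kappa> < 1 to spare.\<close>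
    show "16 * A\<^sup>2 * \<kappa> ^ 3 \<le> B * (300 * \<kappa>)"
    proof (cases b)
      case True
      have "77.44 * \<kappa> ^ 3 \<le> (300 * \<kappa>) * \<kappa> ^ 3"
        using kappa by (intro mult_right_mono) auto
      then show ?thesis using True by (simp add: A_def B_def power2_eq_square mult_ac)
    next
      case False
      have "69.2224 * \<kappa> \<le> 75 * 1" using kappa by (intro mult_mono) auto
      then have "\<kappa>\<^sup>2 * (69.2224 * \<kappa>) \<le> \<kappa>\<^sup>2 * 75" by (intro mult_left_mono) auto
      then show ?thesis using False by (simp add: A_def B_def power2_eq_square power3_eq_cube mult_ac)
    qed
  qed
  finally have "B * (D * (eta_cg_node M fb k)\<^sup>2) \<le> B * (300 * \<kappa> * R)" by (simp add: mult_ac)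
  then have "D * (eta_cg_node M fb k)\<^sup>2 \<le> 300 * \<kappa> * R" using pos by simp
  then show ?thesis using pos by (simp add: R_def D_def field_simps)
qed

lemma estimators_equivalent:
  shows "(2 * \<kappa> - 1) * m / (sqrt 2 * \<kappa>) * eta_z M y \<le> eta_cg M fb"
    and "eta_cg M fb \<le> 10 * sqrt (3 * \<kappa>) * Mx / (2 * \<kappa> - 1) * eta_z M y"
proof -
  have nonneg: "0 \<le> eta_cg M fb" "0 \<le> eta_z M y"
    by (simp_all add: eta_cg_def eta_z_def sum_nonneg)
  have "m\<^sup>2 * (eta_z M y)\<^sup>2 \<le> m\<^sup>2 * (\<Sum>k\<in>Kc M. h_patch M k * (jump k)\<^sup>2 / 3)"
    by (intro mult_left_mono eta_z_upper) simp
  also have "\<dots> \<le> (\<Sum>k\<in>Kc M. 2 * (\<kappa> / (2 * \<kappa> - 1))\<^sup>2 * (eta_cg_node M fb k)\<^sup>2)"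
    unfolding sum_distrib_left by (intro sum_mono jump_le_eta_cg)
  also have "\<dots> = 2 * (\<kappa> / (2 * \<kappa> - 1))\<^sup>2 * (eta_cg M fb)\<^sup>2"
    by (simp add: eta_cg_nodes[of fb, OF fb_periodic] sum_distrib_left)
  finally have "m\<^sup>2 * (eta_z M y)\<^sup>2 \<le> 2 * (\<kappa> / (2 * \<kappa> - 1))\<^sup>2 * (eta_cg M fb)\<^sup>2" .
  moreover define D where "D = 2 * \<kappa> - 1"
  moreover have "0 < D" using kappa by (simp add: D_def)
  ultimately have "((2 * \<kappa> - 1) * m / (sqrt 2 * \<kappa>) * eta_z M y)\<^sup>2 \<le> (eta_cg M fb)\<^sup>2"
    using kappa unfolding D_def[symmetric] by (simp add: power_mult_distrib power_divide field_simps)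
  then show "(2 * \<kappa> - 1) * m / (sqrt 2 * \<kappa>) * eta_z M y \<le> eta_cg M fb"
    using nonneg(1) by (rule power2_le_imp_le)
  have "(eta_cg M fb)\<^sup>2 \<le> (\<Sum>k\<in>Kc M. 300 * \<kappa> * Mx\<^sup>2 / (2 * \<kappa> - 1)\<^sup>2 * recovery_error k)"
    unfolding eta_cg_nodes[of fb, OF fb_periodic] by (intro sum_mono eta_cg_le_recovery_error)
  also have "\<dots> = 300 * \<kappa> * Mx\<^sup>2 / (2 * \<kappa> - 1)\<^sup>2 * (eta_z M y)\<^sup>2"
    unfolding eta_z_elements sum_distrib_left ..
  also have "\<dots> = (10 * sqrt (3 * \<kappa>) * Mx / (2 * \<kappa> - 1) * eta_z M y)\<^sup>2"
    using kappa by (simp add: power_mult_distrib power_divide)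
  finally show "eta_cg M fb \<le> 10 * sqrt (3 * \<kappa>) * Mx / (2 * \<kappa> - 1) * eta_z M y"
    by (rule power2_le_imp_le) (use kappa bounds_pos nonneg in auto)
qed

end

end

theorem theorem14:
  fixes M :: mesh and F \<kappa> :: real and V :: "real^4 \<Rightarrow> real" and f fb y :: "int \<Rightarrow> real"
  assumes mesh: "valid_mesh M"
    and F: "0 < F"
    and V_C3: "Ck_on 3 V_dom V"
    and V_sym: "reflection_symmetric V"
    and f: "f \<in> displacements M"
    and sol: "coupling_solution M F V f y"
    and A: "assumption_A M V y"
    and fb_periodic: "\<And>k. fb (k + mK M) = fb k"
    and kappa: "1 / 2 < \<kappa>" "\<kappa> < 1"
    and i: "\<And>k. k \<in> Kc M \<Longrightarrow>
              \<kappa> \<le> h_patch M k / hT M k \<and> \<kappa> \<le> h_patch M k / hT M (k + 1)"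
    and ii: "\<And>k. k \<in> Kc M \<Longrightarrow>
              (h_patch M k)\<^sup>2 * (l2norm M (elem_sites M k \<union> elem_sites M (k + 1)) (\<lambda>l. f l - fb_patch M fb k))\<^sup>2
              \<le> min (\<kappa> / 4) (\<kappa>\<^sup>2 / (2 * \<kappa> - 1)\<^sup>2) * (eta_cg_node M fb k)\<^sup>2"
    and iii_denominators:
      "grad M y (mK1 M - 2) - grad M y (mK1 M - 1) \<noteq> 0"
      "grad M y (mK2 M + 2) - grad M y (mK2 M + 3) \<noteq> 0"
    and iii: "Max ((\<lambda>(p, q).
                max \<bar>(grad M y p - grad M y (p + 1))
                       / (grad M y (mK1 M - 2) - grad M y (mK1 M - 1))\<bar>
                    \<bar>(grad M y q - grad M y (q + 1))
                       / (grad M y (mK2 M + 2) - grad M y (mK2 M + 3))\<bar>)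
              ` ({mK1 M - 1, mK1 M} \<times> {mK2 M, mK2 M + 1})) \<le> 3"
  shows "(2 * \<kappa> - 1) * m2NN V (E4 M y) / (sqrt 2 * \<kappa>) * eta_z M y \<le> eta_cg M fb
       \<and> eta_cg M fb \<le> 10 * sqrt (3 * \<kappa>) * M2NN V (E4 M y) / (2 * \<kappa> - 1) * eta_z M y"
proof -
  interpret coupled M F V f y
    using mesh V_C3 f sol by unfold_locales
  obtain lo hi where E: "E_int M y = {lo..hi}" "0 < lo" "lo \<le> hi"
    "\<And>k. k \<in> Kc M \<union> Ki M \<union> {K1 + 1} \<Longrightarrow> grad M y k \<in> {lo..hi}"
    using E_int_bounds[OF G_pos] by blast
  interpret potential_bounds V lo hi "m2NN V (E4 M y)" "M2NN V (E4 M y)"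
    by (rule potential_bounds_assumption_A[OF V_C3 V_sym A E(1-3)])
  have quotient: "\<bar>a\<bar> \<le> 3 * \<bar>b\<bar>" if "\<bar>a / b\<bar> \<le> 3" "b \<noteq> 0" for a b :: real
    using that by (simp add: abs_divide pos_divide_le_eq)
  have quotients: "\<bar>(G p - G (p + 1)) / (G (K1 - 2) - G (K1 - 1))\<bar> \<le> 3"
      "\<bar>(G q - G (q + 1)) / (G (K2 + 2) - G (K2 + 3))\<bar> \<le> 3"
    if pq: "p \<in> {K1 - 1, K1}" "q \<in> {K2, K2 + 1}" for p q
  proof -
    \<comment> \<open>The maximum runs over pairs, so each single quotient is reached by choosing
      any partner index from the other interface.\<close>
    have "max \<bar>(G p - G (p + 1)) / (G (K1 - 2) - G (K1 - 1))\<bar> \<bar>(G q - G (q + 1)) / (G (K2 + 2) - G (K2 + 3))\<bar> \<le> 3"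
      by (rule order.trans[OF Max_ge iii]) (use pq in \<open>auto intro!: image_eqI[where x = "(p, q)"]\<close>)
    then show "\<bar>(G p - G (p + 1)) / (G (K1 - 2) - G (K1 - 1))\<bar> \<le> 3"
      "\<bar>(G q - G (q + 1)) / (G (K2 + 2) - G (K2 + 3))\<bar> \<le> 3" by simp_all
  qed
  have left: "\<bar>G p - G (p + 1)\<bar> \<le> 3 * \<bar>G (K1 - 2) - G (K1 - 1)\<bar>" if "p \<in> {K1 - 1, K1}" for p
    using quotients(1)[OF that, of K2] iii_denominators(1) by (intro quotient) auto
  have right: "\<bar>G q - G (q + 1)\<bar> \<le> 3 * \<bar>G (K2 + 2) - G (K2 + 3)\<bar>" if "q \<in> {K2, K2 + 1}" for q
    using quotients(2)[OF _ that, of K1] iii_denominators(2) by (intro quotient) auto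
  interpret coupled_bounds M F V f y lo hi "m2NN V (E4 M y)" "M2NN V (E4 M y)"
  proof unfold_locales
    show "grad M y k \<in> {lo..hi}" if "k \<in> Kc M \<union> Ki M \<union> {K1 + 1}" for k
      using that by (rule E(4))
    show "\<bar>G (K1 - 1) - G K1\<bar> \<le> 3 * \<bar>G (K1 - 2) - G (K1 - 1)\<bar>"
      "\<bar>G K1 - G (K1 + 1)\<bar> \<le> 3 * \<bar>G (K1 - 2) - G (K1 - 1)\<bar>"
      using left[of "K1 - 1"] left[of K1] by simp_all
    show "\<bar>G K2 - G (K2 + 1)\<bar> \<le> 3 * \<bar>G (K2 + 2) - G (K2 + 3)\<bar>"
      "\<bar>G (K2 + 1) - G (K2 + 2)\<bar> \<le> 3 * \<bar>G (K2 + 2) - G (K2 + 3)\<bar>"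
      using right[of K2] right[of "K2 + 1"] by (simp_all add: add.assoc)
  qed
  show ?thesis
    by (intro conjI estimators_equivalent[of \<kappa> fb] kappa i ii fb_periodic)
qed

end
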